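(* There exists a pseudo-functor $\mathcal R\colon \mathsf{Span}\to\mathsf{Biset}$ from the bicategory of spans of finite groupoids to the bicategory of finite bisets which is the identity on objects (finite groupoids) and which sends a span $H \xleftarrow{b} S \xrightarrow{a} G$ (a 1-cell from $H$ to $G$) to the $G,H$-biset given by the coend $$\mathcal R(b,a) := G(a-,-)\otimes_S H(-,b-) := \int^{s\in S} G(as,-)\times H(-,bs)\;\colon\; H^{\mathrm{op}}\times G\to \mathrm{set}.$$ Moreover, every biset $U\colon H^{\mathrm{op}}\times G\to\mathrm{set}$ (for finite groupoids $H,G$) is (canonically) isomorphic to $\mathcal R(b,a)$ for some span $H \xleftarrow{b} S \xrightarrow{a} G$ of finite groupoids.
   Context: A finite groupoid is a groupoid with finitely many objects and morphisms; $G(x,y)$ denotes the Hom set of a groupoid $G$; $\mathrm{set}$ is the category of finite sets. Iso-comma: for functors $T\xrightarrow{c} H\xleftarrow{b} S$ of groupoids, $c/b$ is the groupoid with objects $(t,s,\gamma)$, $t\in T$, $s\in S$, $\gamma\in H(ct,bs)$, and with morphisms $(t,s,\gamma)\to(t',s',\gamma')$ the pairs $(\varphi,\psi)\in T(t,t')\times S(s,s')$ with $\gamma' c(\varphi)=b(\psi)\gamma$. It has projections $p\colon c/b\to T$ and $q\colon c/b\to S$. The bicategory $\mathsf{Span}$: objects are finite groupoids; a 1-cell $H\to G$ is a span of functors $H\xleftarrow{b}S\xrightarrow{a}G$ with $S$ a finite groupoid. A 2-cell from $H\xleftarrow{b}S\xrightarrow{a}G$ to $H\xleftarrow{b'}S'\xrightarrow{a'}G$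 is an equivalence class $[f,\beta,\alpha]$ of triples consisting of a functor $f\colon S\to S'$ and natural isomorphisms $\beta\colon b\Rightarrow b'f$, $\alpha\colon a'f\Rightarrow a$; two triples $(f,\beta,\alpha)$ and $(\tilde f,\tilde\beta,\tilde\alpha)$ are equivalent if there is a natural isomorphism $\theta\colon f\Rightarrow\tilde f$ with $\tilde\beta=(b'\theta)\beta$ and $\alpha=\tilde\alpha(a'\theta)$. Vertical composition is by pasting. The horizontal composite of $K\xleftarrow{d}T\xrightarrow{c}H$ followed by $H\xleftarrow{b}S\xrightarrow{a}G$ is $K\xleftarrow{dp}(c/b)\xrightarrow{aq}G$; horizontal composition of 2-cells and the associativity and unit isomorphisms are those induced by the universal property of iso-comma groupoids (e.g. $[f',\beta',\alpha']$ on $T\to T'$ and $[f,\beta,\alpha]$ on $S\to S'$ induce $(t,s,\gamma)\mapsto(f't,fs,\beta_s\gamma\alpha'_t)$). The identity 1-cell of $G$ is $G=G=G$. The bicategory $\mathsf{Biset}$: objects are finite groupoids; a 1-cell $U\colon H\to G$ (a $G,H$-biset) is a functor $U\colon H^{\mathrm{op}}\times G\to\mathrm{set}$; 2-cells are natural transformations. The composite of $V\colon K\to H$ and $U\colon H\to G$ is the coend $U\circ V=U\otimes_H V=\int^{h\in H}U(h,-)\times V(-,h)\colon K^{\mathrm{op}}\times G\to\mathrm{set}$; the identity 1-cell of $G$ is the Hom functor $G(-,-)$; horizontal composition of 2-cells and coherence isomorphisms are the evident ones induced on coends. *)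

theory Defs
  imports "HOL-Library.FSet" "HOL-Library.FuncSet"
begin

section \<open>A universe for finite structures\<close>

text \<open>
  All finite groupoids and finite sets live on one type, which is closed under pairing (needed for
  iso-comma groupoids) and under formation of finite sets (needed for coends). The type of atoms is
  arbitrary, so every finite groupoid or set on any type has a copy here, obtained by
  tagging with \<open>Atom\<close>.
\<close>

datatype 'a elt = Atom 'a | Tup (tfst: "'a elt") (tsnd: "'a elt") | FinSet "'a elt fset"

definition tri :: "'a elt \<Rightarrow> 'a elt \<Rightarrow> 'a elt \<Rightarrow> 'a elt" where
  "tri x y z = Tup x (Tup y z)"

abbreviation tri1 :: "'a elt \<Rightarrow> 'a elt" where "tri1 x \<equiv> tfst x"
abbreviation tri2 :: "'a elt \<Rightarrow> 'a elt" where "tri2 x \<equiv> tfst (tsnd x)"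
abbreviation tri3 :: "'a elt \<Rightarrow> 'a elt" where "tri3 x \<equiv> tsnd (tsnd x)"

definition cprod :: "'a elt set \<Rightarrow> 'a elt set \<Rightarrow> 'a elt set" where
  "cprod A B = {Tup x y | x y. x \<in> A \<and> y \<in> B}"


section \<open>Finite groupoids, functors, natural isomorphisms\<close>

text \<open>
  Operations are total functions and only their values on the carriers matter.
  The composite \<open>cmp C g f\<close> is ``g after f''.
\<close>

record 'u cat =
  ob :: "'u set"
  ar :: "'u set"
  src :: "'u \<Rightarrow> 'u"
  tgt :: "'u \<Rightarrow> 'u"
  cmp :: "'u \<Rightarrow> 'u \<Rightarrow> 'u"
  idt :: "'u \<Rightarrow> 'u"

definition hom :: "'u cat \<Rightarrow> 'u \<Rightarrow> 'u \<Rightarrow> 'u set" where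
  "hom C x y = {f \<in> ar C. src C f = x \<and> tgt C f = y}"

locale category =
  fixes C :: "'u cat"
  assumes src_ob: "f \<in> ar C \<Longrightarrow> src C f \<in> ob C"
    and tgt_ob: "f \<in> ar C \<Longrightarrow> tgt C f \<in> ob C"
    and idt_hom: "x \<in> ob C \<Longrightarrow> idt C x \<in> hom C x x"
    and cmp_hom: "f \<in> hom C x y \<Longrightarrow> g \<in> hom C y z \<Longrightarrow> cmp C g f \<in> hom C x z"
    and cmp_assoc: "f \<in> hom C w x \<Longrightarrow> g \<in> hom C x y \<Longrightarrow> h \<in> hom C y z \<Longrightarrow>
          cmp C h (cmp C g f) = cmp C (cmp C h g) f"
    and cmp_idt: "f \<in> hom C x y \<Longrightarrow> cmp C f (idt C x) = f"
    and idt_cmp: "f \<in> hom C x y \<Longrightarrow> cmp C (idt C y) f = f"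

definition is_iso :: "'u cat \<Rightarrow> 'u \<Rightarrow> bool" where
  "is_iso C f \<longleftrightarrow> f \<in> ar C \<and>
     (\<exists>g \<in> hom C (tgt C f) (src C f).
        cmp C g f = idt C (src C f) \<and> cmp C f g = idt C (tgt C f))"

locale groupoid = category +
  assumes iso: "f \<in> ar C \<Longrightarrow> is_iso C f"

locale finite_groupoid = groupoid +
  assumes finite_ob: "finite (ob C)"
    and finite_ar: "finite (ar C)"

record 'u func =
  fdom :: "'u cat"
  fcod :: "'u cat"
  fo :: "'u \<Rightarrow> 'u"
  fa :: "'u \<Rightarrow> 'u"

locale cat_functor =
  fixes F :: "'u func"
  assumes cat_dom: "category (fdom F)"
    and cat_cod: "category (fcod F)"
    and fo_ob: "x \<in> ob (fdom F) \<Longrightarrow> fo F x \<in> ob (fcod F)"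
    and fa_hom: "f \<in> hom (fdom F) x y \<Longrightarrow> fa F f \<in> hom (fcod F) (fo F x) (fo F y)"
    and fa_idt: "x \<in> ob (fdom F) \<Longrightarrow> fa F (idt (fdom F) x) = idt (fcod F) (fo F x)"
    and fa_cmp: "f \<in> hom (fdom F) x y \<Longrightarrow> g \<in> hom (fdom F) y z \<Longrightarrow>
          fa F (cmp (fdom F) g f) = cmp (fcod F) (fa F g) (fa F f)"

definition fid :: "'u cat \<Rightarrow> 'u func" where
  "fid C = \<lparr>fdom = C, fcod = C, fo = (\<lambda>x. x), fa = (\<lambda>f. f)\<rparr>"

definition fcomp :: "'u func \<Rightarrow> 'u func \<Rightarrow> 'u func" where
  "fcomp G F = \<lparr>fdom = fdom F, fcod = fcod G, fo = fo G \<circ> fo F, fa = fa G \<circ> fa F\<rparr>"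

locale nat_iso =
  fixes F G :: "'u func" and \<tau> :: "'u \<Rightarrow> 'u"
  assumes functor_F: "cat_functor F"
    and functor_G: "cat_functor G"
    and dom_eq: "fdom F = fdom G"
    and cod_eq: "fcod F = fcod G"
    and comp_hom: "x \<in> ob (fdom F) \<Longrightarrow> \<tau> x \<in> hom (fcod F) (fo F x) (fo G x)"
    and comp_iso: "x \<in> ob (fdom F) \<Longrightarrow> is_iso (fcod F) (\<tau> x)"
    and natural: "f \<in> hom (fdom F) x y \<Longrightarrow>
          cmp (fcod F) (\<tau> y) (fa F f) = cmp (fcod F) (fa G f) (\<tau> x)"


section \<open>Bicategories and pseudo-functors\<close>

text \<open>
  2-cells know their source and target 1-cells, and 1-cells know their source and target objects.
  Compositions are written in the order of function composition.
\<close>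

record ('o, 'c, 'd) bicat =
  obj :: "'o set"
  cell1 :: "'c set"
  src1 :: "'c \<Rightarrow> 'o"
  trg1 :: "'c \<Rightarrow> 'o"
  cell2 :: "'d set"
  src2 :: "'d \<Rightarrow> 'c"
  trg2 :: "'d \<Rightarrow> 'c"
  vid :: "'c \<Rightarrow> 'd"
  vcomp :: "'d \<Rightarrow> 'd \<Rightarrow> 'd"
  id1 :: "'o \<Rightarrow> 'c"
  hcomp1 :: "'c \<Rightarrow> 'c \<Rightarrow> 'c"
  hcomp2 :: "'d \<Rightarrow> 'd \<Rightarrow> 'd"
  assoc :: "'c \<Rightarrow> 'c \<Rightarrow> 'c \<Rightarrow> 'd"
  lunit :: "'c \<Rightarrow> 'd"
  runit :: "'c \<Rightarrow> 'd"

definition one :: "('o, 'c, 'd) bicat \<Rightarrow> 'o \<Rightarrow> 'o \<Rightarrow> 'c set" where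
  "one B x y = {f \<in> cell1 B. src1 B f = x \<and> trg1 B f = y}"

definition two :: "('o, 'c, 'd) bicat \<Rightarrow> 'c \<Rightarrow> 'c \<Rightarrow> 'd set" where
  "two B f g = {\<alpha> \<in> cell2 B. src2 B \<alpha> = f \<and> trg2 B \<alpha> = g}"

definition invertible2 :: "('o, 'c, 'd) bicat \<Rightarrow> 'd \<Rightarrow> bool" where
  "invertible2 B \<alpha> \<longleftrightarrow> \<alpha> \<in> cell2 B \<and>
     (\<exists>\<beta> \<in> two B (trg2 B \<alpha>) (src2 B \<alpha>).
        vcomp B \<beta> \<alpha> = vid B (src2 B \<alpha>) \<and> vcomp B \<alpha> \<beta> = vid B (trg2 B \<alpha>))"

definition isomorphic1 :: "('o, 'c, 'd) bicat \<Rightarrow> 'c \<Rightarrow> 'c \<Rightarrow> bool" where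
  "isomorphic1 B f g \<longleftrightarrow> (\<exists>\<alpha> \<in> two B f g. invertible2 B \<alpha>)"

locale bicategory =
  fixes B :: "('o, 'c, 'd) bicat"
  assumes src1_obj: "f \<in> cell1 B \<Longrightarrow> src1 B f \<in> obj B"
    and trg1_obj: "f \<in> cell1 B \<Longrightarrow> trg1 B f \<in> obj B"
    and src2_cell: "\<alpha> \<in> cell2 B \<Longrightarrow> src2 B \<alpha> \<in> cell1 B"
    and trg2_cell: "\<alpha> \<in> cell2 B \<Longrightarrow> trg2 B \<alpha> \<in> one B (src1 B (src2 B \<alpha>)) (trg1 B (src2 B \<alpha>))"
    and vid_two: "f \<in> cell1 B \<Longrightarrow> vid B f \<in> two B f f"
    and vcomp_two: "\<alpha> \<in> two B f g \<Longrightarrow> \<beta> \<in> two B g h \<Longrightarrow> vcomp B \<beta> \<alpha> \<in> two B f h"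
    and vcomp_assoc: "\<alpha> \<in> two B f g \<Longrightarrow> \<beta> \<in> two B g h \<Longrightarrow> \<gamma> \<in> two B h k \<Longrightarrow>
          vcomp B \<gamma> (vcomp B \<beta> \<alpha>) = vcomp B (vcomp B \<gamma> \<beta>) \<alpha>"
    and vcomp_vid: "\<alpha> \<in> two B f g \<Longrightarrow> vcomp B \<alpha> (vid B f) = \<alpha>"
    and vid_vcomp: "\<alpha> \<in> two B f g \<Longrightarrow> vcomp B (vid B g) \<alpha> = \<alpha>"
    and id1_one: "x \<in> obj B \<Longrightarrow> id1 B x \<in> one B x x"
    and hcomp1_one: "f \<in> one B x y \<Longrightarrow> g \<in> one B y z \<Longrightarrow> hcomp1 B g f \<in> one B x z"
    and hcomp2_two: "f \<in> one B x y \<Longrightarrow> g \<in> one B y z \<Longrightarrow> \<alpha> \<in> two B f f' \<Longrightarrow> \<beta> \<in> two B g g' \<Longrightarrow>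
          hcomp2 B \<beta> \<alpha> \<in> two B (hcomp1 B g f) (hcomp1 B g' f')"
    and hcomp2_vid: "f \<in> one B x y \<Longrightarrow> g \<in> one B y z \<Longrightarrow>
          hcomp2 B (vid B g) (vid B f) = vid B (hcomp1 B g f)"
    and interchange: "f \<in> one B x y \<Longrightarrow> g \<in> one B y z \<Longrightarrow>
          \<alpha> \<in> two B f f' \<Longrightarrow> \<alpha>' \<in> two B f' f'' \<Longrightarrow> \<beta> \<in> two B g g' \<Longrightarrow> \<beta>' \<in> two B g' g'' \<Longrightarrow>
          hcomp2 B (vcomp B \<beta>' \<beta>) (vcomp B \<alpha>' \<alpha>) = vcomp B (hcomp2 B \<beta>' \<alpha>') (hcomp2 B \<beta> \<alpha>)"
    and assoc_two: "f \<in> one B w x \<Longrightarrow> g \<in> one B x y \<Longrightarrow> h \<in> one B y z \<Longrightarrow>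
          assoc B h g f \<in> two B (hcomp1 B (hcomp1 B h g) f) (hcomp1 B h (hcomp1 B g f))"
    and assoc_invertible: "f \<in> one B w x \<Longrightarrow> g \<in> one B x y \<Longrightarrow> h \<in> one B y z \<Longrightarrow>
          invertible2 B (assoc B h g f)"
    and assoc_natural: "f \<in> one B w x \<Longrightarrow> g \<in> one B x y \<Longrightarrow> h \<in> one B y z \<Longrightarrow>
          \<alpha> \<in> two B f f' \<Longrightarrow> \<beta> \<in> two B g g' \<Longrightarrow> \<gamma> \<in> two B h h' \<Longrightarrow>
          vcomp B (assoc B h' g' f') (hcomp2 B (hcomp2 B \<gamma> \<beta>) \<alpha>) =
          vcomp B (hcomp2 B \<gamma> (hcomp2 B \<beta> \<alpha>)) (assoc B h g f)"
    and lunit_two: "f \<in> one B x y \<Longrightarrow> lunit B f \<in> two B (hcomp1 B (id1 B y) f) f"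
    and lunit_invertible: "f \<in> cell1 B \<Longrightarrow> invertible2 B (lunit B f)"
    and lunit_natural: "f \<in> one B x y \<Longrightarrow> \<alpha> \<in> two B f f' \<Longrightarrow>
          vcomp B (lunit B f') (hcomp2 B (vid B (id1 B y)) \<alpha>) = vcomp B \<alpha> (lunit B f)"
    and runit_two: "f \<in> one B x y \<Longrightarrow> runit B f \<in> two B (hcomp1 B f (id1 B x)) f"
    and runit_invertible: "f \<in> cell1 B \<Longrightarrow> invertible2 B (runit B f)"
    and runit_natural: "f \<in> one B x y \<Longrightarrow> \<alpha> \<in> two B f f' \<Longrightarrow>
          vcomp B (runit B f') (hcomp2 B \<alpha> (vid B (id1 B x))) = vcomp B \<alpha> (runit B f)"
    and triangle: "f \<in> one B x y \<Longrightarrow> g \<in> one B y z \<Longrightarrow>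
          vcomp B (hcomp2 B (vid B g) (lunit B f)) (assoc B g (id1 B y) f) =
          hcomp2 B (runit B g) (vid B f)"
    and pentagon: "f \<in> one B v w \<Longrightarrow> g \<in> one B w x \<Longrightarrow> h \<in> one B x y \<Longrightarrow> k \<in> one B y z \<Longrightarrow>
          vcomp B (hcomp2 B (vid B k) (assoc B h g f))
            (vcomp B (assoc B k (hcomp1 B h g) f) (hcomp2 B (assoc B k h g) (vid B f))) =
          vcomp B (assoc B k h (hcomp1 B g f)) (assoc B (hcomp1 B k h) g f)"

record ('o, 'c, 'd, 'p, 'q, 'r) psfun =
  F0 :: "'o \<Rightarrow> 'p"
  F1 :: "'c \<Rightarrow> 'q"
  F2 :: "'d \<Rightarrow> 'r"
  Fcomp :: "'c \<Rightarrow> 'c \<Rightarrow> 'r"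
  Funit :: "'o \<Rightarrow> 'r"

locale pseudo_functor = B: bicategory B + D: bicategory D
  for B :: "('o, 'c, 'd) bicat" and D :: "('p, 'q, 'r) bicat" +
  fixes F :: "('o, 'c, 'd, 'p, 'q, 'r) psfun"
  assumes F0_obj: "x \<in> obj B \<Longrightarrow> F0 F x \<in> obj D"
    and F1_one: "f \<in> one B x y \<Longrightarrow> F1 F f \<in> one D (F0 F x) (F0 F y)"
    and F2_two: "\<alpha> \<in> two B f g \<Longrightarrow> F2 F \<alpha> \<in> two D (F1 F f) (F1 F g)"
    and F2_vid: "f \<in> cell1 B \<Longrightarrow> F2 F (vid B f) = vid D (F1 F f)"
    and F2_vcomp: "\<alpha> \<in> two B f g \<Longrightarrow> \<beta> \<in> two B g h \<Longrightarrow>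
          F2 F (vcomp B \<beta> \<alpha>) = vcomp D (F2 F \<beta>) (F2 F \<alpha>)"
    and Fcomp_two: "f \<in> one B x y \<Longrightarrow> g \<in> one B y z \<Longrightarrow>
          Fcomp F g f \<in> two D (hcomp1 D (F1 F g) (F1 F f)) (F1 F (hcomp1 B g f))"
    and Fcomp_invertible: "f \<in> one B x y \<Longrightarrow> g \<in> one B y z \<Longrightarrow> invertible2 D (Fcomp F g f)"
    and Fcomp_natural: "f \<in> one B x y \<Longrightarrow> g \<in> one B y z \<Longrightarrow> \<alpha> \<in> two B f f' \<Longrightarrow> \<beta> \<in> two B g g' \<Longrightarrow>
          vcomp D (Fcomp F g' f') (hcomp2 D (F2 F \<beta>) (F2 F \<alpha>)) =
          vcomp D (F2 F (hcomp2 B \<beta> \<alpha>)) (Fcomp F g f)"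
    and Funit_two: "x \<in> obj B \<Longrightarrow> Funit F x \<in> two D (id1 D (F0 F x)) (F1 F (id1 B x))"
    and Funit_invertible: "x \<in> obj B \<Longrightarrow> invertible2 D (Funit F x)"
    and F_assoc: "f \<in> one B w x \<Longrightarrow> g \<in> one B x y \<Longrightarrow> h \<in> one B y z \<Longrightarrow>
          vcomp D (F2 F (assoc B h g f))
            (vcomp D (Fcomp F (hcomp1 B h g) f) (hcomp2 D (Fcomp F h g) (vid D (F1 F f)))) =
          vcomp D (Fcomp F h (hcomp1 B g f))
            (vcomp D (hcomp2 D (vid D (F1 F h)) (Fcomp F g f)) (assoc D (F1 F h) (F1 F g) (F1 F f)))"
    and F_lunit: "f \<in> one B x y \<Longrightarrow>
          vcomp D (F2 F (lunit B f))
            (vcomp D (Fcomp F (id1 B y) f) (hcomp2 D (Funit F y) (vid D (F1 F f)))) =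
          lunit D (F1 F f)"
    and F_runit: "f \<in> one B x y \<Longrightarrow>
          vcomp D (F2 F (runit B f))
            (vcomp D (Fcomp F f (id1 B x)) (hcomp2 D (vid D (F1 F f)) (Funit F x))) =
          runit D (F1 F f)"

text \<open>2-cells as underlying data tagged with source and target.\<close>

record ('c, 'm) cell =
  csrc :: 'c
  ctrg :: 'c
  cmap :: 'm


section \<open>The bicategory of spans\<close>

text \<open>
  For \<open>c : T \<rightarrow> H\<close> and \<open>b : S \<rightarrow> H\<close>. Since a pair of arrows is a morphism between many objects, an
  arrow of the iso-comma groupoid is stored as \<open>((x, x'), (\<phi>, \<psi>))\<close> with its source and target.
\<close>

definition isocomma :: "'a elt func \<Rightarrow> 'a elt func \<Rightarrow> 'a elt cat" where
  "isocomma c b = (let T = fdom c; S = fdom b; H = fcod c;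
     Obs = {tri t s \<gamma> | t s \<gamma>. t \<in> ob T \<and> s \<in> ob S \<and> \<gamma> \<in> hom H (fo c t) (fo b s)}
   in \<lparr>ob = Obs,
       ar = {Tup (Tup x x') (Tup \<phi> \<psi>) | x x' \<phi> \<psi>. x \<in> Obs \<and> x' \<in> Obs \<and>
               \<phi> \<in> hom T (tri1 x) (tri1 x') \<and> \<psi> \<in> hom S (tri2 x) (tri2 x') \<and>
               cmp H (tri3 x') (fa c \<phi>) = cmp H (fa b \<psi>) (tri3 x)},
       src = (\<lambda>m. tfst (tfst m)),
       tgt = (\<lambda>m. tsnd (tfst m)),
       cmp = (\<lambda>n m. Tup (Tup (tfst (tfst m)) (tsnd (tfst n)))
                (Tup (cmp T (tri2 n) (tri2 m)) (cmp S (tri3 n) (tri3 m)))),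
       idt = (\<lambda>x. Tup (Tup x x) (Tup (idt T (tri1 x)) (idt S (tri2 x))))\<rparr>)"

definition proj1 :: "'a elt func \<Rightarrow> 'a elt func \<Rightarrow> 'a elt func" where
  "proj1 c b = \<lparr>fdom = isocomma c b, fcod = fdom c, fo = (\<lambda>x. tri1 x), fa = (\<lambda>m. tri2 m)\<rparr>"

definition proj2 :: "'a elt func \<Rightarrow> 'a elt func \<Rightarrow> 'a elt func" where
  "proj2 c b = \<lparr>fdom = isocomma c b, fcod = fdom b, fo = (\<lambda>x. tri2 x), fa = (\<lambda>m. tri3 m)\<rparr>"

text \<open>The span \<open>b : S \<rightarrow> H\<close>, \<open>a : S \<rightarrow> G\<close>, a 1-cell from \<open>H\<close> to \<open>G\<close>, is the pair \<open>(b, a)\<close>.\<close>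

type_synonym 'a span = "'a elt func \<times> 'a elt func"

abbreviation apex :: "'a span \<Rightarrow> 'a elt cat" where "apex X \<equiv> fdom (fst X)"

definition spans :: "'a span set" where
  "spans = {(b, a). cat_functor b \<and> cat_functor a \<and> fdom b = fdom a \<and>
     finite_groupoid (fdom b) \<and> finite_groupoid (fcod b) \<and> finite_groupoid (fcod a)}"

definition span_id :: "'a elt cat \<Rightarrow> 'a span" where
  "span_id G = (fid G, fid G)"

text \<open>Composite of \<open>(d, c)\<close> followed by \<open>(b, a)\<close>.\<close>

fun span_comp :: "'a span \<Rightarrow> 'a span \<Rightarrow> 'a span" where
  "span_comp (b, a) (d, c) = (fcomp d (proj1 c b), fcomp a (proj2 c b))"

type_synonym 'a triple = "'a elt func \<times> ('a elt \<Rightarrow> 'a elt) \<times> ('a elt \<Rightarrow> 'a elt)"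

fun is_triple :: "'a span \<Rightarrow> 'a span \<Rightarrow> 'a triple \<Rightarrow> bool" where
  "is_triple (b, a) (b', a') (f, \<beta>, \<alpha>) \<longleftrightarrow>
     cat_functor f \<and> fdom f = fdom b \<and> fcod f = fdom b' \<and>
     nat_iso b (fcomp b' f) \<beta> \<and> nat_iso (fcomp a' f) a \<alpha>"

fun triple_equiv :: "'a span \<Rightarrow> 'a span \<Rightarrow> 'a triple \<Rightarrow> 'a triple \<Rightarrow> bool" where
  "triple_equiv (b, a) (b', a') (f, \<beta>, \<alpha>) (g, \<beta>', \<alpha>') \<longleftrightarrow>
     is_triple (b, a) (b', a') (f, \<beta>, \<alpha>) \<and> is_triple (b, a) (b', a') (g, \<beta>', \<alpha>') \<and>
     (\<exists>\<theta>. nat_iso f g \<theta> \<and>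
        (\<forall>s \<in> ob (fdom b). \<beta>' s = cmp (fcod b) (fa b' (\<theta> s)) (\<beta> s) \<and>
                          \<alpha> s = cmp (fcod a) (\<alpha>' s) (fa a' (\<theta> s))))"

definition triple_class :: "'a span \<Rightarrow> 'a span \<Rightarrow> 'a triple \<Rightarrow> 'a triple set" where
  "triple_class X X' t = {t'. triple_equiv X X' t t'}"

type_synonym 'a span_cell = "('a span, 'a triple set) cell"

definition span_cell :: "'a span \<Rightarrow> 'a span \<Rightarrow> 'a triple \<Rightarrow> 'a span_cell" where
  "span_cell X X' t = \<lparr>csrc = X, ctrg = X', cmap = triple_class X X' t\<rparr>"

definition span_cells :: "'a span_cell set" where
  "span_cells = {span_cell X X' t | X X' t. X \<in> spans \<and> X' \<in> spans \<and> is_triple X X' t}"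

definition span_vid :: "'a span \<Rightarrow> 'a span_cell" where
  "span_vid X = span_cell X X
     (fid (apex X), \<lambda>s. idt (fcod (fst X)) (fo (fst X) s), \<lambda>s. idt (fcod (snd X)) (fo (snd X) s))"

text \<open>Pasting; \<open>X\<close> is the source span.\<close>

fun triple_vcomp :: "'a span \<Rightarrow> 'a triple \<Rightarrow> 'a triple \<Rightarrow> 'a triple" where
  "triple_vcomp X (f', \<beta>', \<alpha>') (f, \<beta>, \<alpha>) =
     (fcomp f' f,
      \<lambda>s. cmp (fcod (fst X)) (\<beta>' (fo f s)) (\<beta> s),
      \<lambda>s. cmp (fcod (snd X)) (\<alpha> s) (\<alpha>' (fo f s)))"

definition span_vcomp :: "'a span_cell \<Rightarrow> 'a span_cell \<Rightarrow> 'a span_cell" where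
  "span_vcomp B A = \<lparr>csrc = csrc A, ctrg = ctrg B,
     cmap = (\<Union>t' \<in> cmap B. \<Union>t \<in> cmap A.
               triple_class (csrc A) (ctrg B) (triple_vcomp (csrc A) t' t))\<rparr>"

text \<open>
  Here \<open>(f', \<beta>', \<alpha>')\<close> goes from \<open>(d, c)\<close> to \<open>(d', c')\<close>, and \<open>(f, \<beta>, \<alpha>)\<close> from \<open>(b, a)\<close> to \<open>(b', a')\<close>.
\<close>

definition isocomma_map ::
  "'a span \<Rightarrow> 'a span \<Rightarrow> 'a span \<Rightarrow> 'a span \<Rightarrow> 'a triple \<Rightarrow> 'a triple \<Rightarrow> 'a elt func" where
  "isocomma_map X X' Y Y' = (\<lambda>(f, \<beta>, \<alpha>) (f', \<beta>', \<alpha>').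
     let b = fst X; c = snd Y; b' = fst X'; c' = snd Y'; H = fcod b;
         F = (\<lambda>x. tri (fo f' (tri1 x)) (fo f (tri2 x))
                (cmp H (cmp H (\<beta> (tri2 x)) (tri3 x)) (\<alpha>' (tri1 x))))
     in \<lparr>fdom = isocomma c b, fcod = isocomma c' b', fo = F,
         fa = (\<lambda>m. Tup (Tup (F (tfst (tfst m))) (F (tsnd (tfst m))))
                (Tup (fa f' (tri2 m)) (fa f (tri3 m))))\<rparr>)"

definition triple_hcomp ::
  "'a span \<Rightarrow> 'a span \<Rightarrow> 'a span \<Rightarrow> 'a span \<Rightarrow> 'a triple \<Rightarrow> 'a triple \<Rightarrow> 'a triple" where
  "triple_hcomp X X' Y Y' = (\<lambda>(f, \<beta>, \<alpha>) (f', \<beta>', \<alpha>').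
     (isocomma_map X X' Y Y' (f, \<beta>, \<alpha>) (f', \<beta>', \<alpha>'), \<lambda>x. \<beta>' (tri1 x), \<lambda>x. \<alpha> (tri2 x)))"

definition span_hcomp :: "'a span_cell \<Rightarrow> 'a span_cell \<Rightarrow> 'a span_cell" where
  "span_hcomp B A =
    (let X = csrc B; X' = ctrg B; Y = csrc A; Y' = ctrg A;
         Z = span_comp X Y; Z' = span_comp X' Y'
     in \<lparr>csrc = Z, ctrg = Z',
         cmap = (\<Union>t \<in> cmap B. \<Union>t' \<in> cmap A. triple_class Z Z' (triple_hcomp X X' Y Y' t t'))\<rparr>)"

text \<open>Rebracketing \<open>(r, (t, s, \<gamma>), \<delta>) \<mapsto> ((r, t, \<delta>), s, \<gamma>)\<close>; both legs commute strictly.\<close>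

definition span_assoc :: "'a span \<Rightarrow> 'a span \<Rightarrow> 'a span \<Rightarrow> 'a span_cell" where
  "span_assoc Z X Y =
    (let P = span_comp (span_comp Z X) Y; Q = span_comp Z (span_comp X Y);
         l = (\<lambda>x. tri (tri1 x) (tri1 (tri2 x)) (tri3 x));
         F = (\<lambda>x. tri (l x) (tri2 (tri2 x)) (tri3 (tri2 x)))
     in span_cell P Q
          (\<lparr>fdom = apex P, fcod = apex Q, fo = F,
            fa = (\<lambda>m. let x = tfst (tfst m); x' = tsnd (tfst m); \<rho> = tri2 m; n = tri3 m
                      in Tup (Tup (F x) (F x')) (Tup (Tup (Tup (l x) (l x')) (Tup \<rho> (tri2 n))) (tri3 n)))\<rparr>,
           \<lambda>x. idt (fcod (fst P)) (fo (fst P) x),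
           \<lambda>x. idt (fcod (snd P)) (fo (snd P) x)))"

text \<open>The object \<open>(s, g, \<gamma> : a s \<rightarrow> g)\<close> of the composite with the identity of \<open>G\<close> is sent to \<open>s\<close>.\<close>

fun span_lunit :: "'a span \<Rightarrow> 'a span_cell" where
  "span_lunit (b, a) = span_cell (span_comp (span_id (fcod a)) (b, a)) (b, a)
     (proj1 a (fid (fcod a)), \<lambda>x. idt (fcod b) (fo b (tri1 x)), \<lambda>x. tri3 x)"

text \<open>The object \<open>(h, s, \<gamma> : h \<rightarrow> b s)\<close> of the composite with the identity of \<open>H\<close> is sent to \<open>s\<close>.\<close>

fun span_runit :: "'a span \<Rightarrow> 'a span_cell" where
  "span_runit (b, a) = span_cell (span_comp (b, a) (span_id (fcod b))) (b, a)
     (proj2 (fid (fcod b)) b, \<lambda>x. tri3 x, \<lambda>x. idt (fcod a) (fo a (tri2 x)))"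

definition Span :: "('a elt cat, 'a span, 'a span_cell) bicat" where
  "Span = \<lparr>obj = {G. finite_groupoid G},
     cell1 = spans, src1 = (\<lambda>X. fcod (fst X)), trg1 = (\<lambda>X. fcod (snd X)),
     cell2 = span_cells, src2 = csrc, trg2 = ctrg,
     vid = span_vid, vcomp = span_vcomp,
     id1 = span_id, hcomp1 = span_comp, hcomp2 = span_hcomp,
     assoc = span_assoc, lunit = span_lunit, runit = span_runit\<rparr>"


section \<open>The bicategory of bisets\<close>

text \<open>
  A set-valued functor \<open>U : H\<^sup>o\<^sup>p \<times> G \<rightarrow> set\<close>: \<open>po U h g\<close> is the value at \<open>(h, g)\<close>, and
  for \<open>v : h' \<rightarrow> h\<close> in \<open>H\<close> and \<open>u : g \<rightarrow> g'\<close> in \<open>G\<close> the map \<open>pa U v u\<close> goes from \<open>U(h, g)\<close> to \<open>U(h', g')\<close>.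
\<close>

record 'u prof =
  pdom :: "'u cat"
  pcod :: "'u cat"
  po :: "'u \<Rightarrow> 'u \<Rightarrow> 'u set"
  pa :: "'u \<Rightarrow> 'u \<Rightarrow> 'u \<Rightarrow> 'u"

locale biset =
  fixes U :: "'u prof"
  assumes groupoid_dom: "finite_groupoid (pdom U)"
    and groupoid_cod: "finite_groupoid (pcod U)"
    and finite_po: "h \<in> ob (pdom U) \<Longrightarrow> g \<in> ob (pcod U) \<Longrightarrow> finite (po U h g)"
    and pa_po: "v \<in> hom (pdom U) h' h \<Longrightarrow> u \<in> hom (pcod U) g g' \<Longrightarrow> x \<in> po U h g \<Longrightarrow>
          pa U v u x \<in> po U h' g'"
    and pa_idt: "h \<in> ob (pdom U) \<Longrightarrow> g \<in> ob (pcod U) \<Longrightarrow> x \<in> po U h g \<Longrightarrow>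
          pa U (idt (pdom U) h) (idt (pcod U) g) x = x"
    and pa_cmp: "v \<in> hom (pdom U) h' h \<Longrightarrow> v' \<in> hom (pdom U) h'' h' \<Longrightarrow>
          u \<in> hom (pcod U) g g' \<Longrightarrow> u' \<in> hom (pcod U) g' g'' \<Longrightarrow> x \<in> po U h g \<Longrightarrow>
          pa U (cmp (pdom U) v v') (cmp (pcod U) u' u) x = pa U v' u' (pa U v u x)"

text \<open>
  The coend of \<open>F : S\<^sup>o\<^sup>p \<times> S \<rightarrow> set\<close> is the quotient of the disjoint union of the \<open>F(s, s)\<close> by the
  equivalence relation generated by \<open>F(f, 1) x \<sim> F(1, f) x\<close> for \<open>f : s \<rightarrow> s'\<close> and \<open>x \<in> F(s', s)\<close>.
\<close>

definition coend_gen :: "'a elt prof \<Rightarrow> ('a elt \<times> 'a elt) set" where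
  "coend_gen F = (let S = pdom F in
     {(Tup s (pa F f (idt S s) x), Tup s' (pa F (idt S s') f x)) | s s' f x.
        s \<in> ob S \<and> s' \<in> ob S \<and> f \<in> hom S s s' \<and> x \<in> po F s' s})"

text \<open>The canonical map \<open>F(s, s) \<rightarrow> \<integral>\<^sup>s F(s, s)\<close>.\<close>

definition coend_in :: "'a elt prof \<Rightarrow> 'a elt \<Rightarrow> 'a elt \<Rightarrow> 'a elt" where
  "coend_in F s x = FinSet (Abs_fset {e. (Tup s x, e) \<in> (coend_gen F \<union> (coend_gen F)\<inverse>)\<^sup>*})"

definition coend :: "'a elt prof \<Rightarrow> 'a elt set" where
  "coend F = {coend_in F s x | s x. s \<in> ob (pdom F) \<and> x \<in> po F s s}"

text \<open>The map out of the coend induced by a family \<open>\<phi> s\<close> on \<open>F(s, s)\<close> compatible with the relation.\<close>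

definition coend_lift :: "'a elt prof \<Rightarrow> ('a elt \<Rightarrow> 'a elt \<Rightarrow> 'a elt) \<Rightarrow> 'a elt \<Rightarrow> 'a elt" where
  "coend_lift F \<phi> c =
     (THE d. \<exists>s x. s \<in> ob (pdom F) \<and> x \<in> po F s s \<and> c = coend_in F s x \<and> d = \<phi> s x)"

text \<open>
  For \<open>V\<close> from \<open>K\<close> to \<open>H\<close> and \<open>U\<close> from \<open>H\<close> to \<open>G\<close>, the functor
  \<open>(h', h) \<mapsto> U(h', g) \<times> V(k, h)\<close> on \<open>H\<^sup>o\<^sup>p \<times> H\<close>; its coend is the value \<open>(U \<otimes>\<^sub>H V)(k, g)\<close>.
\<close>

definition integrand :: "'a elt prof \<Rightarrow> 'a elt prof \<Rightarrow> 'a elt \<Rightarrow> 'a elt \<Rightarrow> 'a elt prof" where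
  "integrand U V k g = \<lparr>pdom = pcod V, pcod = pcod V,
     po = (\<lambda>h' h. cprod (po U h' g) (po V k h)),
     pa = (\<lambda>m n z. Tup (pa U m (idt (pcod U) g) (tfst z)) (pa V (idt (pdom V) k) n (tsnd z)))\<rparr>"

definition tensor :: "'a elt prof \<Rightarrow> 'a elt prof \<Rightarrow> 'a elt prof" where
  "tensor U V = \<lparr>pdom = pdom V, pcod = pcod U,
     po = (\<lambda>k g. coend (integrand U V k g)),
     pa = (\<lambda>v u. coend_lift (integrand U V (tgt (pdom V) v) (src (pcod U) u))
            (\<lambda>h z. coend_in (integrand U V (src (pdom V) v) (tgt (pcod U) u)) h
               (Tup (pa U (idt (pcod V) h) u (tfst z)) (pa V v (idt (pcod V) h) (tsnd z)))))\<rparr>"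

definition biset_id :: "'u cat \<Rightarrow> 'u prof" where
  "biset_id G = \<lparr>pdom = G, pcod = G, po = hom G, pa = (\<lambda>v u x. cmp G u (cmp G x v))\<rparr>"

text \<open>
  2-cells are compared by equality, hence components are extended by \<^const>\<open>undefined\<close> outside
  \<open>U(h, g)\<close>.
\<close>

type_synonym 'u biset_cell = "('u prof, 'u \<Rightarrow> 'u \<Rightarrow> 'u \<Rightarrow> 'u) cell"

definition biset_cell :: "'u prof \<Rightarrow> 'u prof \<Rightarrow> ('u \<Rightarrow> 'u \<Rightarrow> 'u \<Rightarrow> 'u) \<Rightarrow> 'u biset_cell" where
  "biset_cell U U' \<tau> = \<lparr>csrc = U, ctrg = U',
     cmap = (\<lambda>h g x. if h \<in> ob (pdom U) \<and> g \<in> ob (pcod U) \<and> x \<in> po U h g then \<tau> h g x else undefined)\<rparr>"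

definition is_nat :: "'u prof \<Rightarrow> 'u prof \<Rightarrow> ('u \<Rightarrow> 'u \<Rightarrow> 'u \<Rightarrow> 'u) \<Rightarrow> bool" where
  "is_nat U U' \<tau> \<longleftrightarrow> pdom U = pdom U' \<and> pcod U = pcod U' \<and>
     (\<forall>h \<in> ob (pdom U). \<forall>g \<in> ob (pcod U). \<tau> h g \<in> po U h g \<rightarrow> po U' h g) \<and>
     (\<forall>h \<in> ob (pdom U). \<forall>h' \<in> ob (pdom U). \<forall>g \<in> ob (pcod U). \<forall>g' \<in> ob (pcod U).
        \<forall>v \<in> hom (pdom U) h' h. \<forall>u \<in> hom (pcod U) g g'. \<forall>x \<in> po U h g.
          \<tau> h' g' (pa U v u x) = pa U' v u (\<tau> h g x))"

definition biset_cells :: "'u biset_cell set" where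
  "biset_cells = {biset_cell U U' \<tau> | U U' \<tau>. biset U \<and> biset U' \<and> is_nat U U' \<tau>}"

definition biset_vid :: "'u prof \<Rightarrow> 'u biset_cell" where
  "biset_vid U = biset_cell U U (\<lambda>h g x. x)"

definition biset_vcomp :: "'u biset_cell \<Rightarrow> 'u biset_cell \<Rightarrow> 'u biset_cell" where
  "biset_vcomp B A = biset_cell (csrc A) (ctrg B) (\<lambda>h g x. cmap B h g (cmap A h g x))"

definition biset_hcomp :: "'a elt biset_cell \<Rightarrow> 'a elt biset_cell \<Rightarrow> 'a elt biset_cell" where
  "biset_hcomp B A =
    (let U = csrc B; U' = ctrg B; V = csrc A; V' = ctrg A
     in biset_cell (tensor U V) (tensor U' V')
          (\<lambda>k g. coend_lift (integrand U V k g)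
             (\<lambda>h z. coend_in (integrand U' V' k g) h
                (Tup (cmap B h g (tfst z)) (cmap A k h (tsnd z))))))"

text \<open>\<open>[k, ([h, (w, u)], v)] \<mapsto> [h, (w, [k, (u, v)])]\<close>\<close>

definition biset_assoc :: "'a elt prof \<Rightarrow> 'a elt prof \<Rightarrow> 'a elt prof \<Rightarrow> 'a elt biset_cell" where
  "biset_assoc W U V = biset_cell (tensor (tensor W U) V) (tensor W (tensor U V))
     (\<lambda>l g. coend_lift (integrand (tensor W U) V l g)
        (\<lambda>k z. coend_lift (integrand W U k g)
           (\<lambda>h y. coend_in (integrand W (tensor U V) l g) h
              (Tup (tfst y) (coend_in (integrand U V l h) k (Tup (tsnd y) (tsnd z)))))
           (tfst z)))"

definition biset_lunit :: "'a elt prof \<Rightarrow> 'a elt biset_cell" where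
  "biset_lunit U = biset_cell (tensor (biset_id (pcod U)) U) U
     (\<lambda>h g. coend_lift (integrand (biset_id (pcod U)) U h g)
        (\<lambda>g' z. pa U (idt (pdom U) h) (tfst z) (tsnd z)))"

definition biset_runit :: "'a elt prof \<Rightarrow> 'a elt biset_cell" where
  "biset_runit U = biset_cell (tensor U (biset_id (pdom U))) U
     (\<lambda>h g. coend_lift (integrand U (biset_id (pdom U)) h g)
        (\<lambda>h' z. pa U (tsnd z) (idt (pcod U) g) (tfst z)))"

definition Biset :: "('a elt cat, 'a elt prof, 'a elt biset_cell) bicat" where
  "Biset = \<lparr>obj = {G. finite_groupoid G},
     cell1 = {U. biset U}, src1 = pdom, trg1 = pcod,
     cell2 = biset_cells, src2 = csrc, trg2 = ctrg,
     vid = biset_vid, vcomp = biset_vcomp,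
     id1 = biset_id, hcomp1 = tensor, hcomp2 = biset_hcomp,
     assoc = biset_assoc, lunit = biset_lunit, runit = biset_runit\<rparr>"


section \<open>Representable bisets\<close>

text \<open>
  For a span \<open>(b, a)\<close>, the biset \<open>tensor (hom_from a) (hom_to b)\<close> is the coend over \<open>s\<close> in \<open>S\<close> of
  \<open>G(a s, -) \<times> H(-, b s)\<close>.
\<close>

text \<open>\<open>G(a-, -) : S\<^sup>o\<^sup>p \<times> G \<rightarrow> set\<close> for \<open>a : S \<rightarrow> G\<close>\<close>

definition hom_from :: "'u func \<Rightarrow> 'u prof" where
  "hom_from a = \<lparr>pdom = fdom a, pcod = fcod a,
     po = (\<lambda>s g. hom (fcod a) (fo a s) g),
     pa = (\<lambda>f u x. cmp (fcod a) u (cmp (fcod a) x (fa a f)))\<rparr>"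

text \<open>\<open>H(-, b-) : H\<^sup>o\<^sup>p \<times> S \<rightarrow> set\<close> for \<open>b : S \<rightarrow> H\<close>\<close>

definition hom_to :: "'u func \<Rightarrow> 'u prof" where
  "hom_to b = \<lparr>pdom = fcod b, pcod = fdom b,
     po = (\<lambda>h s. hom (fcod b) h (fo b s)),
     pa = (\<lambda>v f y. cmp (fcod b) (fa b f) (cmp (fcod b) y v))\<rparr>"

end

theory Submission
  imports Defs
begin

text \<open>
  On a 2-cell \<open>[f, \<beta>, \<alpha>]\<close> the pseudo-functor sends the class \<open>[s, (x, y)]\<close> of \<open>x : a s \<rightarrow> g\<close> and
  \<open>y : h \<rightarrow> b s\<close> to \<open>[f s, (x \<alpha>\<^sub>s, \<beta>\<^sub>s y)]\<close>; passing to an isomorphic functor changes this representative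
  by one generating relation of the coend. The comparison of composites is
  \<open>[h, ([s, (x, y)], [t, (z, w)])] \<mapsto> [(t, s, y z), (x, w)]\<close>, with inverse
  \<open>[(t, s, \<gamma>), (x, w)] \<mapsto> [b s, ([s, (x, 1)], [t, (\<gamma>, w)])]\<close>. By the universal property of coends all
  coherence equations need to be checked only on such classes, where they amount to associativity
  in the groupoids; in the bicategory of spans most of them hold strictly on representatives.
  A biset \<open>U\<close> comes from the span of projections of its category of elements, since
  \<open>[(h', g', x), (u, v)] \<mapsto> U(v, u) x\<close> is invertible.
\<close>

section \<open>Categories and functors\<close>

text \<open>The bicategory axioms are equations between 2-cells, while all data are total functions
  that matter only on carriers. On the biset side components are \<open>undefined\<close> off the
  carriers, so agreement there is equality. On the span side two triples that agree on the carriers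
  may be different functions, but the identity transformation makes them equivalent, so their
  classes coincide; the same quotient absorbs the unitors, which are invertible only up to an
  isomorphism of functors. The price is well-definedness. Compositions of span cells must not depend
  on representatives, and a map out of an iterated tensor product has to be balanced once for every
  coend sign, where entries of classes are again classes. Rewriting uses one normal form: composites
  nest to the right, and successive actions on a biset merge into one. Laws that consume a composite
  therefore often come in a second version with a further arrow composed on the right, since right
  nesting destroys the subterm that the plain law matches.\<close>

lemma hom_iff: "f \<in> hom C x y \<longleftrightarrow> f \<in> ar C \<and> src C f = x \<and> tgt C f = y"
  by (simp add: hom_def)

context category
begin

lemma idt_ar: "x \<in> ob C \<Longrightarrow> idt C x \<in> ar C"
  and src_idt: "x \<in> ob C \<Longrightarrow> src C (idt C x) = x"
  and tgt_idt: "x \<in> ob C \<Longrightarrow> tgt C (idt C x) = x"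
  using idt_hom[of x] by (auto simp: hom_iff)

lemma cmp_ar: "f \<in> ar C \<Longrightarrow> g \<in> ar C \<Longrightarrow> src C g = tgt C f \<Longrightarrow> cmp C g f \<in> ar C"
  and src_cmp: "f \<in> ar C \<Longrightarrow> g \<in> ar C \<Longrightarrow> src C g = tgt C f \<Longrightarrow> src C (cmp C g f) = src C f"
  and tgt_cmp: "f \<in> ar C \<Longrightarrow> g \<in> ar C \<Longrightarrow> src C g = tgt C f \<Longrightarrow> tgt C (cmp C g f) = tgt C g"
  using cmp_hom[of f "src C f" "tgt C f" g "tgt C g"] by (auto simp: hom_iff)

lemma cmp_cmp: "f \<in> ar C \<Longrightarrow> g \<in> ar C \<Longrightarrow> h \<in> ar C \<Longrightarrow> src C g = tgt C f \<Longrightarrow> src C h = tgt C g \<Longrightarrow>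
    cmp C (cmp C h g) f = cmp C h (cmp C g f)"
  using cmp_assoc[of f "src C f" "tgt C f" g "tgt C g" h "tgt C h"] by (auto simp: hom_iff)

lemma cmp_idt_right: "f \<in> ar C \<Longrightarrow> src C f = x \<Longrightarrow> cmp C f (idt C x) = f"
  and cmp_idt_left: "f \<in> ar C \<Longrightarrow> tgt C f = x \<Longrightarrow> cmp C (idt C x) f = f"
  using cmp_idt[of f x "tgt C f"] idt_cmp[of f "src C f" x] by (auto simp: hom_iff)

end

text \<open>These rules fix the normal form: composites nest to the right, identities disappear, and
  side conditions speak of sources and targets, which simp can compute, rather than of membership in
  hom sets.\<close>

lemmas category_simps [simp] =
  category.src_ob category.tgt_ob category.idt_ar category.src_idt category.tgt_idt category.cmp_ar
  category.src_cmp category.tgt_cmp category.cmp_cmp category.cmp_idt_right category.cmp_idt_left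

lemma finite_groupoid_groupoid [simp]: "finite_groupoid C \<Longrightarrow> groupoid C"
  by (rule finite_groupoid.axioms)

lemma finite_groupoid_category [simp]: "finite_groupoid C \<Longrightarrow> category C"
  by (intro groupoid.axioms(1) finite_groupoid_groupoid)

lemma categoryI:
  assumes "\<And>f. f \<in> ar C \<Longrightarrow> src C f \<in> ob C \<and> tgt C f \<in> ob C"
    and "\<And>x. x \<in> ob C \<Longrightarrow> idt C x \<in> ar C \<and> src C (idt C x) = x \<and> tgt C (idt C x) = x"
    and "\<And>f g. f \<in> ar C \<Longrightarrow> g \<in> ar C \<Longrightarrow> src C g = tgt C f \<Longrightarrow>
          cmp C g f \<in> ar C \<and> src C (cmp C g f) = src C f \<and> tgt C (cmp C g f) = tgt C g"
    and "\<And>f g h. f \<in> ar C \<Longrightarrow> g \<in> ar C \<Longrightarrow> h \<in> ar C \<Longrightarrow> src C g = tgt C f \<Longrightarrow> src C h = tgt C g \<Longrightarrow>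
          cmp C h (cmp C g f) = cmp C (cmp C h g) f"
    and "\<And>f. f \<in> ar C \<Longrightarrow> cmp C f (idt C (src C f)) = f \<and> cmp C (idt C (tgt C f)) f = f"
  shows "category C"
  by unfold_locales (use assms in \<open>auto simp: hom_iff\<close>)

lemma groupoidI:
  assumes "category C"
    and "\<And>f. f \<in> ar C \<Longrightarrow> \<exists>g \<in> ar C. src C g = tgt C f \<and> tgt C g = src C f \<and>
          cmp C g f = idt C (src C f) \<and> cmp C f g = idt C (tgt C f)"
  shows "groupoid C"
  using assms by (fastforce simp: groupoid_def groupoid_axioms_def is_iso_def hom_iff Bex_def)

text \<open>\<open>is_iso\<close> only asserts that an inverse exists; a chosen one can occur in
  simp rules and in witnesses.\<close>

definition inv_ar :: "'u cat \<Rightarrow> 'u \<Rightarrow> 'u" where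
  "inv_ar C f = (SOME g. g \<in> hom C (tgt C f) (src C f) \<and>
     cmp C g f = idt C (src C f) \<and> cmp C f g = idt C (tgt C f))"

context groupoid
begin

lemma inv_ar:
  assumes "f \<in> ar C"
  shows "inv_ar C f \<in> ar C" "src C (inv_ar C f) = tgt C f" "tgt C (inv_ar C f) = src C f"
    "cmp C (inv_ar C f) f = idt C (src C f)" "cmp C f (inv_ar C f) = idt C (tgt C f)"
proof -
  have "\<exists>g. g \<in> hom C (tgt C f) (src C f) \<and>
     cmp C g f = idt C (src C f) \<and> cmp C f g = idt C (tgt C f)"
    using iso[OF assms] by (auto simp: is_iso_def)
  from someI_ex[OF this]
  show "inv_ar C f \<in> ar C" "src C (inv_ar C f) = tgt C f" "tgt C (inv_ar C f) = src C f"
    "cmp C (inv_ar C f) f = idt C (src C f)" "cmp C f (inv_ar C f) = idt C (tgt C f)"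
    unfolding inv_ar_def[symmetric] by (auto simp: hom_iff)
qed

end

lemmas inv_ar_simps [simp] = groupoid.inv_ar

text \<open>Right nesting breaks up the composite of \<open>inv_ar C f\<close> and \<open>f\<close>,
  so cancellation against a tail \<open>h\<close> is stated separately. The inverse law is switched
  off in the first step to keep the bracket from collapsing before it is reassociated.\<close>

lemma inv_ar_cmp [simp]:
  assumes "groupoid C" "f \<in> ar C" "h \<in> ar C" "src C f = tgt C h"
  shows "cmp C (inv_ar C f) (cmp C f h) = h"
proof -
  have C: "category C"
    using assms(1) by (rule groupoid.axioms)
  have "cmp C (inv_ar C f) (cmp C f h) = cmp C (cmp C (inv_ar C f) f) h"
    using assms C by (simp del: groupoid.inv_ar(4))
  then show ?thesis
    using assms C by simp
qed

section \<open>Functor laws in rewriting form\<close>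

context cat_functor
begin

text \<open>Domain and codomain enter through equations, so that the rules also match where a
  groupoid is written differently, for instance as the domain of the other leg of a span.\<close>

lemma fo_in: "fdom F = S \<Longrightarrow> fcod F = H \<Longrightarrow> x \<in> ob S \<Longrightarrow> fo F x \<in> ob H"
  using fo_ob by auto

lemma fa_ar: "fcod F = H \<Longrightarrow> f \<in> ar (fdom F) \<Longrightarrow> fa F f \<in> ar H"
  and src_fa: "fcod F = H \<Longrightarrow> f \<in> ar (fdom F) \<Longrightarrow> src H (fa F f) = fo F (src (fdom F) f)"
  and tgt_fa: "fcod F = H \<Longrightarrow> f \<in> ar (fdom F) \<Longrightarrow> tgt H (fa F f) = fo F (tgt (fdom F) f)"
  using fa_hom[of f "src (fdom F) f" "tgt (fdom F) f"] by (auto simp: hom_iff)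

lemma fa_idt': "fdom F = S \<Longrightarrow> x \<in> ob S \<Longrightarrow> fa F (idt S x) = idt (fcod F) (fo F x)"
  using fa_idt by auto

lemma fa_cmp': "fdom F = S \<Longrightarrow> f \<in> ar S \<Longrightarrow> g \<in> ar S \<Longrightarrow> src S g = tgt S f \<Longrightarrow>
    fa F (cmp S g f) = cmp (fcod F) (fa F g) (fa F f)"
  using fa_cmp[of f "src S f" "tgt S f" g "tgt S g"] by (auto simp: hom_iff)

end

lemma functor_fo_in [simp]: "cat_functor F \<Longrightarrow> fcod F = H \<Longrightarrow> x \<in> ob (fdom F) \<Longrightarrow> fo F x \<in> ob H"
  by (auto intro: cat_functor.fo_in)

lemmas functor_simps [simp] = cat_functor.fa_ar cat_functor.src_fa cat_functor.tgt_fa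
  cat_functor.fa_idt' cat_functor.fa_cmp'

lemma cat_functorI:
  assumes "category (fdom F)" "category (fcod F)"
    and "\<And>x. x \<in> ob (fdom F) \<Longrightarrow> fo F x \<in> ob (fcod F)"
    and "\<And>f. f \<in> ar (fdom F) \<Longrightarrow> fa F f \<in> ar (fcod F) \<and>
          src (fcod F) (fa F f) = fo F (src (fdom F) f) \<and> tgt (fcod F) (fa F f) = fo F (tgt (fdom F) f)"
    and "\<And>x. x \<in> ob (fdom F) \<Longrightarrow> fa F (idt (fdom F) x) = idt (fcod F) (fo F x)"
    and "\<And>f g. f \<in> ar (fdom F) \<Longrightarrow> g \<in> ar (fdom F) \<Longrightarrow> src (fdom F) g = tgt (fdom F) f \<Longrightarrow>
          fa F (cmp (fdom F) g f) = cmp (fcod F) (fa F g) (fa F f)"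
  shows "cat_functor F"
  by unfold_locales (use assms in \<open>auto simp: hom_iff\<close>)

lemma fid_simps [simp]: "fdom (fid C) = C" "fcod (fid C) = C" "fo (fid C) x = x" "fa (fid C) f = f"
  by (simp_all add: fid_def)

lemma fcomp_simps [simp]: "fdom (fcomp G F) = fdom F" "fcod (fcomp G F) = fcod G"
  "fo (fcomp G F) x = fo G (fo F x)" "fa (fcomp G F) f = fa G (fa F f)"
  by (simp_all add: fcomp_def)

lemma fid_functor [simp]: "category C \<Longrightarrow> cat_functor (fid C)"
  by (rule cat_functorI) auto

lemma fcomp_functor [simp]:
  assumes "cat_functor F" "cat_functor G" "fcod F = fdom G"
  shows "cat_functor (fcomp G F)"
  by (rule cat_functorI)
    (use assms in \<open>auto simp: cat_functor.cat_dom cat_functor.cat_cod\<close>)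

section \<open>Coends\<close>

definition coend_rel :: "'a elt prof \<Rightarrow> ('a elt \<times> 'a elt) set" where
  "coend_rel F = (coend_gen F \<union> (coend_gen F)\<inverse>)\<^sup>*"

lemma equiv_coend_rel: "equiv UNIV (coend_rel F)"
  unfolding coend_rel_def
  by (intro equivI refl_rtrancl trans_rtrancl sym_rtrancl sym_Un_converse) auto

lemma coend_in_rel: "coend_in F s x = FinSet (Abs_fset (coend_rel F `` {Tup s x}))"
  by (simp add: coend_in_def coend_rel_def Image_singleton)

text \<open>These conditions keep the generating relation inside the finite disjoint union of the
  sets \<open>po F s s\<close>. Classes are then finite, which is what \<open>Abs_fset\<close> needs
  in order to be injective on them.\<close>

locale coendable =
  fixes F :: "'a elt prof"
  assumes idt_ob: "s \<in> ob (pdom F) \<Longrightarrow> idt (pdom F) s \<in> hom (pdom F) s s"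
    and finite_ob: "finite (ob (pdom F))"
    and finite_po: "s \<in> ob (pdom F) \<Longrightarrow> finite (po F s s)"
    and left_po: "s \<in> ob (pdom F) \<Longrightarrow> s' \<in> ob (pdom F) \<Longrightarrow> f \<in> hom (pdom F) s s' \<Longrightarrow> x \<in> po F s' s \<Longrightarrow>
          pa F f (idt (pdom F) s) x \<in> po F s s"
    and right_po: "s \<in> ob (pdom F) \<Longrightarrow> s' \<in> ob (pdom F) \<Longrightarrow> f \<in> hom (pdom F) s s' \<Longrightarrow> x \<in> po F s' s \<Longrightarrow>
          pa F (idt (pdom F) s') f x \<in> po F s' s'"
begin

definition pts :: "'a elt set" where
  "pts = (\<Union>s \<in> ob (pdom F). Tup s ` po F s s)"

lemma finite_pts: "finite pts"
  unfolding pts_def using finite_ob finite_po by auto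

lemma coend_gen_pts: "coend_gen F \<subseteq> pts \<times> pts"
  using left_po right_po by (fastforce simp: coend_gen_def Let_def pts_def)

lemma coend_rel_pts:
  assumes "(p, q) \<in> coend_rel F" "p \<in> pts"
  shows "q \<in> pts"
  using assms(1) unfolding coend_rel_def
  by (induction rule: rtrancl_induct) (use assms(2) coend_gen_pts in auto)

lemma finite_class: "p \<in> pts \<Longrightarrow> finite (coend_rel F `` {p})"
  by (rule finite_subset[OF _ finite_pts]) (auto intro: coend_rel_pts)

text \<open>\<open>Abs_fset\<close> is injective on finite sets only; equal values of
  \<open>coend_in\<close> can be traced back to related points because classes of points are
  finite.\<close>

lemma coend_in_eqD:
  assumes "coend_in F s x = coend_in F s' x'" "Tup s x \<in> pts" "Tup s' x' \<in> pts"
  shows "(Tup s x, Tup s' x') \<in> coend_rel F"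
proof -
  have "coend_rel F `` {Tup s x} = coend_rel F `` {Tup s' x'}"
    using assms finite_class by (simp add: coend_in_rel Abs_fset_inject)
  then show ?thesis
    using equiv_coend_rel by (metis UNIV_I equiv_class_eq_iff)
qed

lemma coend_in_glue:
  assumes "f \<in> hom (pdom F) s s'" "s \<in> ob (pdom F)" "s' \<in> ob (pdom F)" "x \<in> po F s' s"
  shows "coend_in F s (pa F f (idt (pdom F) s) x) = coend_in F s' (pa F (idt (pdom F) s') f x)"
proof -
  have "(Tup s (pa F f (idt (pdom F) s) x), Tup s' (pa F (idt (pdom F) s') f x)) \<in> coend_rel F"
    unfolding coend_rel_def using assms
    by (intro r_into_rtrancl UnI1) (auto simp: coend_gen_def Let_def)
  then show ?thesis
    unfolding coend_in_rel using equiv_coend_rel by (metis equiv_class_eq)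
qed

text \<open>The universal property: a family that agrees on the generators is constant along the
  equivalence closure, which gives the uniqueness required by the definite description.\<close>

lemma coend_lift:
  assumes compat: "\<And>s s' f x. f \<in> hom (pdom F) s s' \<Longrightarrow> s \<in> ob (pdom F) \<Longrightarrow> s' \<in> ob (pdom F) \<Longrightarrow>
      x \<in> po F s' s \<Longrightarrow> \<phi> s (pa F f (idt (pdom F) s) x) = \<phi> s' (pa F (idt (pdom F) s') f x)"
    and s: "s \<in> ob (pdom F)" and x: "x \<in> po F s s"
  shows "coend_lift F \<phi> (coend_in F s x) = \<phi> s x"
proof -
  \<comment> \<open>The family as one function on pairs, so that it can be followed along a chain of
    generators by induction.\<close>
  define \<psi> where "\<psi> e = \<phi> (tfst e) (tsnd e)" for e
  have gen: "\<psi> p = \<psi> q" if "(p, q) \<in> coend_gen F" for p q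
    using that compat by (auto simp: coend_gen_def Let_def \<psi>_def)
  have rel: "\<psi> p = \<psi> q" if "(p, q) \<in> coend_rel F" for p q
    using that unfolding coend_rel_def by (induction rule: rtrancl_induct) (auto dest: gen)
  have "\<phi> s' x' = \<phi> s x"
    if "s' \<in> ob (pdom F)" "x' \<in> po F s' s'" "coend_in F s x = coend_in F s' x'" for s' x'
    using rel[OF coend_in_eqD[OF that(3)]] that s x by (force simp: \<psi>_def pts_def)
  then show ?thesis
    unfolding coend_lift_def using s x by (intro the_equality) blast+
qed

lemma finite_coend: "finite (coend F)"
proof -
  have "coend F = (\<lambda>e. coend_in F (tfst e) (tsnd e)) ` pts"
    by (force simp: coend_def pts_def)
  then show ?thesis
    using finite_pts by simp
qed

end

section \<open>Bisets and their tensor product\<close>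

lemma biset_groupoid [simp]: "biset U \<Longrightarrow> finite_groupoid (pdom U)"
  "biset U \<Longrightarrow> finite_groupoid (pcod U)"
  by (auto simp: biset_def)

lemma pa_in [simp]:
  assumes "biset U" "v \<in> ar (pdom U)" "u \<in> ar (pcod U)" "src (pdom U) v = h'" "tgt (pcod U) u = g'"
    "x \<in> po U (tgt (pdom U) v) (src (pcod U) u)"
  shows "pa U v u x \<in> po U h' g'"
  using assms biset.pa_po[of U v h' "tgt (pdom U) v" u "src (pcod U) u" g'] by (auto simp: hom_iff)

lemma pa_idt [simp]:
  assumes "biset U" "pdom U = H" "pcod U = G" "h \<in> ob H" "g \<in> ob G" "x \<in> po U h g"
  shows "pa U (idt H h) (idt G g) x = x"
  using assms biset.pa_idt by auto

text \<open>The composition axiom read backwards: successive actions merge into one, and the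
  composites that arise are then normalised in the groupoids.\<close>

lemma pa_pa [simp]:
  assumes "biset U" "v \<in> ar (pdom U)" "v' \<in> ar (pdom U)" "src (pdom U) v = tgt (pdom U) v'"
    "u \<in> ar (pcod U)" "u' \<in> ar (pcod U)" "src (pcod U) u' = tgt (pcod U) u"
    "x \<in> po U (tgt (pdom U) v) (src (pcod U) u)"
  shows "pa U v' u' (pa U v u x) = pa U (cmp (pdom U) v v') (cmp (pcod U) u' u) x"
  using assms biset.pa_cmp[of U v "src (pdom U) v" "tgt (pdom U) v" v' "src (pdom U) v'" u
      "src (pcod U) u" "tgt (pcod U) u" u' "tgt (pcod U) u'" x] by (auto simp: hom_iff)

lemma bisetI:
  assumes "finite_groupoid (pdom U)" "finite_groupoid (pcod U)"
    and "\<And>h g. h \<in> ob (pdom U) \<Longrightarrow> g \<in> ob (pcod U) \<Longrightarrow> finite (po U h g)"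
    and "\<And>v u x. v \<in> ar (pdom U) \<Longrightarrow> u \<in> ar (pcod U) \<Longrightarrow> x \<in> po U (tgt (pdom U) v) (src (pcod U) u) \<Longrightarrow>
          pa U v u x \<in> po U (src (pdom U) v) (tgt (pcod U) u)"
    and "\<And>h g x. h \<in> ob (pdom U) \<Longrightarrow> g \<in> ob (pcod U) \<Longrightarrow> x \<in> po U h g \<Longrightarrow>
          pa U (idt (pdom U) h) (idt (pcod U) g) x = x"
    and "\<And>v v' u u' x. v \<in> ar (pdom U) \<Longrightarrow> v' \<in> ar (pdom U) \<Longrightarrow> src (pdom U) v = tgt (pdom U) v' \<Longrightarrow>
          u \<in> ar (pcod U) \<Longrightarrow> u' \<in> ar (pcod U) \<Longrightarrow> src (pcod U) u' = tgt (pcod U) u \<Longrightarrow>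
          x \<in> po U (tgt (pdom U) v) (src (pcod U) u) \<Longrightarrow>
          pa U (cmp (pdom U) v v') (cmp (pcod U) u' u) x = pa U v' u' (pa U v u x)"
  shows "biset U"
  by (rule biset.intro) (use assms in \<open>auto simp: hom_iff\<close>)

section \<open>Hom bisets of groupoids and functors\<close>

lemma biset_id_simps [simp]: "pdom (biset_id G) = G" "pcod (biset_id G) = G"
  "x \<in> po (biset_id G) g g' \<longleftrightarrow> x \<in> hom G g g'"
  "pa (biset_id G) v u x = cmp G u (cmp G x v)"
  by (simp_all add: biset_id_def)

lemma hom_from_simps [simp]: "pdom (hom_from a) = fdom a" "pcod (hom_from a) = fcod a"
  "x \<in> po (hom_from a) s g \<longleftrightarrow> x \<in> hom (fcod a) (fo a s) g"
  "pa (hom_from a) f u x = cmp (fcod a) u (cmp (fcod a) x (fa a f))"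
  by (simp_all add: hom_from_def)

lemma hom_to_simps [simp]: "pdom (hom_to b) = fcod b" "pcod (hom_to b) = fdom b"
  "x \<in> po (hom_to b) h s \<longleftrightarrow> x \<in> hom (fcod b) h (fo b s)"
  "pa (hom_to b) v f y = cmp (fcod b) (fa b f) (cmp (fcod b) y v)"
  by (simp_all add: hom_to_def)

lemma finite_hom: "finite_groupoid G \<Longrightarrow> finite (hom G x y)"
  by (rule finite_subset[OF _ finite_groupoid.finite_ar]) (auto simp: hom_iff)

lemma biset_id_biset [simp]: "finite_groupoid G \<Longrightarrow> biset (biset_id G)"
  by (rule bisetI) (auto simp: hom_iff, simp add: finite_hom biset_id_def)

lemma hom_from_biset [simp]:
  "cat_functor a \<Longrightarrow> finite_groupoid (fdom a) \<Longrightarrow> finite_groupoid (fcod a) \<Longrightarrow> biset (hom_from a)"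
  by (rule bisetI) (auto simp: hom_iff, simp add: finite_hom hom_from_def)

lemma hom_to_biset [simp]:
  "cat_functor b \<Longrightarrow> finite_groupoid (fdom b) \<Longrightarrow> finite_groupoid (fcod b) \<Longrightarrow> biset (hom_to b)"
  by (rule bisetI) (auto simp: hom_iff, simp add: finite_hom hom_to_def)

text \<open>The elementary class \<open>[h, (x, y)]\<close>. A name of its own keeps simp from
  looking inside the coend; maps out of a tensor product are computed by their values on such
  terms.\<close>

definition tensor_in :: "'a elt prof \<Rightarrow> 'a elt prof \<Rightarrow> 'a elt \<Rightarrow> 'a elt \<Rightarrow> 'a elt \<Rightarrow> 'a elt \<Rightarrow> 'a elt \<Rightarrow> 'a
    elt" where
  "tensor_in U V k g h x y = coend_in (integrand U V k g) h (Tup x y)"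

lemma integrand_simps [simp]: "pdom (integrand U V k g) = pcod V"
  "po (integrand U V k g) h' h = cprod (po U h' g) (po V k h)"
  "pa (integrand U V k g) m n z =
    Tup (pa U m (idt (pcod U) g) (tfst z)) (pa V (idt (pdom V) k) n (tsnd z))"
  by (simp_all add: integrand_def)

lemma Tup_cprod [simp]: "Tup x y \<in> cprod A B \<longleftrightarrow> x \<in> A \<and> y \<in> B"
  by (auto simp: cprod_def)

lemma cprod_image: "cprod A B = (\<lambda>(x, y). Tup x y) ` (A \<times> B)"
  by (auto simp: cprod_def)

lemma coendable_integrand:
  assumes "biset U" "biset V" "pdom U = pcod V" "k \<in> ob (pdom V)" "g \<in> ob (pcod U)"
  shows "coendable (integrand U V k g)"
proof -
  have fin: "finite_groupoid (pcod V)"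
    using assms by simp
  show ?thesis
    by unfold_locales
      (use assms fin finite_groupoid.finite_ob[OF fin] biset.finite_po[OF assms(1)]
        biset.finite_po[OF assms(2)] in \<open>auto simp: hom_iff cprod_image\<close>)
qed

lemma tensor_simps [simp]: "pdom (tensor U V) = pdom V" "pcod (tensor U V) = pcod U"
  by (simp_all add: tensor_def)

lemma tensor_in_po [simp]: "h \<in> ob (pcod V) \<Longrightarrow> x \<in> po U h g \<Longrightarrow> y \<in> po V k h \<Longrightarrow>
    tensor_in U V k g h x y \<in> po (tensor U V) k g"
  by (auto simp: tensor_def coend_def tensor_in_def intro!: exI)

lemma tensorE:
  assumes "c \<in> po (tensor U V) k g"
  obtains h x y where "c = tensor_in U V k g h x y" "h \<in> ob (pcod V)" "x \<in> po U h g" "y \<in> po V k h"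
  using assms by (auto simp: tensor_def coend_def tensor_in_def cprod_def)

text \<open>The balancing relation over the middle groupoid. It is not a default simp rule, because
  some proofs push an arrow from the left factor to the right one and others pull it back.\<close>

lemma tensor_in_glue:
  assumes "biset U" "biset V" "pdom U = pcod V" "pcod U = G" "k \<in> ob (pdom V)" "g \<in> ob G"
    "m \<in> ar (pcod V)" "src (pcod V) m = h" "x \<in> po U (tgt (pcod V) m) g" "y \<in> po V k h"
  shows "tensor_in U V k g h (pa U m (idt G g) x) y =
    tensor_in U V k g (tgt (pcod V) m) x (pa V (idt (pdom V) k) m y)"
  using coendable.coend_in_glue[OF coendable_integrand[of U V k g],
      of m "src (pcod V) m" "tgt (pcod V) m" "Tup x y"] assms
  by (auto simp: tensor_in_def hom_iff)

text \<open>The universal property for tensor products: the family has to be balanced with respect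
  to arrows \<open>m\<close> of the middle groupoid.\<close>

lemma tensor_in_lift:
  assumes "biset U" "biset V" "pdom U = pcod V" "k \<in> ob (pdom V)" "g \<in> ob (pcod U)"
    and "\<And>m x y. m \<in> ar (pcod V) \<Longrightarrow> x \<in> po U (tgt (pcod V) m) g \<Longrightarrow> y \<in> po V k (src (pcod V) m) \<Longrightarrow>
      \<phi> (src (pcod V) m) (Tup (pa U m (idt (pcod U) g) x) y) =
      \<phi> (tgt (pcod V) m) (Tup x (pa V (idt (pdom V) k) m y))"
    and "h \<in> ob (pcod V)" "x \<in> po U h g" "y \<in> po V k h"
  shows "coend_lift (integrand U V k g) \<phi> (tensor_in U V k g h x y) = \<phi> h (Tup x y)"
  unfolding tensor_in_def
  by (rule coendable.coend_lift[OF coendable_integrand[OF assms(1-5)]])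
    (use assms in \<open>auto simp: cprod_def hom_iff\<close>)

lemma pa_tensor [simp]:
  assumes "biset U" "biset V" "pdom U = pcod V" "v \<in> ar (pdom V)" "u \<in> ar (pcod U)"
    "k = tgt (pdom V) v" "g = src (pcod U) u" "h \<in> ob (pcod V)" "x \<in> po U h g" "y \<in> po V k h"
  shows "pa (tensor U V) v u (tensor_in U V k g h x y) =
    tensor_in U V (src (pdom V) v) (tgt (pcod U) u) h (pa U (idt (pcod V) h) u x)
        (pa V v (idt (pcod V) h) y)"
proof -
  let ?t = "tensor_in U V (src (pdom V) v) (tgt (pcod U) u)"
  \<comment> \<open>Balancing: \<open>u\<close> and \<open>v\<close> act on the outer variables and
    \<open>m\<close> on the middle one, so these actions commute and one glueing along
    \<open>m\<close> after acting suffices.\<close>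
  have *: "?t (src (pcod V) m) (pa U m u p) (pa V v (idt (pcod V) (src (pcod V) m)) q) =
      ?t (tgt (pcod V) m) (pa U (idt (pcod V) (tgt (pcod V) m)) u p) (pa V v m q)"
    if "m \<in> ar (pcod V)" "p \<in> po U (tgt (pcod V) m) g" "q \<in> po V k (src (pcod V) m)" for m p q
    using assms that
      tensor_in_glue[of U V "pcod U" "src (pdom V) v" "tgt (pcod U) u" m "src (pcod V) m"
        "pa U (idt (pcod V) (tgt (pcod V) m)) u p" "pa V v (idt (pcod V) (src (pcod V) m)) q"]
    by simp
  show ?thesis
    unfolding tensor_def prof.simps tensor_in_def[symmetric] assms(6,7)[symmetric]
    by (subst tensor_in_lift) (use assms * in \<open>auto simp: hom_iff\<close>)
qed

lemma tensor_biset [simp]: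
  assumes "biset U" "biset V" "pdom U = pcod V"
  shows "biset (tensor U V)"
proof (rule bisetI)
  show "finite (po (tensor U V) h g)" if "h \<in> ob (pdom (tensor U V))" "g \<in> ob (pcod (tensor U V))"
      for h g
    using coendable.finite_coend[OF coendable_integrand[OF assms]] that by (simp add: tensor_def)
next
  fix v u x
  assume "v \<in> ar (pdom (tensor U V))" "u \<in> ar (pcod (tensor U V))"
    and x: "x \<in> po (tensor U V) (tgt (pdom (tensor U V)) v) (src (pcod (tensor U V)) u)"
  note A = assms this(1-2)
  show "pa (tensor U V) v u x \<in> po (tensor U V) (src (pdom (tensor U V)) v) (tgt (pcod (tensor U V)) u)"
    by (rule tensorE[OF x[unfolded tensor_simps]]) (use A in simp)
next
  fix h g x
  assume "h \<in> ob (pdom (tensor U V))" "g \<in> ob (pcod (tensor U V))" and x: "x \<in> po (tensor U V) h g"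
  note A = assms this(1-2)
  show "pa (tensor U V) (idt (pdom (tensor U V)) h) (idt (pcod (tensor U V)) g) x = x"
    by (rule tensorE[OF x[unfolded tensor_simps]]) (use A in simp)
next
  fix v v' u u' x
  assume "v \<in> ar (pdom (tensor U V))" "v' \<in> ar (pdom (tensor U V))"
    "src (pdom (tensor U V)) v = tgt (pdom (tensor U V)) v'"
    "u \<in> ar (pcod (tensor U V))" "u' \<in> ar (pcod (tensor U V))"
    "src (pcod (tensor U V)) u' = tgt (pcod (tensor U V)) u"
    and x: "x \<in> po (tensor U V) (tgt (pdom (tensor U V)) v) (src (pcod (tensor U V)) u)"
  note A = assms this(1-6)
  show "pa (tensor U V) (cmp (pdom (tensor U V)) v v') (cmp (pcod (tensor U V)) u' u) x =
      pa (tensor U V) v' u' (pa (tensor U V) v u x)"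
    by (rule tensorE[OF x[unfolded tensor_simps]]) (use A in simp)
qed (use assms in auto)

section \<open>The bicategory of bisets\<close>

lemma cell_simps [simp]: "csrc (biset_cell U U' \<tau>) = U" "ctrg (biset_cell U U' \<tau>) = U'"
  "h \<in> ob (pdom U) \<Longrightarrow> g \<in> ob (pcod U) \<Longrightarrow> x \<in> po U h g \<Longrightarrow> cmap (biset_cell U U' \<tau>) h g x = \<tau> h g x"
  by (simp_all add: biset_cell_def)

lemma biset_cellsI:
  assumes "biset U" "biset U'" "pdom U' = pdom U" "pcod U' = pcod U"
    and "\<And>h g x. h \<in> ob (pdom U) \<Longrightarrow> g \<in> ob (pcod U) \<Longrightarrow> x \<in> po U h g \<Longrightarrow> \<tau> h g x \<in> po U' h g"
    and "\<And>v u x. v \<in> ar (pdom U) \<Longrightarrow> u \<in> ar (pcod U) \<Longrightarrow> x \<in> po U (tgt (pdom U) v) (src (pcod U) u) \<Longrightarrow>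
      \<tau> (src (pdom U) v) (tgt (pcod U) u) (pa U v u x) =
          pa U' v u (\<tau> (tgt (pdom U) v) (src (pcod U) u) x)"
  shows "biset_cell U U' \<tau> \<in> biset_cells"
  unfolding biset_cells_def is_nat_def mem_Collect_eq using assms
  by (intro exI[of _ U] exI[of _ U'] exI[of _ \<tau>]) (auto simp: hom_iff Pi_iff)

text \<open>The conditions are on \<open>cmap \<alpha>\<close> instead of the raw family: for the
  composed cells the raw family is a \<open>coend_lift\<close>, while \<open>cmap\<close> has
  evaluation rules on elementary classes.\<close>

lemma biset_cellsI2:
  assumes "\<alpha> = biset_cell U U' \<tau>" "biset U" "biset U'" "pdom U' = pdom U" "pcod U' = pcod U"
    and "\<And>h g x. h \<in> ob (pdom U) \<Longrightarrow> g \<in> ob (pcod U) \<Longrightarrow> x \<in> po U h g \<Longrightarrow> cmap \<alpha> h g x \<in> po U' h g"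
    and "\<And>v u x. v \<in> ar (pdom U) \<Longrightarrow> u \<in> ar (pcod U) \<Longrightarrow> x \<in> po U (tgt (pdom U) v) (src (pcod U) u) \<Longrightarrow>
      cmap \<alpha> (src (pdom U) v) (tgt (pcod U) u) (pa U v u x) =
      pa U' v u (cmap \<alpha> (tgt (pdom U) v) (src (pcod U) u) x)"
  shows "\<alpha> \<in> biset_cells"
proof -
  \<comment> \<open>Truncating to \<open>undefined\<close> outside the carriers is
    idempotent.\<close>
  have "\<alpha> = biset_cell U U' (cmap \<alpha>)"
    using assms(1) by (auto simp: biset_cell_def intro!: ext)
  moreover have "biset_cell U U' (cmap \<alpha>) \<in> biset_cells"
    using assms(2-) by (rule biset_cellsI)
  ultimately show ?thesis
    by metis
qed

lemma biset_cellsE: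
  assumes "\<alpha> \<in> biset_cells"
  obtains U U' \<tau> where "\<alpha> = biset_cell U U' \<tau>" "biset U" "biset U'" "pdom U' = pdom U" "pcod U' =
      pcod U"
    "\<And>h g x. h \<in> ob (pdom U) \<Longrightarrow> g \<in> ob (pcod U) \<Longrightarrow> x \<in> po U h g \<Longrightarrow> \<tau> h g x \<in> po U' h g"
    "\<And>v u x. v \<in> ar (pdom U) \<Longrightarrow> u \<in> ar (pcod U) \<Longrightarrow> x \<in> po U (tgt (pdom U) v) (src (pcod U) u) \<Longrightarrow>
      \<tau> (src (pdom U) v) (tgt (pcod U) u) (pa U v u x) =
          pa U' v u (\<tau> (tgt (pdom U) v) (src (pcod U) u) x)"
proof -
  obtain U U' \<tau> where *: "\<alpha> = biset_cell U U' \<tau>" "biset U" "biset U'" and "is_nat U U' \<tau>"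
    using assms by (auto simp: biset_cells_def)
  from this(4) have "pdom U' = pdom U" "pcod U' = pcod U"
    "\<And>h g x. h \<in> ob (pdom U) \<Longrightarrow> g \<in> ob (pcod U) \<Longrightarrow> x \<in> po U h g \<Longrightarrow> \<tau> h g x \<in> po U' h g"
    and nat: "\<forall>h \<in> ob (pdom U). \<forall>h' \<in> ob (pdom U). \<forall>g \<in> ob (pcod U). \<forall>g' \<in> ob (pcod U).
        \<forall>v \<in> hom (pdom U) h' h. \<forall>u \<in> hom (pcod U) g g'. \<forall>x \<in> po U h g.
          \<tau> h' g' (pa U v u x) = pa U' v u (\<tau> h g x)"
    unfolding is_nat_def by (simp, simp, blast, blast)
  moreover have "\<tau> (src (pdom U) v) (tgt (pcod U) u) (pa U v u x) =
      pa U' v u (\<tau> (tgt (pdom U) v) (src (pcod U) u) x)"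
    if "v \<in> ar (pdom U)" "u \<in> ar (pcod U)" "x \<in> po U (tgt (pdom U) v) (src (pcod U) u)" for v u x
    using nat[rule_format, of "tgt (pdom U) v" "src (pdom U) v" "src (pcod U) u" "tgt (pcod U) u" v u x]
      that *(2) by (simp add: hom_iff)
  ultimately show thesis
    using that * by blast
qed

lemma cell_bisets [simp]:
  assumes "\<alpha> \<in> biset_cells"
  shows "biset (csrc \<alpha>)" "biset (ctrg \<alpha>)" "pdom (ctrg \<alpha>) = pdom (csrc \<alpha>)" "pcod (ctrg \<alpha>) =
      pcod (csrc \<alpha>)"
  by (rule biset_cellsE[OF assms], simp)+

lemma cmap_in [simp]:
  assumes "\<alpha> \<in> biset_cells" "ctrg \<alpha> = U'" "h \<in> ob (pdom (csrc \<alpha>))" "g \<in> ob (pcod (csrc \<alpha>))"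
    "x \<in> po (csrc \<alpha>) h g"
  shows "cmap \<alpha> h g x \<in> po U' h g"
  by (rule biset_cellsE[OF assms(1)]) (use assms(2-) in auto)

lemma cmap_pa [simp]:
  assumes "\<alpha> \<in> biset_cells" "csrc \<alpha> = U" "v \<in> ar (pdom U)" "u \<in> ar (pcod U)" "src (pdom U) v = h'"
    "tgt (pcod U) u = g'" "x \<in> po U (tgt (pdom U) v) (src (pcod U) u)"
  shows "cmap \<alpha> h' g' (pa U v u x) = pa (ctrg \<alpha>) v u (cmap \<alpha> (tgt (pdom U) v) (src (pcod U) u) x)"
  by (rule biset_cellsE[OF assms(1)]) (use assms(2-) in auto)

lemma cmap_undefined:
  assumes "\<alpha> \<in> biset_cells"
    and "\<not> (h \<in> ob (pdom (csrc \<alpha>)) \<and> g \<in> ob (pcod (csrc \<alpha>)) \<and> x \<in> po (csrc \<alpha>) h g)"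
  shows "cmap \<alpha> h g x = undefined"
  by (rule biset_cellsE[OF assms(1)]) (use assms(2) in \<open>auto simp: biset_cell_def\<close>)

text \<open>Off the carriers both components are \<open>undefined\<close>, so comparison on the
  carriers is enough for equality of 2-cells.\<close>

lemma biset_cell_eqI:
  assumes "\<alpha> \<in> biset_cells" "\<beta> \<in> biset_cells" "csrc \<alpha> = csrc \<beta>" "ctrg \<alpha> = ctrg \<beta>"
    and "\<And>h g x. h \<in> ob (pdom (csrc \<beta>)) \<Longrightarrow> g \<in> ob (pcod (csrc \<beta>)) \<Longrightarrow> x \<in> po (csrc \<beta>) h g \<Longrightarrow>
      cmap \<alpha> h g x = cmap \<beta> h g x"
  shows "\<alpha> = \<beta>"
proof -
  have "cmap \<alpha> h g x = cmap \<beta> h g x" for h g x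
    using assms(5) cmap_undefined[OF assms(1), of h g x] cmap_undefined[OF assms(2), of h g x] assms(3)
    by (cases "h \<in> ob (pdom (csrc \<beta>)) \<and> g \<in> ob (pcod (csrc \<beta>)) \<and> x \<in> po (csrc \<beta>) h g") simp_all
  then have "cmap \<alpha> = cmap \<beta>"
    by (intro ext)
  then show ?thesis
    using assms(3,4) by simp
qed

section \<open>The bicategory structure on bisets\<close>

lemma Biset_simps [simp]: "obj Biset = {G. finite_groupoid G}" "cell1 Biset = {U. biset U}"
  "src1 Biset = pdom" "trg1 Biset = pcod" "cell2 Biset = biset_cells" "src2 Biset = csrc"
      "trg2 Biset = ctrg"
  "vid Biset = biset_vid" "vcomp Biset = biset_vcomp" "id1 Biset = biset_id" "hcomp1 Biset = tensor"
  "hcomp2 Biset = biset_hcomp" "assoc Biset = biset_assoc" "lunit Biset = biset_lunit"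
      "runit Biset = biset_runit"
  by (simp_all add: Biset_def)

lemma one_Biset [simp]: "U \<in> one Biset H G \<longleftrightarrow> biset U \<and> pdom U = H \<and> pcod U = G"
  by (simp add: one_def)

lemma two_Biset [simp]: "\<alpha> \<in> two Biset U U' \<longleftrightarrow> \<alpha> \<in> biset_cells \<and> csrc \<alpha> = U \<and> ctrg \<alpha> = U' \<and>
    biset U \<and> biset U' \<and> pdom U' = pdom U \<and> pcod U' = pcod U"
  by (auto simp: two_def)

lemma biset_vid_simps [simp]: "biset U \<Longrightarrow> biset_vid U \<in> biset_cells"
  "csrc (biset_vid U) = U" "ctrg (biset_vid U) = U"
  "h \<in> ob (pdom U) \<Longrightarrow> g \<in> ob (pcod U) \<Longrightarrow> x \<in> po U h g \<Longrightarrow> cmap (biset_vid U) h g x = x"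
  by (auto simp: biset_vid_def intro!: biset_cellsI)

lemma biset_vcomp_simps [simp]:
  "csrc (biset_vcomp \<beta> \<alpha>) = csrc \<alpha>" "ctrg (biset_vcomp \<beta> \<alpha>) = ctrg \<beta>"
  "h \<in> ob (pdom (csrc \<alpha>)) \<Longrightarrow> g \<in> ob (pcod (csrc \<alpha>)) \<Longrightarrow> x \<in> po (csrc \<alpha>) h g \<Longrightarrow>
    cmap (biset_vcomp \<beta> \<alpha>) h g x = cmap \<beta> h g (cmap \<alpha> h g x)"
  by (auto simp: biset_vcomp_def)

lemma biset_vcomp_cells [simp]:
  assumes "\<alpha> \<in> biset_cells" "\<beta> \<in> biset_cells" "csrc \<beta> = ctrg \<alpha>"
  shows "biset_vcomp \<beta> \<alpha> \<in> biset_cells"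
  unfolding biset_vcomp_def
proof (rule biset_cellsI)
  show "pdom (ctrg \<beta>) = pdom (csrc \<alpha>)" "pcod (ctrg \<beta>) = pcod (csrc \<alpha>)"
    using assms by simp_all
qed (use assms in simp_all)

text \<open>A pointwise two-sided inverse suffices, since the inverse of a natural bijection is
  natural. No inverse given later has to be shown natural.\<close>

lemma invertible2_Biset:
  assumes "\<alpha> \<in> biset_cells"
    and "\<And>h g x. h \<in> ob (pdom (csrc \<alpha>)) \<Longrightarrow> g \<in> ob (pcod (csrc \<alpha>)) \<Longrightarrow> x \<in> po (csrc \<alpha>) h g \<Longrightarrow>
      \<sigma> h g (cmap \<alpha> h g x) = x"
    and "\<And>h g y. h \<in> ob (pdom (csrc \<alpha>)) \<Longrightarrow> g \<in> ob (pcod (csrc \<alpha>)) \<Longrightarrow> y \<in> po (ctrg \<alpha>) h g \<Longrightarrow>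
      \<sigma> h g y \<in> po (csrc \<alpha>) h g \<and> cmap \<alpha> h g (\<sigma> h g y) = y"
  shows "invertible2 Biset \<alpha>"
proof -
  let ?\<beta> = "biset_cell (ctrg \<alpha>) (csrc \<alpha>) \<sigma>"
  have \<beta>: "?\<beta> \<in> biset_cells"
  proof (rule biset_cellsI)
    fix v u x
    assume A: "v \<in> ar (pdom (ctrg \<alpha>))" "u \<in> ar (pcod (ctrg \<alpha>))"
      "x \<in> po (ctrg \<alpha>) (tgt (pdom (ctrg \<alpha>)) v) (src (pcod (ctrg \<alpha>)) u)"
    let ?y = "\<sigma> (tgt (pdom (ctrg \<alpha>)) v) (src (pcod (ctrg \<alpha>)) u) x"
    have y: "?y \<in> po (csrc \<alpha>) (tgt (pdom (csrc \<alpha>)) v) (src (pcod (csrc \<alpha>)) u)"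
      and x: "cmap \<alpha> (tgt (pdom (csrc \<alpha>)) v) (src (pcod (csrc \<alpha>)) u) ?y = x"
      using assms(3)[of "tgt (pdom (ctrg \<alpha>)) v" "src (pcod (ctrg \<alpha>)) u" x] A assms(1) by auto
    \<comment> \<open>Naturality of \<open>\<alpha>\<close> at the preimage of \<open>x\<close>;
      cancelling with \<open>\<sigma>\<close> turns it into naturality of
      \<open>\<sigma>\<close>.\<close>
    have "cmap \<alpha> (src (pdom (csrc \<alpha>)) v) (tgt (pcod (csrc \<alpha>)) u) (pa (csrc \<alpha>) v u ?y) =
        pa (ctrg \<alpha>) v u x"
      using y x A assms(1) by simp
    then show "\<sigma> (src (pdom (ctrg \<alpha>)) v) (tgt (pcod (ctrg \<alpha>)) u) (pa (ctrg \<alpha>) v u x) =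
        pa (csrc \<alpha>) v u ?y"
      using assms(2)[of "src (pdom (ctrg \<alpha>)) v" "tgt (pcod (ctrg \<alpha>)) u" "pa (csrc \<alpha>) v u ?y"] y A
          assms(1)
      by simp
  qed (use assms in simp_all)
  have "biset_vcomp ?\<beta> \<alpha> = biset_vid (csrc \<alpha>)" "biset_vcomp \<alpha> ?\<beta> = biset_vid (ctrg \<alpha>)"
    using \<beta> assms by (auto intro!: biset_cell_eqI)
  then show ?thesis
    unfolding invertible2_def using \<beta> assms(1) by (auto intro!: bexI[of _ ?\<beta>])
qed

lemma biset_hcomp_simps [simp]: "csrc (biset_hcomp \<beta> \<alpha>) = tensor (csrc \<beta>) (csrc \<alpha>)"
  "ctrg (biset_hcomp \<beta> \<alpha>) = tensor (ctrg \<beta>) (ctrg \<alpha>)"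
  by (simp_all add: biset_hcomp_def Let_def)

lemma cmap_biset_hcomp [simp]:
  assumes "\<alpha> \<in> biset_cells" "\<beta> \<in> biset_cells" "csrc \<beta> = U" "csrc \<alpha> = V" "pdom U = pcod V"
    "k \<in> ob (pdom V)" "g \<in> ob (pcod U)" "h \<in> ob (pcod V)" "x \<in> po U h g" "y \<in> po V k h"
  shows "cmap (biset_hcomp \<beta> \<alpha>) k g (tensor_in U V k g h x y) =
    tensor_in (ctrg \<beta>) (ctrg \<alpha>) k g h (cmap \<beta> h g x) (cmap \<alpha> k h y)"
proof -
  have "biset U" "biset V" "pdom (ctrg \<beta>) = pcod V" "pcod (ctrg \<beta>) = pcod U"
    "pdom (ctrg \<alpha>) = pdom V" "pcod (ctrg \<alpha>) = pcod V"
    using assms by auto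
  with assms show ?thesis
    by (simp add: biset_hcomp_def Let_def tensor_in_def[symmetric] tensor_in_lift tensor_in_glue)
qed

lemma biset_hcomp_cells [simp]:
  assumes "\<alpha> \<in> biset_cells" "\<beta> \<in> biset_cells" "pdom (csrc \<beta>) = pcod (csrc \<alpha>)"
  shows "biset_hcomp \<beta> \<alpha> \<in> biset_cells"
  unfolding biset_hcomp_def Let_def
  \<comment> \<open>The definition is opened only to match the shape of a cell and is folded back at
    once, so that the evaluation rule for \<open>cmap\<close> applies.\<close>
  by (rule biset_cellsI2[OF refl], unfold biset_hcomp_def[unfolded Let_def, symmetric])
    (use assms in \<open>auto elim!: tensorE\<close>)

lemma biset_assoc_simps [simp]: "csrc (biset_assoc W U V) = tensor (tensor W U) V"
  "ctrg (biset_assoc W U V) = tensor W (tensor U V)"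
  by (simp_all add: biset_assoc_def)

text \<open>The argument is a class whose left entry is a class, so two lifts are nested and each
  has to be balanced: the inner one over the arrows of \<open>pcod U\<close>, the outer one over
  those of \<open>pcod V\<close>.\<close>

lemma cmap_biset_assoc [simp]:
  assumes "biset W" "biset U" "biset V" "pdom W = pcod U" "pdom U = pcod V"
    "l \<in> ob (pdom V)" "g \<in> ob (pcod W)" "k \<in> ob (pcod V)" "h \<in> ob (pcod U)"
    "w \<in> po W h g" "u \<in> po U k h" "v \<in> po V l k"
  shows "cmap (biset_assoc W U V) l g (tensor_in (tensor W U) V l g k (tensor_in W U k g h w u) v) =
    tensor_in W (tensor U V) l g h w (tensor_in U V l h k u v)"
proof -
  let ?\<psi> = "\<lambda>k c v. coend_lift (integrand W U k g)
       (\<lambda>h y. tensor_in W (tensor U V) l g h (tfst y) (tensor_in U V l h k (tsnd y) v)) c"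
  have inner: "?\<psi> k (tensor_in W U k g h w u) v = tensor_in W (tensor U V) l g h w (tensor_in U V l
      h k u v)"
    if "k \<in> ob (pcod V)" "h \<in> ob (pcod U)" "w \<in> po W h g" "u \<in> po U k h" "v \<in> po V l k" for k h w u v
    using assms(1-7) that by (simp add: tensor_in_lift tensor_in_glue)
  \<comment> \<open>Balancing of the outer lift is tested after writing the left entry
    \<open>x\<close> as an elementary class, where the inner lift is already known.\<close>
  have outer: "?\<psi> (src (pcod V) m) (pa (tensor W U) m (idt (pcod (tensor W U)) g) x) y =
      ?\<psi> (tgt (pcod V) m) x (pa V (idt (pdom V) l) m y)"
    if "m \<in> ar (pcod V)" "x \<in> po (tensor W U) (tgt (pcod V) m) g" "y \<in> po V l (src (pcod V) m)"
        for m x y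
    by (rule tensorE[OF that(2)])
      (use assms(1-7) that in \<open>simp add: inner tensor_in_glue\<close>)
  have "coend_lift (integrand (tensor W U) V l g) (\<lambda>k z. ?\<psi> k (tfst z) (tsnd z))
      (tensor_in (tensor W U) V l g k (tensor_in W U k g h w u) v) = ?\<psi> k (tensor_in W U k g h w u) v"
    by (subst tensor_in_lift) (use assms outer in auto)
  then show ?thesis
    using assms unfolding biset_assoc_def tensor_in_def[symmetric]
    by (simp add: inner)
qed

lemma biset_assoc_cells [simp]:
  assumes "biset W" "biset U" "biset V" "pdom W = pcod U" "pdom U = pcod V"
  shows "biset_assoc W U V \<in> biset_cells"
  unfolding biset_assoc_def
  by (rule biset_cellsI2[OF refl], unfold biset_assoc_def[symmetric])
    (use assms in \<open>auto elim!: tensorE\<close>)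

lemma biset_lunit_simps [simp]: "csrc (biset_lunit U) = tensor (biset_id (pcod U)) U"
    "ctrg (biset_lunit U) = U"
  by (simp_all add: biset_lunit_def)

lemma cmap_biset_lunit [simp]:
  assumes "biset U" "h \<in> ob (pdom U)" "g \<in> ob (pcod U)" "G = pcod U" "g' \<in> ob G" "x \<in> hom G g' g"
      "y \<in> po U h g'"
  shows "cmap (biset_lunit U) h g (tensor_in (biset_id G) U h g g' x y) = pa U (idt (pdom U) h) x y"
  unfolding biset_lunit_def
  by (subst cell_simps(3), use assms in \<open>simp_all add: hom_iff\<close>)
    (subst tensor_in_lift, use assms in \<open>simp_all add: hom_iff\<close>)

lemma biset_lunit_cells [simp]: "biset U \<Longrightarrow> biset_lunit U \<in> biset_cells"
  unfolding biset_lunit_def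
  by (rule biset_cellsI2[OF refl], unfold biset_lunit_def[symmetric])
    (auto elim!: tensorE simp: hom_iff)

lemma biset_runit_simps [simp]: "csrc (biset_runit U) = tensor U (biset_id (pdom U))"
    "ctrg (biset_runit U) = U"
  by (simp_all add: biset_runit_def)

lemma cmap_biset_runit [simp]:
  assumes "biset U" "h \<in> ob (pdom U)" "g \<in> ob (pcod U)" "H = pdom U" "h' \<in> ob H" "x \<in> po U h' g"
      "y \<in> hom H h h'"
  shows "cmap (biset_runit U) h g (tensor_in U (biset_id H) h g h' x y) = pa U y (idt (pcod U) g) x"
  unfolding biset_runit_def
  by (subst cell_simps(3), use assms in \<open>simp_all add: hom_iff\<close>)
    (subst tensor_in_lift, use assms in \<open>simp_all add: hom_iff\<close>)

lemma biset_runit_cells [simp]: "biset U \<Longrightarrow> biset_runit U \<in> biset_cells"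
  unfolding biset_runit_def
  by (rule biset_cellsI2[OF refl], unfold biset_runit_def[symmetric])
    (auto elim!: tensorE simp: hom_iff)

text \<open>The inverse unpacks the other entry: for fixed \<open>w\<close> it sends
  \<open>[k, (u, v)]\<close> to \<open>[k, ([h, (w, u)], v)]\<close>, which is balanced first over
  \<open>pcod V\<close> and then over \<open>pcod U\<close>.\<close>

lemma invertible_biset_assoc:
  assumes "biset W" "biset U" "biset V" "pdom W = pcod U" "pdom U = pcod V"
  shows "invertible2 Biset (biset_assoc W U V)"
proof -
  let ?\<psi> = "\<lambda>l g h w c. coend_lift (integrand U V l h)
       (\<lambda>k y. tensor_in (tensor W U) V l g k (tensor_in W U k g h w (tfst y)) (tsnd y)) c"
  have inner: "?\<psi> l g h w (tensor_in U V l h k u v) = tensor_in (tensor W U) V l g k (tensor_in W U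
      k g h w u) v"
    if "l \<in> ob (pdom V)" "g \<in> ob (pcod W)" "k \<in> ob (pcod V)" "h \<in> ob (pcod U)"
      "w \<in> po W h g" "u \<in> po U k h" "v \<in> po V l k" for l g k h w u v
    \<comment> \<open>The glueing is read backwards here: the arrow leaves \<open>v\<close> and acts
      on the class on the left, where \<open>pa_tensor\<close> evaluates it.\<close>
    using assms that by (simp add: tensor_in_lift flip: tensor_in_glue)
  have outer: "?\<psi> l g (src (pcod U) m) (pa W m (idt (pcod W) g) w) c =
      ?\<psi> l g (tgt (pcod U) m) w (pa (tensor U V) (idt (pdom V) l) m c)"
    if "l \<in> ob (pdom V)" "g \<in> ob (pcod W)" "m \<in> ar (pcod U)"
      "w \<in> po W (tgt (pcod U) m) g" "c \<in> po (tensor U V) l (src (pcod U) m)" for l g m w c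
    by (rule tensorE[OF that(5)])
      (use assms that in \<open>simp add: inner tensor_in_glue\<close>)
  have "coend_lift (integrand W (tensor U V) l g) (\<lambda>h z. ?\<psi> l g h (tfst z) (tsnd z))
      (tensor_in W (tensor U V) l g h w (tensor_in U V l h k u v)) = tensor_in (tensor W U) V l g k
          (tensor_in W U k g h w u) v"
    if "l \<in> ob (pdom V)" "g \<in> ob (pcod W)" "k \<in> ob (pcod V)" "h \<in> ob (pcod U)"
      "w \<in> po W h g" "u \<in> po U k h" "v \<in> po V l k" for l g k h w u v
    by (subst tensor_in_lift) (use assms that outer inner in auto)
  then show ?thesis
    using assms
    by (intro invertible2_Biset[where \<sigma> = "\<lambda>l g. coend_lift (integrand W (tensor U V) l g)
          (\<lambda>h z. ?\<psi> l g h (tfst z) (tsnd z))"]) (auto elim!: tensorE)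
qed

text \<open>The inverse is \<open>y \<mapsto> [g, (1, y)]\<close>: writing \<open>x\<close> as
  \<open>1 x\<close> and glueing along \<open>x\<close> moves it from the hom set onto
  \<open>y\<close>.\<close>

lemma invertible_biset_lunit:
  assumes "biset U"
  shows "invertible2 Biset (biset_lunit U)"
proof -
  let ?G = "pcod U"
  have "tensor_in (biset_id ?G) U h g g (idt ?G g) (pa U (idt (pdom U) h) x y) =
      tensor_in (biset_id ?G) U h g g' x y"
    if "h \<in> ob (pdom U)" "g \<in> ob ?G" "x \<in> hom ?G g' g" "y \<in> po U h g'" for h g g' x y
    using that assms tensor_in_glue[of "biset_id ?G" U ?G h g x g' "idt ?G g" y] by (simp add: hom_iff)
  then show ?thesis
    using assms
    by (intro invertible2_Biset[where \<sigma> = "\<lambda>h g y. tensor_in (biset_id ?G) U h g g (idt ?G g) y"])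
      (auto elim!: tensorE simp: hom_iff)
qed

lemma invertible_biset_runit:
  assumes "biset U"
  shows "invertible2 Biset (biset_runit U)"
proof -
  let ?H = "pdom U"
  have "tensor_in U (biset_id ?H) h g h (pa U x (idt (pcod U) g) y) (idt ?H h) =
      tensor_in U (biset_id ?H) h g h' y x"
    if "h \<in> ob ?H" "g \<in> ob (pcod U)" "x \<in> hom ?H h h'" "y \<in> po U h' g" for h g h' x y
    using that assms tensor_in_glue[of U "biset_id ?H" "pcod U" h g x h y "idt ?H h"] by
        (simp add: hom_iff)
  then show ?thesis
    using assms
    by (intro invertible2_Biset[where \<sigma> = "\<lambda>h g y. tensor_in U (biset_id ?H) h g h y (idt ?H h)"])
      (auto elim!: tensorE simp: hom_iff)
qed

text \<open>Each equation between 2-cells is evaluated on an iterated elementary class, where both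
  sides become the same term; in the triangle they still differ by one balancing relation.\<close>

lemma bicategory_Biset: "bicategory (Biset :: ('a elt cat, 'a elt prof, 'a elt biset_cell) bicat)"
proof
  fix f g x y z and f' f'' g' g'' :: "'a elt prof" and \<alpha> \<alpha>' \<beta> \<beta>' :: "'a elt biset_cell"
  assume "f \<in> one Biset x y" "g \<in> one Biset y z"
    "\<alpha> \<in> two Biset f f'" "\<alpha>' \<in> two Biset f' f''" "\<beta> \<in> two Biset g g'" "\<beta>' \<in> two Biset g' g''"
  then show "hcomp2 Biset (vcomp Biset \<beta>' \<beta>) (vcomp Biset \<alpha>' \<alpha>) =
      vcomp Biset (hcomp2 Biset \<beta>' \<alpha>') (hcomp2 Biset \<beta> \<alpha>)"
    by (auto intro!: biset_cell_eqI elim!: tensorE)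
next
  fix f g h w x y z f' g' h' and \<alpha> \<beta> \<gamma> :: "'a elt biset_cell"
  assume "f \<in> one Biset w x" "g \<in> one Biset x y" "h \<in> one Biset y z"
    "\<alpha> \<in> two Biset f f'" "\<beta> \<in> two Biset g g'" "\<gamma> \<in> two Biset h h'"
  then show "vcomp Biset (assoc Biset h' g' f') (hcomp2 Biset (hcomp2 Biset \<gamma> \<beta>) \<alpha>) =
      vcomp Biset (hcomp2 Biset \<gamma> (hcomp2 Biset \<beta> \<alpha>)) (assoc Biset h g f)"
    by (auto intro!: biset_cell_eqI elim!: tensorE)
next
  fix f g :: "'a elt prof" and x y z
  assume "f \<in> one Biset x y" "g \<in> one Biset y z"
  then show "vcomp Biset (hcomp2 Biset (vid Biset g) (lunit Biset f)) (assoc Biset g (id1 Biset y) f) =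
      hcomp2 Biset (runit Biset g) (vid Biset f)"
    by (auto intro!: biset_cell_eqI elim!: tensorE simp: hom_iff tensor_in_glue)
next
  fix f g h k :: "'a elt prof" and v w x y z
  assume "f \<in> one Biset v w" "g \<in> one Biset w x" "h \<in> one Biset x y" "k \<in> one Biset y z"
  then show "vcomp Biset (hcomp2 Biset (vid Biset k) (assoc Biset h g f))
      (vcomp Biset (assoc Biset k (hcomp1 Biset h g) f) (hcomp2 Biset (assoc Biset k h g)
          (vid Biset f))) =
      vcomp Biset (assoc Biset k h (hcomp1 Biset g f)) (assoc Biset (hcomp1 Biset k h) g f)"
    by (auto intro!: biset_cell_eqI elim!: tensorE)
qed (auto intro!: biset_cell_eqI invertible_biset_assoc invertible_biset_lunit invertible_biset_runit
      elim!: tensorE simp: hom_iff)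

section \<open>Spans and their 2-cells\<close>

lemma nat_isoI:
  assumes "cat_functor F" "cat_functor G" "fdom G = fdom F" "fcod G = fcod F" "groupoid (fcod F)"
    and "\<And>x. x \<in> ob (fdom F) \<Longrightarrow> \<tau> x \<in> ar (fcod F) \<and> src (fcod F) (\<tau> x) = fo F x \<and>
        tgt (fcod F) (\<tau> x) = fo G x"
    and "\<And>m. m \<in> ar (fdom F) \<Longrightarrow> cmp (fcod F) (\<tau> (tgt (fdom F) m)) (fa F m) =
        cmp (fcod F) (fa G m) (\<tau> (src (fdom F) m))"
  shows "nat_iso F G \<tau>"
  by (rule nat_iso.intro) (use assms groupoid.iso[OF assms(5)] in \<open>auto simp: hom_iff\<close>)

lemma nat_isoD:
  assumes "nat_iso F G \<tau>"
  shows "cat_functor F" "cat_functor G" "fdom G = fdom F" "fcod G = fcod F"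
    and "x \<in> ob (fdom F) \<Longrightarrow> \<tau> x \<in> ar (fcod F) \<and> src (fcod F) (\<tau> x) = fo F x \<and> tgt (fcod F) (\<tau> x) =
        fo G x"
    and "m \<in> ar (fdom F) \<Longrightarrow> cmp (fcod F) (\<tau> (tgt (fdom F) m)) (fa F m) =
        cmp (fcod F) (fa G m) (\<tau> (src (fdom F) m))"
  using assms nat_iso.comp_hom[OF assms, of x] nat_iso.natural[OF assms, of m "src (fdom F) m"
      "tgt (fdom F) m"]
  by (auto simp: nat_iso_def hom_iff)

lemma spansI:
  assumes "cat_functor (fst X)" "cat_functor (snd X)" "fdom (snd X) = fdom (fst X)"
    "finite_groupoid (fdom (fst X))" "finite_groupoid (fcod (fst X))" "finite_groupoid (fcod (snd X))"
  shows "X \<in> spans"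
  using assms by (cases X) (auto simp: spans_def)

lemma spansD [simp]:
  assumes "X \<in> spans"
  shows "cat_functor (fst X)" "cat_functor (snd X)" "fdom (snd X) = fdom (fst X)"
    "finite_groupoid (fdom (fst X))" "finite_groupoid (fcod (fst X))" "finite_groupoid (fcod (snd X))"
  using assms by (auto simp: spans_def)

section \<open>Representatives of 2-cells of spans\<close>

definition parallel :: "'a span \<Rightarrow> 'a span \<Rightarrow> bool" where
  "parallel X X' \<longleftrightarrow> X \<in> spans \<and> X' \<in> spans \<and> fcod (fst X') = fcod (fst X) \<and> fcod (snd X') = fcod (snd X)"

lemma parallelD:
  assumes "parallel X X'"
  shows "X \<in> spans" "X' \<in> spans" "fcod (fst X') = fcod (fst X)" "fcod (snd X') = fcod (snd X)"
  using assms by (simp_all add: parallel_def)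

lemma is_tripleI:
  assumes "parallel X X'" "cat_functor f" "fdom f = fdom (fst X)" "fcod f = fdom (fst X')"
    and "\<And>s. s \<in> ob (fdom (fst X)) \<Longrightarrow> \<beta> s \<in> ar (fcod (fst X)) \<and>
      src (fcod (fst X)) (\<beta> s) = fo (fst X) s \<and> tgt (fcod (fst X)) (\<beta> s) = fo (fst X') (fo f s)"
    and "\<And>s. s \<in> ob (fdom (fst X)) \<Longrightarrow> \<alpha> s \<in> ar (fcod (snd X)) \<and>
      src (fcod (snd X)) (\<alpha> s) = fo (snd X') (fo f s) \<and> tgt (fcod (snd X)) (\<alpha> s) = fo (snd X) s"
    and "\<And>m. m \<in> ar (fdom (fst X)) \<Longrightarrow> cmp (fcod (fst X)) (\<beta> (tgt (fdom (fst X)) m)) (fa (fst X) m) =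
      cmp (fcod (fst X)) (fa (fst X') (fa f m)) (\<beta> (src (fdom (fst X)) m))"
    and "\<And>m. m \<in> ar (fdom (fst X)) \<Longrightarrow> cmp (fcod (snd X)) (\<alpha> (tgt (fdom (fst X)) m))
        (fa (snd X') (fa f m)) =
      cmp (fcod (snd X)) (fa (snd X) m) (\<alpha> (src (fdom (fst X)) m))"
  shows "is_triple X X' (f, \<beta>, \<alpha>)"
proof -
  have "nat_iso (fst X) (fcomp (fst X') f) \<beta>" "nat_iso (fcomp (snd X') f) (snd X) \<alpha>"
    by (rule nat_isoI; use assms parallelD[OF assms(1)] in simp)+
  then show ?thesis
    using assms by (cases X, cases X') simp
qed

text \<open>Interpreting this locale gives simp the ends of \<open>\<beta>\<close> and
  \<open>\<alpha>\<close> and their naturality, oriented so that the image of an arrow of the apex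
  travels to the left of the component.\<close>

locale triple =
  fixes X X' :: "'a span" and f :: "'a elt func" and \<beta> \<alpha> :: "'a elt \<Rightarrow> 'a elt"
  assumes span_src [simp]: "X \<in> spans" and span_trg [simp]: "X' \<in> spans"
    and tr: "is_triple X X' (f, \<beta>, \<alpha>)"
begin

lemma tr': "cat_functor f" "fdom f = fdom (fst X)" "fcod f = fdom (fst X')"
    "nat_iso (fst X) (fcomp (fst X') f) \<beta>" "nat_iso (fcomp (snd X') f) (snd X) \<alpha>"
  using tr by (cases X, cases X', simp)+

lemmas functor_simps [simp] = tr'(1-3)

lemma ends [simp]: "fcod (fst X') = fcod (fst X)" "fcod (snd X') = fcod (snd X)"
  using nat_isoD(4)[OF tr'(4)] nat_isoD(4)[OF tr'(5)] by auto

lemma beta_ar [simp]: "fcod (fst X) = H \<Longrightarrow> s \<in> ob (fdom (fst X)) \<Longrightarrow> \<beta> s \<in> ar H"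
  and beta_src [simp]: "fcod (fst X) = H \<Longrightarrow> s \<in> ob (fdom (fst X)) \<Longrightarrow> src H (\<beta> s) = fo (fst X) s"
  and beta_tgt [simp]: "fcod (fst X) = H \<Longrightarrow> s \<in> ob (fdom (fst X)) \<Longrightarrow> tgt H (\<beta> s) = fo (fst X') (fo f s)"
  using nat_isoD(5)[OF tr'(4), of s] by auto

lemma alpha_ar [simp]: "fcod (snd X) = G \<Longrightarrow> s \<in> ob (fdom (fst X)) \<Longrightarrow> \<alpha> s \<in> ar G"
  and alpha_src [simp]: "fcod (snd X) = G \<Longrightarrow> s \<in> ob (fdom (fst X)) \<Longrightarrow> src G (\<alpha> s) = fo (snd X') (fo f s)"
  and alpha_tgt [simp]: "fcod (snd X) = G \<Longrightarrow> s \<in> ob (fdom (fst X)) \<Longrightarrow> tgt G (\<alpha> s) = fo (snd X) s"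
  using nat_isoD(5)[OF tr'(5), of s] by auto

lemma beta_natural [simp]: "fcod (fst X) = H \<Longrightarrow> m \<in> ar (fdom (fst X)) \<Longrightarrow> tgt (fdom (fst X)) m = s \<Longrightarrow>
    cmp H (\<beta> s) (fa (fst X) m) = cmp H (fa (fst X') (fa f m)) (\<beta> (src (fdom (fst X)) m))"
  using nat_isoD(6)[OF tr'(4), of m] by auto

lemma alpha_natural [simp]: "fcod (snd X) = G \<Longrightarrow> m \<in> ar (fdom (fst X)) \<Longrightarrow> tgt (fdom (fst X)) m = s \<Longrightarrow>
    cmp G (\<alpha> s) (fa (snd X') (fa f m)) = cmp G (fa (snd X) m) (\<alpha> (src (fdom (fst X)) m))"
  using nat_isoD(6)[OF tr'(5), of m] by auto

text \<open>Naturality with a further arrow \<open>k\<close> on the right: in a right-nested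
  composite the two arrows of the plain square no longer form a subterm.\<close>

lemma beta_natural' [simp]:
  assumes "fcod (fst X) = H" "m \<in> ar (fdom (fst X))" "tgt (fdom (fst X)) m = s"
    "k \<in> ar H" "tgt H k = fo (fst X) (src (fdom (fst X)) m)"
  shows "cmp H (\<beta> s) (cmp H (fa (fst X) m) k) =
      cmp H (fa (fst X') (fa f m)) (cmp H (\<beta> (src (fdom (fst X)) m)) k)"
proof -
  have "cmp H (cmp H (\<beta> s) (fa (fst X) m)) k =
      cmp H (cmp H (fa (fst X') (fa f m)) (\<beta> (src (fdom (fst X)) m))) k"
    using assms by (subst beta_natural) auto
  moreover have "finite_groupoid H"
    using assms(1) by auto
  ultimately show ?thesis
    using assms by (auto simp del: beta_natural)
qed

lemma alpha_natural' [simp]: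
  assumes "fcod (snd X) = G" "m \<in> ar (fdom (fst X))" "tgt (fdom (fst X)) m = s"
    "k \<in> ar G" "tgt G k = fo (snd X') (fo f (src (fdom (fst X)) m))"
  shows "cmp G (\<alpha> s) (cmp G (fa (snd X') (fa f m)) k) =
      cmp G (fa (snd X) m) (cmp G (\<alpha> (src (fdom (fst X)) m)) k)"
proof -
  have "cmp G (cmp G (\<alpha> s) (fa (snd X') (fa f m))) k =
      cmp G (cmp G (fa (snd X) m) (\<alpha> (src (fdom (fst X)) m))) k"
    using assms by (subst alpha_natural) auto
  moreover have "finite_groupoid G"
    using assms(1) by auto
  ultimately show ?thesis
    using assms by (auto simp del: alpha_natural)
qed

end

text \<open>In the equivalence \<open>\<theta>\<close> expresses \<open>\<beta>'\<close> through
  \<open>\<beta>\<close>, but \<open>\<alpha>\<close> through \<open>\<alpha>'\<close>. Rewriting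
  follows this: \<open>\<beta>'\<close> is expanded, while the composite of \<open>\<alpha>'\<close>
  with the image of \<open>\<theta>\<close> is contracted to \<open>\<alpha>\<close>.\<close>

locale triple_iso = triple X X' f \<beta> \<alpha> + tilde: triple X X' g \<beta>' \<alpha>'
  for X X' :: "'a span" and f \<beta> \<alpha> g \<beta>' \<alpha>' +
  fixes \<theta> :: "'a elt \<Rightarrow> 'a elt"
  assumes theta_iso: "nat_iso f g \<theta>"
    and beta_tilde [simp]: "s \<in> ob (fdom (fst X)) \<Longrightarrow> \<beta>' s = cmp (fcod (fst X)) (fa (fst X') (\<theta> s)) (\<beta> s)"
    and alpha_tilde: "s \<in> ob (fdom (fst X)) \<Longrightarrow> \<alpha> s = cmp (fcod (snd X)) (\<alpha>' s) (fa (snd X') (\<theta> s))"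
begin

lemma theta_ar [simp]: "fdom (fst X') = S \<Longrightarrow> s \<in> ob (fdom (fst X)) \<Longrightarrow> \<theta> s \<in> ar S"
  and theta_src [simp]: "fdom (fst X') = S \<Longrightarrow> s \<in> ob (fdom (fst X)) \<Longrightarrow> src S (\<theta> s) = fo f s"
  and theta_tgt [simp]: "fdom (fst X') = S \<Longrightarrow> s \<in> ob (fdom (fst X)) \<Longrightarrow> tgt S (\<theta> s) = fo g s"
  using nat_isoD(5)[OF theta_iso, of s] by auto

lemma theta_natural [simp]: "fdom (fst X') = S \<Longrightarrow> m \<in> ar (fdom (fst X)) \<Longrightarrow> tgt (fdom (fst X)) m = s \<Longrightarrow>
    cmp S (\<theta> s) (fa f m) = cmp S (fa g m) (\<theta> (src (fdom (fst X)) m))"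
  using nat_isoD(6)[OF theta_iso, of m] by auto

lemma alpha_tilde_theta [simp]: "fcod (snd X) = G \<Longrightarrow> s \<in> ob (fdom (fst X)) \<Longrightarrow>
    cmp G (\<alpha>' s) (fa (snd X') (\<theta> s)) = \<alpha> s"
  using alpha_tilde by auto

lemma alpha_tilde_theta' [simp]:
  assumes "fcod (snd X) = G" "s \<in> ob (fdom (fst X))" "k \<in> ar G" "tgt G k = fo (snd X') (fo f s)"
  shows "cmp G (\<alpha>' s) (cmp G (fa (snd X') (\<theta> s)) k) = cmp G (\<alpha> s) k"
proof -
  have "finite_groupoid G"
    using assms(1) by auto
  then show ?thesis
    using assms by (subst alpha_tilde) (auto simp del: alpha_tilde_theta)
qed

lemma equiv: "triple_equiv X X' (f, \<beta>, \<alpha>) (g, \<beta>', \<alpha>')"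
proof -
  have "\<exists>\<theta>. nat_iso f g \<theta> \<and> (\<forall>s\<in>ob (fdom (fst X)). \<beta>' s = cmp (fcod (fst X)) (fa (fst X') (\<theta> s)) (\<beta> s) \<and>
      \<alpha> s = cmp (fcod (snd X)) (\<alpha>' s) (fa (snd X') (\<theta> s)))"
    using theta_iso by auto
  then show ?thesis
    using tr tilde.tr by (cases X, cases X') simp
qed

end

lemma triple_equivE:
  assumes "triple_equiv X X' (f, \<beta>, \<alpha>) (g, \<beta>', \<alpha>')" "X \<in> spans" "X' \<in> spans"
  obtains \<theta> where "triple_iso X X' f \<beta> \<alpha> g \<beta>' \<alpha>' \<theta>"
  using assms by (cases X, cases X') (auto simp: triple_iso_def triple_def triple_iso_axioms_def)

lemma triple_isoI:
  assumes "triple X X' f \<beta> \<alpha>" "triple X X' g \<beta>' \<alpha>'"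
    and "\<And>s. s \<in> ob (fdom (fst X)) \<Longrightarrow> \<theta> s \<in> ar (fdom (fst X')) \<and>
      src (fdom (fst X')) (\<theta> s) = fo f s \<and> tgt (fdom (fst X')) (\<theta> s) = fo g s"
    and "\<And>m. m \<in> ar (fdom (fst X)) \<Longrightarrow> cmp (fdom (fst X')) (\<theta> (tgt (fdom (fst X)) m)) (fa f m) =
      cmp (fdom (fst X')) (fa g m) (\<theta> (src (fdom (fst X)) m))"
    and "\<And>s. s \<in> ob (fdom (fst X)) \<Longrightarrow> \<beta>' s = cmp (fcod (fst X)) (fa (fst X') (\<theta> s)) (\<beta> s)"
    and "\<And>s. s \<in> ob (fdom (fst X)) \<Longrightarrow> cmp (fcod (snd X)) (\<alpha>' s) (fa (snd X') (\<theta> s)) = \<alpha> s"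
  shows "triple_iso X X' f \<beta> \<alpha> g \<beta>' \<alpha>' \<theta>"
proof -
  interpret triple X X' f \<beta> \<alpha>
    by (fact assms(1))
  interpret tilde: triple X X' g \<beta>' \<alpha>'
    by (fact assms(2))
  have "nat_iso f g \<theta>"
    by (rule nat_isoI) (use assms(3-) in auto)
  then show ?thesis
    by (intro triple_iso.intro triple_iso_axioms.intro assms(1,2)) (use assms(3-) in auto)
qed

lemma triple_iso_sym:
  assumes "triple_iso X X' f \<beta> \<alpha> g \<beta>' \<alpha>' \<theta>"
  shows "triple_iso X X' g \<beta>' \<alpha>' f \<beta> \<alpha> (\<lambda>s. inv_ar (fdom (fst X')) (\<theta> s))"
proof -
  interpret triple_iso X X' f \<beta> \<alpha> g \<beta>' \<alpha>' \<theta>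
    by (fact assms)
  \<comment> \<open>Functors preserve inverses; this is applied below to both legs of the target
    span.\<close>
  have cancel: "cmp (fcod c) (fa c (inv_ar (fdom (fst X')) (\<theta> s))) (cmp (fcod c) (fa c (\<theta> s)) k) = k"
    "cmp (fcod c) (fa c (\<theta> s)) (fa c (inv_ar (fdom (fst X')) (\<theta> s))) = idt (fcod c) (fo c (fo g s))"
    if "cat_functor c" "fdom c = fdom (fst X')" "finite_groupoid (fcod c)"
      "s \<in> ob (fdom (fst X))" "k \<in> ar (fcod c)" "tgt (fcod c) k = fo c (fo f s)" for c s k
  proof -
    have "cmp (fcod c) (fa c (inv_ar (fdom (fst X')) (\<theta> s))) (cmp (fcod c) (fa c (\<theta> s)) k) =
      cmp (fcod c) (fa c (cmp (fdom (fst X')) (inv_ar (fdom (fst X')) (\<theta> s)) (\<theta> s))) k"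
      using that by (simp del: groupoid.inv_ar(4))
    then show "cmp (fcod c) (fa c (inv_ar (fdom (fst X')) (\<theta> s))) (cmp (fcod c) (fa c (\<theta> s)) k) = k"
      using that by simp
    have "cmp (fcod c) (fa c (\<theta> s)) (fa c (inv_ar (fdom (fst X')) (\<theta> s))) =
      fa c (cmp (fdom (fst X')) (\<theta> s) (inv_ar (fdom (fst X')) (\<theta> s)))"
      using that by (simp del: groupoid.inv_ar(5))
    then show "cmp (fcod c) (fa c (\<theta> s)) (fa c (inv_ar (fdom (fst X')) (\<theta> s))) =
        idt (fcod c) (fo c (fo g s))"
      using that by simp
  qed
  show ?thesis
  proof (rule triple_isoI)
    fix m assume m: "m \<in> ar (fdom (fst X))"
    let ?S = "fdom (fst X')" and ?\<theta> = "\<lambda>s. inv_ar (fdom (fst X')) (\<theta> s)"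
    \<comment> \<open>The naturality square of \<open>\<theta>\<close> placed between inverses on
      both sides; cancelling leaves the square for the inverses.\<close>
    have "cmp ?S (?\<theta> (tgt (fdom (fst X)) m)) (cmp ?S (cmp ?S (fa g m) (\<theta> (src (fdom (fst X)) m)))
        (?\<theta> (src (fdom (fst X)) m))) =
        cmp ?S (?\<theta> (tgt (fdom (fst X)) m)) (cmp ?S (cmp ?S (\<theta> (tgt (fdom (fst X)) m)) (fa f m))
            (?\<theta> (src (fdom (fst X)) m)))"
      using m by simp
    then show "cmp ?S (?\<theta> (tgt (fdom (fst X)) m)) (fa g m) =
        cmp ?S (fa f m) (?\<theta> (src (fdom (fst X)) m))"
      using m by (simp del: theta_natural)
  next
    fix s assume s: "s \<in> ob (fdom (fst X))"
    show "\<beta> s = cmp (fcod (fst X)) (fa (fst X') (inv_ar (fdom (fst X')) (\<theta> s))) (\<beta>' s)"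
      using s cancel(1)[of "fst X'" s "\<beta> s"] by simp
    show "cmp (fcod (snd X)) (\<alpha> s) (fa (snd X') (inv_ar (fdom (fst X')) (\<theta> s))) = \<alpha>' s"
      using s cancel(2)[of "snd X'" s "idt (fcod (snd X)) (fo (snd X') (fo f s))"]
      by (subst alpha_tilde) (simp_all del: alpha_tilde_theta)
  qed (use triple_axioms tilde.triple_axioms in auto)
qed

lemma triple_iso_trans:
  assumes "triple_iso X X' f \<beta> \<alpha> g \<beta>' \<alpha>' \<theta>" "triple_iso X X' g \<beta>' \<alpha>' h \<beta>'' \<alpha>'' \<eta>"
  shows "triple_iso X X' f \<beta> \<alpha> h \<beta>'' \<alpha>'' (\<lambda>s. cmp (fdom (fst X')) (\<eta> s) (\<theta> s))"
proof -
  interpret triple_iso X X' f \<beta> \<alpha> g \<beta>' \<alpha>' \<theta>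
    by (fact assms)
  interpret eta: triple_iso X X' g \<beta>' \<alpha>' h \<beta>'' \<alpha>'' \<eta>
    by (fact assms)
  \<comment> \<open>Naturality of \<open>\<eta>\<close> with a tail, which is what the right-nested
    composite with \<open>\<theta>\<close> offers.\<close>
  have [simp]: "cmp (fdom (fst X')) (\<eta> s) (cmp (fdom (fst X')) (fa g m) k) =
     cmp (fdom (fst X')) (fa h m) (cmp (fdom (fst X')) (\<eta> (src (fdom (fst X)) m)) k)"
    if "m \<in> ar (fdom (fst X))" "s = tgt (fdom (fst X)) m" "k \<in> ar (fdom (fst X'))"
        "tgt (fdom (fst X')) k = fo g (src (fdom (fst X)) m)"
    for s m k
    using that category.cmp_cmp[of "fdom (fst X')" k "fa g m" "\<eta> s"]
    category.cmp_cmp[of "fdom (fst X')" k "\<eta> (src (fdom (fst X)) m)"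
        "fa h m"] eta.theta_natural[of "fdom (fst X')" m s]
    by (simp del: category.cmp_cmp)
  show ?thesis
    by (rule triple_isoI) (use triple_axioms eta.tilde.triple_axioms in auto)
qed

lemma span_cell_eqI:
  assumes "triple_iso X X' f \<beta> \<alpha> g \<beta>' \<alpha>' \<theta>"
  shows "span_cell X X' (f, \<beta>, \<alpha>) = span_cell X X' (g, \<beta>', \<alpha>')"
proof -
  interpret triple_iso X X' f \<beta> \<alpha> g \<beta>' \<alpha>' \<theta>
    by (fact assms)
  have "triple_equiv X X' (f, \<beta>, \<alpha>) t \<longleftrightarrow> triple_equiv X X' (g, \<beta>', \<alpha>') t" for t
  proof (cases t)
    case (fields h \<beta>'' \<alpha>'')
    show ?thesis
      unfolding fields
    proof
      assume "triple_equiv X X' (f, \<beta>, \<alpha>) (h, \<beta>'', \<alpha>'')"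
      then obtain \<eta> where "triple_iso X X' f \<beta> \<alpha> h \<beta>'' \<alpha>'' \<eta>"
        by (rule triple_equivE) simp_all
      from triple_iso_trans[OF triple_iso_sym[OF assms] this]
      show "triple_equiv X X' (g, \<beta>', \<alpha>') (h, \<beta>'', \<alpha>'')"
        by (rule triple_iso.equiv)
    next
      assume "triple_equiv X X' (g, \<beta>', \<alpha>') (h, \<beta>'', \<alpha>'')"
      then obtain \<eta> where "triple_iso X X' g \<beta>' \<alpha>' h \<beta>'' \<alpha>'' \<eta>"
        by (rule triple_equivE) simp_all
      from triple_iso_trans[OF assms this]
      show "triple_equiv X X' (f, \<beta>, \<alpha>) (h, \<beta>'', \<alpha>'')"
        by (rule triple_iso.equiv)
    qed
  qed
  then show ?thesis
    by (simp add: span_cell_def triple_class_def)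
qed

text \<open>Triples are total functions, so agreement on the carriers does not make them equal; the
  identity transformation makes them equivalent, and this is equality of 2-cells. In this sense laws
  of spans hold strictly on representatives.\<close>

lemma span_cell_agree:
  assumes "triple X X' f \<beta> \<alpha>" "triple X X' g \<beta>' \<alpha>'"
    and "\<And>s. s \<in> ob (fdom (fst X)) \<Longrightarrow> fo f s = fo g s \<and> \<beta> s = \<beta>' s \<and> \<alpha> s = \<alpha>' s"
    and "\<And>m. m \<in> ar (fdom (fst X)) \<Longrightarrow> fa f m = fa g m"
  shows "span_cell X X' (f, \<beta>, \<alpha>) = span_cell X X' (g, \<beta>', \<alpha>')"
proof -
  interpret triple X X' f \<beta> \<alpha>
    by (fact assms)
  interpret tilde: triple X X' g \<beta>' \<alpha>'
    by (fact assms)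
  have "triple_iso X X' f \<beta> \<alpha> g \<beta>' \<alpha>' (\<lambda>s. idt (fdom (fst X')) (fo g s))"
    by (rule triple_isoI) (use assms in auto)
  then show ?thesis
    by (rule span_cell_eqI)
qed

lemma span_cellsE:
  assumes "A \<in> span_cells"
  obtains X X' f \<beta> \<alpha> where "A = span_cell X X' (f, \<beta>, \<alpha>)" "triple X X' f \<beta> \<alpha>"
  using assms by (force simp: span_cells_def triple_def)

lemma span_cellsI [simp]: "triple X X' f \<beta> \<alpha> \<Longrightarrow> span_cell X X' (f, \<beta>, \<alpha>) \<in> span_cells"
  unfolding span_cells_def triple_def by blast

lemma span_cell_simps [simp]: "csrc (span_cell X X' t) = X" "ctrg (span_cell X X' t) = X'"
  "cmap (span_cell X X' t) = triple_class X X' t"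
  by (simp_all add: span_cell_def)

section \<open>Iso-comma groupoids\<close>

declare tri_def [simp]

lemma isocomma_simps [simp]:
  "src (isocomma c b) m = tfst (tfst m)" "tgt (isocomma c b) m = tsnd (tfst m)"
  "cmp (isocomma c b) n m = Tup (Tup (tfst (tfst m)) (tsnd (tfst n)))
    (Tup (cmp (fdom c) (tri2 n) (tri2 m)) (cmp (fdom b) (tri3 n) (tri3 m)))"
  "idt (isocomma c b) x = Tup (Tup x x) (Tup (idt (fdom c) (tri1 x)) (idt (fdom b) (tri2 x)))"
  by (simp_all add: isocomma_def Let_def)

lemma isocomma_ob [simp]: "Tup t (Tup s \<gamma>) \<in> ob (isocomma c b) \<longleftrightarrow>
    t \<in> ob (fdom c) \<and> s \<in> ob (fdom b) \<and> \<gamma> \<in> ar (fcod c) \<and> src (fcod c) \<gamma> = fo c t \<and> tgt (fcod c) \<gamma> =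
        fo b s"
  by (auto simp: isocomma_def Let_def hom_iff)

lemma isocomma_obE:
  assumes "x \<in> ob (isocomma c b)"
  obtains t s \<gamma> where "x = Tup t (Tup s \<gamma>)" "t \<in> ob (fdom c)" "s \<in> ob (fdom b)"
    "\<gamma> \<in> ar (fcod c)" "src (fcod c) \<gamma> = fo c t" "tgt (fcod c) \<gamma> = fo b s"
  using assms by (auto simp: isocomma_def Let_def hom_iff)

lemma isocomma_ar [simp]: "Tup (Tup x x') (Tup \<phi> \<psi>) \<in> ar (isocomma c b) \<longleftrightarrow>
    x \<in> ob (isocomma c b) \<and> x' \<in> ob (isocomma c b) \<and>
    \<phi> \<in> ar (fdom c) \<and> src (fdom c) \<phi> = tri1 x \<and> tgt (fdom c) \<phi> = tri1 x' \<and>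
    \<psi> \<in> ar (fdom b) \<and> src (fdom b) \<psi> = tri2 x \<and> tgt (fdom b) \<psi> = tri2 x' \<and>
    cmp (fcod c) (tri3 x') (fa c \<phi>) = cmp (fcod c) (fa b \<psi>) (tri3 x)"
  by (auto simp: isocomma_def Let_def hom_iff)

text \<open>The form in which a commuting square is usable inside a right-nested composite.\<close>

lemma cmp_square:
  assumes "cmp H a b = cmp H c d" "category H" "a \<in> ar H" "b \<in> ar H" "c \<in> ar H" "d \<in> ar H" "k \<in> ar H"
    "src H a = tgt H b" "src H c = tgt H d" "src H b = tgt H k" "src H d = tgt H k"
  shows "cmp H a (cmp H b k) = cmp H c (cmp H d k)"
  using assms category.cmp_cmp[of H k b a] category.cmp_cmp[of H k d c] by (simp del: category.cmp_cmp)

text \<open>Exposes an arrow as a term in \<open>Tup\<close>, on which the evaluation rules act. The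
  last clause is the defining square with a tail \<open>k\<close>.\<close>

lemma isocomma_arE:
  assumes "m \<in> ar (isocomma c b)"
  obtains \<phi> \<psi> \<gamma> \<gamma>' where
    "m = Tup (Tup (Tup (src (fdom c) \<phi>) (Tup (src (fdom b) \<psi>) \<gamma>)) (Tup (tgt (fdom c) \<phi>)
        (Tup (tgt (fdom b) \<psi>) \<gamma>')))
      (Tup \<phi> \<psi>)"
    "\<phi> \<in> ar (fdom c)" "\<psi> \<in> ar (fdom b)"
    "\<gamma> \<in> ar (fcod c)" "src (fcod c) \<gamma> = fo c (src (fdom c) \<phi>)" "tgt (fcod c) \<gamma> = fo b (src (fdom b) \<psi>)"
    "\<gamma>' \<in> ar (fcod c)" "src (fcod c) \<gamma>' = fo c (tgt (fdom c) \<phi>)" "tgt (fcod c) \<gamma>' =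
        fo b (tgt (fdom b) \<psi>)"
    "cmp (fcod c) \<gamma>' (fa c \<phi>) = cmp (fcod c) (fa b \<psi>) \<gamma>"
    "\<And>k. cat_functor c \<Longrightarrow> cat_functor b \<Longrightarrow> fcod c = fcod b \<Longrightarrow> k \<in> ar (fcod c) \<Longrightarrow>
      tgt (fcod c) k = fo c (src (fdom c) \<phi>) \<Longrightarrow>
      cmp (fcod c) \<gamma>' (cmp (fcod c) (fa c \<phi>) k) = cmp (fcod c) (fa b \<psi>) (cmp (fcod c) \<gamma> k)"
proof -
  obtain x x' \<phi> \<psi> where m: "m = Tup (Tup x x') (Tup \<phi> \<psi>)" "Tup (Tup x x') (Tup \<phi> \<psi>) \<in> ar (isocomma c b)"
    using assms by (auto simp: isocomma_def Let_def hom_iff)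
  then obtain t s \<gamma> t' s' \<gamma>' where x: "x = Tup t (Tup s \<gamma>)" "x' = Tup t' (Tup s' \<gamma>')"
    by (auto elim!: isocomma_obE)
  show thesis
    by (rule that[of \<phi> \<psi> \<gamma> \<gamma>'])
      (use m x in \<open>auto intro!: cmp_square simp: cat_functor.cat_cod\<close>)
qed

lemma finite_groupoid_isocomma [simp]:
  assumes "cat_functor c" "cat_functor b" "fcod c = fcod b"
    "finite_groupoid (fdom c)" "finite_groupoid (fdom b)" "finite_groupoid (fcod b)"
  shows "finite_groupoid (isocomma c b)"
proof -
  let ?H = "fcod b"
  have cat: "category (isocomma c b)"
  proof (rule categoryI)
    fix f g assume A: "f \<in> ar (isocomma c b)" "g \<in> ar (isocomma c b)" "src (isocomma c b) g =
        tgt (isocomma c b) f"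
    show "cmp (isocomma c b) g f \<in> ar (isocomma c b) \<and> src (isocomma c b) (cmp (isocomma c b) g f) =
        src (isocomma c b) f \<and>
      tgt (isocomma c b) (cmp (isocomma c b) g f) = tgt (isocomma c b) g"
      by (rule isocomma_arE[OF A(1)], rule isocomma_arE[OF A(2)])
        (use A(3) assms in \<open>auto\<close>)
  qed (use assms in \<open>auto elim!: isocomma_arE isocomma_obE\<close>)
  have grp: "groupoid (isocomma c b)"
  proof (rule groupoidI[OF cat])
    fix f assume "f \<in> ar (isocomma c b)"
    then show "\<exists>g \<in> ar (isocomma c b). src (isocomma c b) g = tgt (isocomma c b) f \<and>
      tgt (isocomma c b) g = src (isocomma c b) f \<and>
      cmp (isocomma c b) g f = idt (isocomma c b) (src (isocomma c b) f) \<and>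
      cmp (isocomma c b) f g = idt (isocomma c b) (tgt (isocomma c b) f)"
    proof (rule isocomma_arE)
      fix \<phi> \<psi> \<gamma> \<gamma>'
      assume f: "f = Tup (Tup (Tup (src (fdom c) \<phi>) (Tup (src (fdom b) \<psi>) \<gamma>)) (Tup (tgt (fdom c) \<phi>)
          (Tup (tgt (fdom b) \<psi>) \<gamma>')))
          (Tup \<phi> \<psi>)"
        and A: "\<phi> \<in> ar (fdom c)" "\<psi> \<in> ar (fdom b)"
          "\<gamma> \<in> ar (fcod c)" "src (fcod c) \<gamma> = fo c (src (fdom c) \<phi>)" "tgt (fcod c) \<gamma> =
              fo b (src (fdom b) \<psi>)"
          "\<gamma>' \<in> ar (fcod c)" "src (fcod c) \<gamma>' = fo c (tgt (fdom c) \<phi>)" "tgt (fcod c) \<gamma>' =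
              fo b (tgt (fdom b) \<psi>)"
        and sq: "cmp (fcod c) \<gamma>' (fa c \<phi>) = cmp (fcod c) (fa b \<psi>) \<gamma>"
      let ?\<phi> = "inv_ar (fdom c) \<phi>" and ?\<psi> = "inv_ar (fdom b) \<psi>"
      \<comment> \<open>The square of the inverse pair comes from the given one by composing with
        the inverse of \<open>b \<psi>\<close> on the left and that of \<open>c \<phi>\<close> on
        the right.\<close>
      have "cmp ?H (fa b ?\<psi>) (cmp ?H (cmp ?H \<gamma>' (fa c \<phi>)) (fa c ?\<phi>)) =
          cmp ?H (fa b ?\<psi>) (cmp ?H (cmp ?H (fa b \<psi>) \<gamma>) (fa c ?\<phi>))"
        using sq assms(3) by simp
      moreover have "cmp ?H (fa c \<phi>) (fa c ?\<phi>) = fa c (cmp (fdom c) \<phi> ?\<phi>)"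
        using A assms by (simp del: inv_ar_simps(5))
      moreover have "cmp ?H (fa b ?\<psi>) (cmp ?H (fa b \<psi>) k) = cmp ?H (fa b (cmp (fdom b) ?\<psi> \<psi>)) k"
        if "k \<in> ar ?H" "tgt ?H k = fo b (src (fdom b) \<psi>)" for k
        using A assms that by (simp del: inv_ar_simps(4))
      ultimately have "cmp ?H (fa b ?\<psi>) \<gamma>' = cmp ?H \<gamma> (fa c ?\<phi>)"
        using A assms by simp
      then show ?thesis
        using A assms unfolding f
        by (intro bexI[of _ "Tup (Tup (Tup (tgt (fdom c) \<phi>) (Tup (tgt (fdom b) \<psi>) \<gamma>'))
            (Tup (src (fdom c) \<phi>) (Tup (src (fdom b) \<psi>) \<gamma>)))
          (Tup ?\<phi> ?\<psi>)"]) auto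
    qed
  qed
  note fin = finite_groupoid.finite_ob finite_groupoid.finite_ar
  have "ob (isocomma c b) \<subseteq> (\<lambda>(t, s, \<gamma>). Tup t (Tup s \<gamma>)) ` (ob (fdom c) \<times> ob (fdom b) \<times> ar ?H)"
    using assms(3) by (auto elim!: isocomma_obE simp: image_iff)
  then have ob: "finite (ob (isocomma c b))"
    by (rule finite_subset) (intro finite_imageI finite_cartesian_product fin assms)
  have "ar (isocomma c b) \<subseteq> (\<lambda>(x, x', \<phi>, \<psi>). Tup (Tup x x') (Tup \<phi> \<psi>)) `
      (ob (isocomma c b) \<times> ob (isocomma c b) \<times> ar (fdom c) \<times> ar (fdom b))"
    by (auto simp: isocomma_def Let_def hom_iff image_iff)
  then have "finite (ar (isocomma c b))"
    by (rule finite_subset) (intro finite_imageI finite_cartesian_product fin ob assms)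
  then show ?thesis
    using grp ob by (simp add: finite_groupoid_def finite_groupoid_axioms_def)
qed

lemma proj_simps [simp]: "fdom (proj1 c b) = isocomma c b" "fcod (proj1 c b) = fdom c"
  "fo (proj1 c b) x = tri1 x" "fa (proj1 c b) m = tri2 m"
  "fdom (proj2 c b) = isocomma c b" "fcod (proj2 c b) = fdom b"
  "fo (proj2 c b) x = tri2 x" "fa (proj2 c b) m = tri3 m"
  by (simp_all add: proj1_def proj2_def)

lemma proj_functor [simp]:
  assumes "cat_functor c" "cat_functor b" "fcod c = fcod b"
    "finite_groupoid (fdom c)" "finite_groupoid (fdom b)" "finite_groupoid (fcod b)"
  shows "cat_functor (proj1 c b)" "cat_functor (proj2 c b)"
  by (rule cat_functorI; use assms in \<open>auto elim!: isocomma_arE isocomma_obE\<close>)+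

section \<open>The bicategory of spans\<close>

lemma span_id_simps [simp]: "fst (span_id G) = fid G" "snd (span_id G) = fid G"
  by (simp_all add: span_id_def)

lemma span_id_span [simp]: "finite_groupoid G \<Longrightarrow> span_id G \<in> spans"
  by (rule spansI) auto

lemma span_comp_simps [simp]:
  "fst (span_comp X Y) = fcomp (fst Y) (proj1 (snd Y) (fst X))"
  "snd (span_comp X Y) = fcomp (snd X) (proj2 (snd Y) (fst X))"
  by (cases X, cases Y, simp)+

lemma span_comp_span [simp]:
  assumes "X \<in> spans" "Y \<in> spans" "fcod (snd Y) = fcod (fst X)"
  shows "span_comp X Y \<in> spans"
  by (rule spansI) (use assms in auto)

text \<open>The locale for a triple kept as a single variable, so that composites such as
  \<open>triple_vcomp X t' t\<close> can be nested without splitting them into components.\<close>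

definition span_triple :: "'a span \<Rightarrow> 'a span \<Rightarrow> 'a triple \<Rightarrow> bool" where
  "span_triple X X' t \<longleftrightarrow> triple X X' (fst t) (fst (snd t)) (snd (snd t))"

lemma span_tripleI:
  assumes "X \<in> spans" "X' \<in> spans" "fcod (fst X') = fcod (fst X)" "fcod (snd X') = fcod (snd X)"
    and "cat_functor f" "fdom f = fdom (fst X)" "fcod f = fdom (fst X')"
    and "\<And>s. s \<in> ob (fdom (fst X)) \<Longrightarrow> \<beta> s \<in> ar (fcod (fst X)) \<and>
      src (fcod (fst X)) (\<beta> s) = fo (fst X) s \<and> tgt (fcod (fst X)) (\<beta> s) = fo (fst X') (fo f s)"
    and "\<And>s. s \<in> ob (fdom (fst X)) \<Longrightarrow> \<alpha> s \<in> ar (fcod (snd X)) \<and>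
      src (fcod (snd X)) (\<alpha> s) = fo (snd X') (fo f s) \<and> tgt (fcod (snd X)) (\<alpha> s) = fo (snd X) s"
    and "\<And>m. m \<in> ar (fdom (fst X)) \<Longrightarrow> cmp (fcod (fst X)) (\<beta> (tgt (fdom (fst X)) m)) (fa (fst X) m) =
      cmp (fcod (fst X)) (fa (fst X') (fa f m)) (\<beta> (src (fdom (fst X)) m))"
    and "\<And>m. m \<in> ar (fdom (fst X)) \<Longrightarrow> cmp (fcod (snd X)) (\<alpha> (tgt (fdom (fst X)) m))
        (fa (snd X') (fa f m)) =
      cmp (fcod (snd X)) (fa (snd X) m) (\<alpha> (src (fdom (fst X)) m))"
  shows "span_triple X X' (f, \<beta>, \<alpha>)"
  unfolding span_triple_def fst_conv snd_conv
  by (intro triple.intro is_tripleI) (use assms in \<open>auto simp: parallel_def\<close>)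

lemma triple_vcomp_eq: "triple_vcomp X t' t = (fcomp (fst t') (fst t),
      \<lambda>s. cmp (fcod (fst X)) (fst (snd t') (fo (fst t) s)) (fst (snd t) s),
      \<lambda>s. cmp (fcod (snd X)) (snd (snd t) s) (snd (snd t') (fo (fst t) s)))"
  by (cases t, cases t') simp

lemma span_triple_vcomp:
  assumes "span_triple X X' t" "span_triple X' X'' t'"
  shows "span_triple X X'' (triple_vcomp X t' t)"
proof -
  interpret triple X X' "fst t" "fst (snd t)" "snd (snd t)"
    using assms(1) by (simp add: span_triple_def)
  interpret t': triple X' X'' "fst t'" "fst (snd t')" "snd (snd t')"
    using assms(2) by (simp add: span_triple_def)
  show ?thesis
    unfolding triple_vcomp_eq by (rule span_tripleI) auto
qed

lemma isocomma_map_simps [simp]: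
  "fdom (isocomma_map X X' Y Y' t t') = isocomma (snd Y) (fst X)"
  "fcod (isocomma_map X X' Y Y' t t') = isocomma (snd Y') (fst X')"
  "fo (isocomma_map X X' Y Y' t t') (Tup u (Tup v \<gamma>)) = Tup (fo (fst t') u) (Tup (fo (fst t) v)
     (cmp (fcod (fst X)) (cmp (fcod (fst X)) (fst (snd t) v) \<gamma>) (snd (snd t') u)))"
  "fa (isocomma_map X X' Y Y' t t') (Tup (Tup x x') (Tup \<phi> \<psi>)) =
    Tup (Tup (fo (isocomma_map X X' Y Y' t t') x) (fo (isocomma_map X X' Y Y' t t') x'))
      (Tup (fa (fst t') \<phi>) (fa (fst t) \<psi>))"
  by (cases t, cases t', simp add: isocomma_map_def Let_def)+

lemma triple_hcomp_eq: "triple_hcomp X X' Y Y' t t' =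
    (isocomma_map X X' Y Y' t t', \<lambda>x. fst (snd t') (tri1 x), \<lambda>x. snd (snd t) (tri2 x))"
  by (cases t, cases t') (simp add: triple_hcomp_def)

text \<open>An image pair satisfies the iso-comma square by naturality of the two components pasted
  onto the connecting arrow, the \<open>\<beta>\<close> of \<open>t\<close> and the
  \<open>\<alpha>\<close> of \<open>t'\<close>.\<close>

lemma isocomma_map_functor:
  assumes "span_triple X X' t" "span_triple Y Y' t'" "fcod (snd Y) = fcod (fst X)"
  shows "cat_functor (isocomma_map X X' Y Y' t t')"
proof -
  interpret t: triple X X' "fst t" "fst (snd t)" "snd (snd t)"
    using assms(1) by (simp add: span_triple_def)
  interpret t': triple Y Y' "fst t'" "fst (snd t')" "snd (snd t')"
    using assms(2) by (simp add: span_triple_def)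
  show ?thesis
    by (rule cat_functorI) (use assms(3) in \<open>auto elim!: isocomma_arE isocomma_obE\<close>)
qed

lemma span_triple_hcomp:
  assumes "span_triple X X' t" "span_triple Y Y' t'" "fcod (snd Y) = fcod (fst X)"
  shows "span_triple (span_comp X Y) (span_comp X' Y') (triple_hcomp X X' Y Y' t t')"
proof -
  interpret t: triple X X' "fst t" "fst (snd t)" "snd (snd t)"
    using assms(1) by (simp add: span_triple_def)
  interpret t': triple Y Y' "fst t'" "fst (snd t')" "snd (snd t')"
    using assms(2) by (simp add: span_triple_def)
  show ?thesis
    unfolding triple_hcomp_eq
    by (rule span_tripleI) (use assms(3) isocomma_map_functor[OF assms] in \<open>auto elim!: isocomma_arE
        isocomma_obE\<close>)
qed

section \<open>Compositions of 2-cells descend to classes\<close>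

definition span_triple_iso :: "'a span \<Rightarrow> 'a span \<Rightarrow> 'a triple \<Rightarrow> 'a triple \<Rightarrow> ('a elt \<Rightarrow> 'a elt) \<Rightarrow> bool"
    where
  "span_triple_iso X X' t u \<theta> \<longleftrightarrow>
     triple_iso X X' (fst t) (fst (snd t)) (snd (snd t)) (fst u) (fst (snd u)) (snd (snd u)) \<theta>"

lemma span_triple_isoI:
  assumes "span_triple X X' t" "span_triple X X' u"
    and "\<And>s. s \<in> ob (fdom (fst X)) \<Longrightarrow> \<theta> s \<in> ar (fdom (fst X')) \<and>
      src (fdom (fst X')) (\<theta> s) = fo (fst t) s \<and> tgt (fdom (fst X')) (\<theta> s) = fo (fst u) s"
    and "\<And>m. m \<in> ar (fdom (fst X)) \<Longrightarrow> cmp (fdom (fst X')) (\<theta> (tgt (fdom (fst X)) m)) (fa (fst t) m) =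
      cmp (fdom (fst X')) (fa (fst u) m) (\<theta> (src (fdom (fst X)) m))"
    and "\<And>s. s \<in> ob (fdom (fst X)) \<Longrightarrow> fst (snd u) s = cmp (fcod (fst X)) (fa (fst X') (\<theta> s))
        (fst (snd t) s)"
    and "\<And>s. s \<in> ob (fdom (fst X)) \<Longrightarrow> cmp (fcod (snd X)) (snd (snd u) s) (fa (snd X') (\<theta> s)) =
        snd (snd t) s"
  shows "span_triple_iso X X' t u \<theta>"
  unfolding span_triple_iso_def by (rule triple_isoI) (use assms in \<open>auto simp: span_triple_def\<close>)

lemma span_cell_iso: "span_triple_iso X X' t u \<theta> \<Longrightarrow> span_cell X X' t = span_cell X X' u"
  using span_cell_eqI[of X X' "fst t" "fst (snd t)" "snd (snd t)"] by (auto simp: span_triple_iso_def)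

lemma span_cell_cong:
  assumes "span_triple X X' t" "span_triple X X' u"
    and "\<And>s. s \<in> ob (fdom (fst X)) \<Longrightarrow>
      fo (fst t) s = fo (fst u) s \<and> fst (snd t) s = fst (snd u) s \<and> snd (snd t) s = snd (snd u) s"
    and "\<And>m. m \<in> ar (fdom (fst X)) \<Longrightarrow> fa (fst t) m = fa (fst u) m"
  shows "span_cell X X' t = span_cell X X' u"
  using span_cell_agree[of X X' "fst t" "fst (snd t)" "snd (snd t)" "fst u" "fst (snd u)"
      "snd (snd u)"] assms
  by (auto simp: span_triple_def)

lemma triple_class_iso:
  assumes "u \<in> triple_class X X' t" "span_triple X X' t"
  obtains \<theta> where "span_triple_iso X X' t u \<theta>"
proof -
  have "triple_equiv X X' (fst t, fst (snd t), snd (snd t)) (fst u, fst (snd u), snd (snd u))"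
    using assms(1) by (simp add: triple_class_def)
  then show thesis
    using assms(2) that by (elim triple_equivE) (auto simp: span_triple_iso_def span_triple_def
        triple_def)
qed

lemma span_triple_iso_tripl: "span_triple_iso X X' t u \<theta> \<Longrightarrow> span_triple X X' t"
    "span_triple_iso X X' t u \<theta> \<Longrightarrow> span_triple X X' u"
  by (auto simp: span_triple_iso_def span_triple_def triple_iso_def)

lemma triple_class_self:
  assumes "span_triple X X' t"
  shows "t \<in> triple_class X X' t"
proof -
  interpret triple X X' "fst t" "fst (snd t)" "snd (snd t)"
    using assms by (simp add: span_triple_def)
  have "span_triple_iso X X' t t (\<lambda>s. idt (fdom (fst X')) (fo (fst t) s))"
    by (rule span_triple_isoI) (use assms in auto)
  from triple_iso.equiv[OF this[unfolded span_triple_iso_def]] show ?thesis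
    by (simp add: triple_class_def)
qed

lemma triple_class_eq: "span_triple_iso X X' t u \<theta> \<Longrightarrow> triple_class X X' u = triple_class X X' t"
  using span_cell_iso[of X X' t u \<theta>] by (simp add: span_cell_def)

text \<open>The witness is the horizontal composite of \<open>\<theta>\<close> and
  \<open>\<theta>'\<close>.\<close>

lemma span_triple_iso_vcomp:
  assumes "span_triple_iso X X' t u \<theta>" "span_triple_iso X' X'' t' u' \<theta>'"
  shows "span_triple_iso X X'' (triple_vcomp X t' t) (triple_vcomp X u' u)
    (\<lambda>s. cmp (fdom (fst X'')) (fa (fst u') (\<theta> s)) (\<theta>' (fo (fst t) s)))"
proof -
  interpret t: triple_iso X X' "fst t" "fst (snd t)" "snd (snd t)" "fst u" "fst (snd u)" "snd (snd u)" \<theta>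
    using assms(1) by (simp add: span_triple_iso_def)
  interpret t': triple_iso X' X'' "fst t'" "fst (snd t')" "snd (snd t')" "fst u'" "fst (snd u')"
      "snd (snd u')" \<theta>'
    using assms(2) by (simp add: span_triple_iso_def)
  \<comment> \<open>The functor of \<open>u'\<close> applied to naturality of
    \<open>\<theta>\<close>.\<close>
  have nat: "cmp (fdom (fst X'')) (fa (fst u') (\<theta> (tgt (fdom (fst X)) m))) (cmp (fdom (fst X''))
      (fa (fst u') (fa (fst t) m)) k) =
      cmp (fdom (fst X'')) (fa (fst u') (fa (fst u) m)) (cmp (fdom (fst X''))
          (fa (fst u') (\<theta> (src (fdom (fst X)) m))) k)"
    if "m \<in> ar (fdom (fst X))" "k \<in> ar (fdom (fst X''))" "tgt (fdom (fst X'')) k =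
        fo (fst u') (fo (fst t) (src (fdom (fst X)) m))" for m k
  proof -
    have "fa (fst u') (cmp (fdom (fst X')) (\<theta> (tgt (fdom (fst X)) m)) (fa (fst t) m)) =
      fa (fst u') (cmp (fdom (fst X')) (fa (fst u) m) (\<theta> (src (fdom (fst X)) m)))"
      using that by simp
    then have "cmp (fdom (fst X'')) (fa (fst u') (\<theta> (tgt (fdom (fst X)) m)))
        (fa (fst u') (fa (fst t) m)) =
      cmp (fdom (fst X'')) (fa (fst u') (fa (fst u) m)) (fa (fst u') (\<theta> (src (fdom (fst X)) m)))"
      using that by (simp del: t.theta_natural)
    then show ?thesis
      by (rule cmp_square) (use that in auto)
  qed
  \<comment> \<open>The leg \<open>fst X''\<close> applied to naturality of \<open>\<theta>'\<close>
    at the arrow \<open>\<theta> s\<close>; it reconciles the two ways of writing the horizontal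
    composite.\<close>
  have sq: "cmp (fcod (fst X)) (fa (fst X'') (\<theta>' (fo (fst u) s))) (cmp (fcod (fst X))
      (fa (fst X'') (fa (fst t') (\<theta> s))) k) =
      cmp (fcod (fst X)) (fa (fst X'') (fa (fst u') (\<theta> s))) (cmp (fcod (fst X))
          (fa (fst X'') (\<theta>' (fo (fst t) s))) k)"
    if "s \<in> ob (fdom (fst X))" "k \<in> ar (fcod (fst X))" "tgt (fcod (fst X)) k =
        fo (fst X'') (fo (fst t') (fo (fst t) s))" for s k
  proof -
    have "fa (fst X'') (cmp (fdom (fst X'')) (\<theta>' (fo (fst u) s)) (fa (fst t') (\<theta> s))) =
      fa (fst X'') (cmp (fdom (fst X'')) (fa (fst u') (\<theta> s)) (\<theta>' (fo (fst t) s)))"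
      using that by simp
    then have "cmp (fcod (fst X)) (fa (fst X'') (\<theta>' (fo (fst u) s)))
        (fa (fst X'') (fa (fst t') (\<theta> s))) =
      cmp (fcod (fst X)) (fa (fst X'') (fa (fst u') (\<theta> s))) (fa (fst X'') (\<theta>' (fo (fst t) s)))"
      using that by (simp del: t'.theta_natural)
    then show ?thesis
      by (rule cmp_square) (use that in auto)
  qed
  note T = span_triple_vcomp[OF span_triple_iso_tripl(1)[OF assms(1)] span_triple_iso_tripl(1)[OF
      assms(2)]]
    span_triple_vcomp[OF span_triple_iso_tripl(2)[OF assms(1)] span_triple_iso_tripl(2)[OF assms(2)]]
  show ?thesis
    by (rule span_triple_isoI[OF T]) (use nat sq in \<open>auto simp: triple_vcomp_eq\<close>)
qed

text \<open>The pair \<open>(\<theta>', \<theta>)\<close> is an arrow of the iso-comma groupoid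
  because of the equivalence equations: \<open>\<beta>\<close> on the \<open>X\<close> side and
  \<open>\<alpha>\<close> on the \<open>Y\<close> side change by the images of
  \<open>\<theta>\<close> and \<open>\<theta>'\<close>.\<close>

lemma span_triple_iso_hcomp:
  assumes "span_triple_iso X X' t u \<theta>" "span_triple_iso Y Y' t' u' \<theta>'" "fcod (snd Y) = fcod (fst X)"
  shows "span_triple_iso (span_comp X Y) (span_comp X' Y') (triple_hcomp X X' Y Y' t t')
      (triple_hcomp X X' Y Y' u u')
    (\<lambda>x. Tup (Tup (fo (isocomma_map X X' Y Y' t t') x) (fo (isocomma_map X X' Y Y' u u') x))
      (Tup (\<theta>' (tri1 x)) (\<theta> (tri2 x))))"
proof -
  interpret t: triple_iso X X' "fst t" "fst (snd t)" "snd (snd t)" "fst u" "fst (snd u)" "snd (snd u)" \<theta>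
    using assms(1) by (simp add: span_triple_iso_def)
  interpret t': triple_iso Y Y' "fst t'" "fst (snd t')" "snd (snd t')" "fst u'" "fst (snd u')"
      "snd (snd u')" \<theta>'
    using assms(2) by (simp add: span_triple_iso_def)
  note T = span_triple_hcomp[OF span_triple_iso_tripl(1)[OF assms(1)] span_triple_iso_tripl(1)[OF
      assms(2)] assms(3)]
    span_triple_hcomp[OF span_triple_iso_tripl(2)[OF assms(1)] span_triple_iso_tripl(2)[OF assms(2)]
        assms(3)]
  show ?thesis
    by (rule span_triple_isoI[OF T])
      (use assms(3) in \<open>auto simp: triple_hcomp_eq elim!: isocomma_arE isocomma_obE\<close>)
qed

text \<open>\<open>span_vcomp\<close> takes a union over all pairs of representatives. Every member
  of it is the same class and there is at least one pair, so the union is that class.\<close>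

lemma span_vcomp_cell [simp]:
  assumes "span_triple X X' t" "span_triple X' X'' t'"
  shows "span_vcomp (span_cell X' X'' t') (span_cell X X' t) = span_cell X X'' (triple_vcomp X t' t)"
proof -
  have "triple_class X X'' (triple_vcomp X u' u) = triple_class X X'' (triple_vcomp X t' t)"
    if "u \<in> triple_class X X' t" "u' \<in> triple_class X' X'' t'" for u u'
    using that assms by (meson triple_class_iso span_triple_iso_vcomp triple_class_eq)
  then have "(\<Union>u'\<in>triple_class X' X'' t'. \<Union>u\<in>triple_class X X' t. triple_class X X'' (triple_vcomp X
      u' u)) =
      (\<Union>u'\<in>triple_class X' X'' t'. \<Union>u\<in>triple_class X X' t. triple_class X X'' (triple_vcomp X t' t))"
    by (intro SUP_cong refl)
  also have "\<dots> = triple_class X X'' (triple_vcomp X t' t)"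
    using triple_class_self[OF assms(1)] triple_class_self[OF assms(2)] by blast
  finally show ?thesis
    by (simp add: span_vcomp_def span_cell_def)
qed

lemma span_hcomp_cell [simp]:
  assumes "span_triple X X' t" "span_triple Y Y' t'" "fcod (snd Y) = fcod (fst X)"
  shows "span_hcomp (span_cell X X' t) (span_cell Y Y' t') =
    span_cell (span_comp X Y) (span_comp X' Y') (triple_hcomp X X' Y Y' t t')"
proof -
  have "triple_class (span_comp X Y) (span_comp X' Y') (triple_hcomp X X' Y Y' u u') =
      triple_class (span_comp X Y) (span_comp X' Y') (triple_hcomp X X' Y Y' t t')"
    if "u \<in> triple_class X X' t" "u' \<in> triple_class Y Y' t'" for u u'
    using that assms by (meson triple_class_iso span_triple_iso_hcomp triple_class_eq)
  then have "(\<Union>u\<in>triple_class X X' t. \<Union>u'\<in>triple_class Y Y' t'.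
        triple_class (span_comp X Y) (span_comp X' Y') (triple_hcomp X X' Y Y' u u')) =
      (\<Union>u\<in>triple_class X X' t. \<Union>u'\<in>triple_class Y Y' t'.
        triple_class (span_comp X Y) (span_comp X' Y') (triple_hcomp X X' Y Y' t t'))"
    by (intro SUP_cong refl)
  also have "\<dots> = triple_class (span_comp X Y) (span_comp X' Y') (triple_hcomp X X' Y Y' t t')"
    using triple_class_self[OF assms(1)] triple_class_self[OF assms(2)] by blast
  finally show ?thesis
    by (simp add: span_hcomp_def span_cell_def Let_def)
qed

section \<open>Identity 2-cells, associators and unitors of spans\<close>

definition vid_triple :: "'a span \<Rightarrow> 'a triple" where
  "vid_triple X = (fid (apex X), \<lambda>s. idt (fcod (fst X)) (fo (fst X) s),
      \<lambda>s. idt (fcod (snd X)) (fo (snd X) s))"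

lemma span_vid_cell: "span_vid X = span_cell X X (vid_triple X)"
  by (simp add: span_vid_def vid_triple_def)

lemma span_triple_vid [simp]: "X \<in> spans \<Longrightarrow> span_triple X X (vid_triple X)"
  unfolding vid_triple_def by (rule span_tripleI) auto

definition assoc_functor :: "'a span \<Rightarrow> 'a span \<Rightarrow> 'a span \<Rightarrow> 'a elt func" where
  "assoc_functor Z X Y =
    (let l = (\<lambda>x. tri (tri1 x) (tri1 (tri2 x)) (tri3 x));
         F = (\<lambda>x. tri (l x) (tri2 (tri2 x)) (tri3 (tri2 x)))
     in \<lparr>fdom = apex (span_comp (span_comp Z X) Y), fcod = apex (span_comp Z (span_comp X Y)), fo = F,
         fa = (\<lambda>m. let x = tfst (tfst m); x' = tsnd (tfst m); \<rho> = tri2 m; n = tri3 m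
                  in Tup (Tup (F x) (F x')) (Tup (Tup (Tup (l x) (l x')) (Tup \<rho> (tri2 n))) (tri3 n)))\<rparr>)"

text \<open>Rebracketing in the opposite direction, inverse to \<open>assoc_functor\<close> on the
  carriers.\<close>

definition assoc_inv :: "'a span \<Rightarrow> 'a span \<Rightarrow> 'a span \<Rightarrow> 'a elt func" where
  "assoc_inv Z X Y =
    (let r = (\<lambda>x. tri (tri2 (tri1 x)) (tri2 x) (tri3 x));
         F = (\<lambda>x. tri (tri1 (tri1 x)) (r x) (tri3 (tri1 x)))
     in \<lparr>fdom = apex (span_comp Z (span_comp X Y)), fcod = apex (span_comp (span_comp Z X) Y), fo = F,
         fa = (\<lambda>m. let x = tfst (tfst m); x' = tsnd (tfst m); n = tri2 m; \<psi> = tri3 m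
                  in Tup (Tup (F x) (F x')) (Tup (tri2 n) (Tup (Tup (r x) (r x')) (Tup (tri3 n) \<psi>))))\<rparr>)"

definition strict_triple :: "'a span \<Rightarrow> 'a elt func \<Rightarrow> 'a triple" where
  "strict_triple P F = (F, \<lambda>x. idt (fcod (fst P)) (fo (fst P) x),
      \<lambda>x. idt (fcod (snd P)) (fo (snd P) x))"

lemma strict_triple_simps [simp]: "fst (strict_triple P F) = F"
  "fst (snd (strict_triple P F)) x = idt (fcod (fst P)) (fo (fst P) x)"
  "snd (snd (strict_triple P F)) x = idt (fcod (snd P)) (fo (snd P) x)"
  by (simp_all add: strict_triple_def)

lemma vid_triple_strict: "vid_triple X = strict_triple X (fid (apex X))"
  by (simp add: vid_triple_def strict_triple_def)

lemma span_assoc_cell: "span_assoc Z X Y = span_cell (span_comp (span_comp Z X) Y)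
    (span_comp Z (span_comp X Y))
    (strict_triple (span_comp (span_comp Z X) Y) (assoc_functor Z X Y))"
  by (simp add: span_assoc_def assoc_functor_def strict_triple_def Let_def)

lemma assoc_functor_simps [simp]:
  "fdom (assoc_functor Z X Y) = apex (span_comp (span_comp Z X) Y)"
  "fcod (assoc_functor Z X Y) = apex (span_comp Z (span_comp X Y))"
  "fo (assoc_functor Z X Y) (Tup r (Tup (Tup t (Tup s \<gamma>)) \<delta>)) = Tup (Tup r (Tup t \<delta>)) (Tup s \<gamma>)"
  "fa (assoc_functor Z X Y) (Tup (Tup (Tup r (Tup (Tup t (Tup s \<gamma>)) \<delta>))
      (Tup r' (Tup (Tup t' (Tup s' \<gamma>')) \<delta>')))
      (Tup \<rho> (Tup (Tup p p') (Tup \<phi> \<psi>)))) =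
    Tup (Tup (Tup (Tup r (Tup t \<delta>)) (Tup s \<gamma>)) (Tup (Tup r' (Tup t' \<delta>')) (Tup s' \<gamma>')))
      (Tup (Tup (Tup (Tup r (Tup t \<delta>)) (Tup r' (Tup t' \<delta>'))) (Tup \<rho> \<phi>)) \<psi>)"
  by (simp_all add: assoc_functor_def Let_def)

lemma assoc_inv_simps [simp]:
  "fdom (assoc_inv Z X Y) = apex (span_comp Z (span_comp X Y))"
  "fcod (assoc_inv Z X Y) = apex (span_comp (span_comp Z X) Y)"
  "fo (assoc_inv Z X Y) (Tup (Tup r (Tup t \<delta>)) (Tup s \<gamma>)) = Tup r (Tup (Tup t (Tup s \<gamma>)) \<delta>)"
  "fa (assoc_inv Z X Y) (Tup (Tup (Tup (Tup r (Tup t \<delta>)) (Tup s \<gamma>)) (Tup (Tup r' (Tup t' \<delta>'))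
      (Tup s' \<gamma>')))
      (Tup (Tup (Tup p p') (Tup \<rho> \<phi>)) \<psi>)) =
    Tup (Tup (Tup r (Tup (Tup t (Tup s \<gamma>)) \<delta>)) (Tup r' (Tup (Tup t' (Tup s' \<gamma>')) \<delta>')))
      (Tup \<rho> (Tup (Tup (Tup t (Tup s \<gamma>)) (Tup t' (Tup s' \<gamma>'))) (Tup \<phi> \<psi>)))"
  by (simp_all add: assoc_inv_def Let_def)

lemma assoc_functors:
  assumes "Z \<in> spans" "X \<in> spans" "Y \<in> spans" "fcod (snd X) = fcod (fst Z)" "fcod (snd Y) =
      fcod (fst X)"
  shows "cat_functor (assoc_functor Z X Y)" "cat_functor (assoc_inv Z X Y)"
  by (rule cat_functorI; use assms in \<open>auto elim!: isocomma_arE isocomma_obE\<close>)+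

lemma span_triple_assoc:
  assumes "Z \<in> spans" "X \<in> spans" "Y \<in> spans" "fcod (snd X) = fcod (fst Z)" "fcod (snd Y) =
      fcod (fst X)"
  shows "span_triple (span_comp (span_comp Z X) Y) (span_comp Z (span_comp X Y))
      (strict_triple (span_comp (span_comp Z X) Y) (assoc_functor Z X Y))" (is ?A)
    and "span_triple (span_comp Z (span_comp X Y)) (span_comp (span_comp Z X) Y)
      (strict_triple (span_comp Z (span_comp X Y)) (assoc_inv Z X Y))" (is ?B)
  unfolding strict_triple_def
  by (rule span_tripleI; use assms assoc_functors[OF assms] in \<open>auto elim!: isocomma_arE isocomma_obE\<close>)+

definition lunit_triple :: "'a span \<Rightarrow> 'a triple" where
  "lunit_triple X = (proj1 (snd X) (fid (fcod (snd X))),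
      \<lambda>x. idt (fcod (fst X)) (fo (fst X) (tri1 x)), \<lambda>x. tri3 x)"

text \<open>A section of the projection to the apex, inverse to it up to isomorphism.\<close>

definition lunit_inv :: "'a span \<Rightarrow> 'a elt func" where
  "lunit_inv X = (let a = snd X; F = (\<lambda>s. tri s (fo a s) (idt (fcod a) (fo a s)))
     in \<lparr>fdom = fdom a, fcod = isocomma a (fid (fcod a)), fo = F,
         fa = (\<lambda>m. Tup (Tup (F (src (fdom a) m)) (F (tgt (fdom a) m))) (Tup m (fa a m)))\<rparr>)"

definition runit_triple :: "'a span \<Rightarrow> 'a triple" where
  "runit_triple X = (proj2 (fid (fcod (fst X))) (fst X), \<lambda>x. tri3 x,
      \<lambda>x. idt (fcod (snd X)) (fo (snd X) (tri2 x)))"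

definition runit_inv :: "'a span \<Rightarrow> 'a elt func" where
  "runit_inv X = (let b = fst X; F = (\<lambda>s. tri (fo b s) s (idt (fcod b) (fo b s)))
     in \<lparr>fdom = fdom b, fcod = isocomma (fid (fcod b)) b, fo = F,
         fa = (\<lambda>m. Tup (Tup (F (src (fdom b) m)) (F (tgt (fdom b) m))) (Tup (fa b m) m))\<rparr>)"

lemma span_lunit_cell: "span_lunit X = span_cell (span_comp (span_id (fcod (snd X))) X) X
    (lunit_triple X)"
  by (cases X) (simp add: lunit_triple_def)

lemma span_runit_cell: "span_runit X = span_cell (span_comp X (span_id (fcod (fst X)))) X
    (runit_triple X)"
  by (cases X) (simp add: runit_triple_def)

lemma unit_inv_simps [simp]:
  "fdom (lunit_inv X) = fdom (snd X)" "fcod (lunit_inv X) = isocomma (snd X) (fid (fcod (snd X)))"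
  "fo (lunit_inv X) s = Tup s (Tup (fo (snd X) s) (idt (fcod (snd X)) (fo (snd X) s)))"
  "fa (lunit_inv X) m = Tup (Tup (fo (lunit_inv X) (src (fdom (snd X)) m)) (fo (lunit_inv X)
      (tgt (fdom (snd X)) m)))
    (Tup m (fa (snd X) m))"
  "fdom (runit_inv X) = fdom (fst X)" "fcod (runit_inv X) = isocomma (fid (fcod (fst X))) (fst X)"
  "fo (runit_inv X) s = Tup (fo (fst X) s) (Tup s (idt (fcod (fst X)) (fo (fst X) s)))"
  "fa (runit_inv X) m = Tup (Tup (fo (runit_inv X) (src (fdom (fst X)) m)) (fo (runit_inv X)
      (tgt (fdom (fst X)) m)))
    (Tup (fa (fst X) m) m)"
  by (simp_all add: lunit_inv_def runit_inv_def Let_def)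

lemma unit_triple_simps [simp]: "fst (lunit_triple X) = proj1 (snd X) (fid (fcod (snd X)))"
  "fst (snd (lunit_triple X)) x = idt (fcod (fst X)) (fo (fst X) (tri1 x))"
      "snd (snd (lunit_triple X)) x = tri3 x"
  "fst (runit_triple X) = proj2 (fid (fcod (fst X))) (fst X)" "fst (snd (runit_triple X)) x = tri3 x"
  "snd (snd (runit_triple X)) x = idt (fcod (snd X)) (fo (snd X) (tri2 x))"
  by (simp_all add: lunit_triple_def runit_triple_def)

lemma span_triple_lunit:
  assumes "X \<in> spans" "fcod (snd X) = G"
  shows "span_triple (span_comp (span_id G) X) X (lunit_triple X)"
    and "span_triple X (span_comp (span_id G) X) (strict_triple X (lunit_inv X))"
proof -
  show "span_triple (span_comp (span_id G) X) X (lunit_triple X)"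
    unfolding lunit_triple_def by (rule span_tripleI) (use assms in \<open>auto elim!: isocomma_arE
        isocomma_obE\<close>)
  have "cat_functor (lunit_inv X)"
    by (rule cat_functorI) (use assms in auto)
  then show "span_triple X (span_comp (span_id G) X) (strict_triple X (lunit_inv X))"
    unfolding strict_triple_def by (intro span_tripleI) (use assms in auto)
qed

lemma span_triple_runit:
  assumes "X \<in> spans" "fcod (fst X) = H"
  shows "span_triple (span_comp X (span_id H)) X (runit_triple X)"
    and "span_triple X (span_comp X (span_id H)) (strict_triple X (runit_inv X))"
proof -
  show "span_triple (span_comp X (span_id H)) X (runit_triple X)"
    unfolding runit_triple_def by (rule span_tripleI) (use assms in \<open>auto elim!: isocomma_arE
        isocomma_obE\<close>)
  have "cat_functor (runit_inv X)"
    by (rule cat_functorI) (use assms in auto)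
  then show "span_triple X (span_comp X (span_id H)) (strict_triple X (runit_inv X))"
    unfolding strict_triple_def by (intro span_tripleI) (use assms in auto)
qed

section \<open>The bicategory structure on spans\<close>

lemma Span_simps [simp]: "obj Span = {G. finite_groupoid G}" "cell1 Span = spans"
  "src1 Span = (\<lambda>X. fcod (fst X))" "trg1 Span = (\<lambda>X. fcod (snd X))" "cell2 Span = span_cells"
  "src2 Span = csrc" "trg2 Span = ctrg" "vid Span = span_vid" "vcomp Span = span_vcomp" "id1 Span =
      span_id"
  "hcomp1 Span = span_comp" "hcomp2 Span = span_hcomp" "assoc Span = span_assoc" "lunit Span =
      span_lunit"
  "runit Span = span_runit"
  by (simp_all add: Span_def)

lemma one_Span [simp]: "X \<in> one Span H G \<longleftrightarrow> X \<in> spans \<and> fcod (fst X) = H \<and> fcod (snd X) = G"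
  by (simp add: one_def)

lemma span_triple_in_cells [simp]: "span_triple X X' t \<Longrightarrow> span_cell X X' t \<in> span_cells"
  using span_cellsI[of X X' "fst t" "fst (snd t)" "snd (snd t)"] by (simp add: span_triple_def)

lemma span_triple_ends:
  assumes "span_triple X X' t"
  shows "X \<in> spans" "X' \<in> spans" "fcod (fst X') = fcod (fst X)" "fcod (snd X') = fcod (snd X)"
proof -
  interpret triple X X' "fst t" "fst (snd t)" "snd (snd t)"
    using assms by (simp add: span_triple_def)
  show "X \<in> spans" "X' \<in> spans" "fcod (fst X') = fcod (fst X)" "fcod (snd X') = fcod (snd X)"
    by simp_all
qed

lemma two_Span: "A \<in> two Span X X' \<longleftrightarrow> (\<exists>t. A = span_cell X X' t \<and> span_triple X X' t)"
proof
  assume A: "A \<in> two Span X X'"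
  then have "A \<in> span_cells"
    by (simp add: two_def)
  then obtain Y Y' f \<beta> \<alpha> where Y: "A = span_cell Y Y' (f, \<beta>, \<alpha>)" "span_triple Y Y' (f, \<beta>, \<alpha>)"
    by (rule span_cellsE) (simp add: span_triple_def)
  with A show "\<exists>t. A = span_cell X X' t \<and> span_triple X X' t"
    by (auto simp: two_def simp del: split_paired_Ex)
qed (auto simp: two_def)

lemma two_SpanI [simp]: "span_triple X X' t \<Longrightarrow> span_cell X X' t \<in> two Span X X'"
  unfolding two_Span by blast

lemma invertible2_Span:
  assumes "span_triple X X' t" "span_triple X' X u"
    and "span_cell X X (triple_vcomp X u t) = span_cell X X (vid_triple X)"
    and "span_cell X' X' (triple_vcomp X' t u) = span_cell X' X' (vid_triple X')"
  shows "invertible2 Span (span_cell X X' t)"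
  unfolding invertible2_def using assms by (auto simp: span_vid_cell intro!: bexI[of _ "span_cell X'
      X u"])

lemma invertible_span_assoc:
  assumes "Z \<in> spans" "X \<in> spans" "Y \<in> spans" "fcod (snd X) = fcod (fst Z)" "fcod (snd Y) =
      fcod (fst X)"
  shows "invertible2 Span (span_assoc Z X Y)"
proof -
  note T = span_triple_assoc[OF assms]
  have "span_comp (span_comp Z X) Y \<in> spans" "span_comp Z (span_comp X Y) \<in> spans"
    using assms by auto
  note V = this[THEN span_triple_vid]
  show ?thesis
    unfolding span_assoc_cell
    by (intro invertible2_Span[OF T] span_cell_cong span_triple_vcomp[OF T] span_triple_vcomp[OF
        T(2,1)] V)
      (use assms in \<open>auto simp: triple_vcomp_eq vid_triple_strict elim!: isocomma_arE isocomma_obE\<close>)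
qed

text \<open>One composite is the identity strictly, the other only up to a natural isomorphism: the
  third entry \<open>\<gamma>\<close> of an object is itself the arrow that connects
  \<open>(s, a s, 1)\<close> to \<open>(s, g, \<gamma>)\<close>.\<close>

lemma invertible_span_lunit:
  assumes "X \<in> spans"
  shows "invertible2 Span (span_lunit X)"
proof -
  let ?G = "fcod (snd X)"
  let ?Y = "span_comp (span_id ?G) X"
  note T = span_triple_lunit[OF assms refl]
  have "?Y \<in> spans"
    using assms by auto
  note V = assms[THEN span_triple_vid] this[THEN span_triple_vid]
  have 1: "span_cell X X (triple_vcomp X (lunit_triple X) (strict_triple X (lunit_inv X))) =
      span_cell X X (vid_triple X)"
    by (rule span_cell_cong[OF span_triple_vcomp[OF T(2,1)] V(1)])
      (use assms in \<open>auto simp: triple_vcomp_eq vid_triple_strict\<close>)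
  have "span_triple_iso ?Y ?Y (triple_vcomp ?Y (strict_triple X (lunit_inv X)) (lunit_triple X))
      (vid_triple ?Y)
      (\<lambda>x. Tup (Tup (fo (lunit_inv X) (tri1 x)) x) (Tup (idt (apex X) (tri1 x)) (tri3 x)))"
    by (rule span_triple_isoI[OF span_triple_vcomp[OF T] V(2)])
      (use assms in \<open>auto simp: triple_vcomp_eq vid_triple_strict elim!: isocomma_arE isocomma_obE\<close>)
  then show ?thesis
    unfolding span_lunit_cell using invertible2_Span[OF T _ 1] span_cell_iso by blast
qed

lemma invertible_span_runit:
  assumes "X \<in> spans"
  shows "invertible2 Span (span_runit X)"
proof -
  let ?H = "fcod (fst X)"
  let ?Y = "span_comp X (span_id ?H)"
  note T = span_triple_runit[OF assms refl]
  have "?Y \<in> spans"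
    using assms by auto
  note V = assms[THEN span_triple_vid] this[THEN span_triple_vid]
  have 1: "span_cell X X (triple_vcomp X (runit_triple X) (strict_triple X (runit_inv X))) =
      span_cell X X (vid_triple X)"
    by (rule span_cell_cong[OF span_triple_vcomp[OF T(2,1)] V(1)])
      (use assms in \<open>auto simp: triple_vcomp_eq vid_triple_strict\<close>)
  \<comment> \<open>Here \<open>\<gamma>\<close> goes from \<open>h\<close> to \<open>b s\<close>,
    so the isomorphism starts at the given object and ends at its image, and the two triples
    exchange their roles.\<close>
  have "span_triple_iso ?Y ?Y (vid_triple ?Y) (triple_vcomp ?Y (strict_triple X (runit_inv X))
      (runit_triple X))
      (\<lambda>x. Tup (Tup x (fo (runit_inv X) (tri2 x))) (Tup (tri3 x) (idt (apex X) (tri2 x))))"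
    by (rule span_triple_isoI[OF V(2) span_triple_vcomp[OF T]])
      (use assms in \<open>auto simp: triple_vcomp_eq vid_triple_strict elim!: isocomma_arE isocomma_obE\<close>)
  from span_cell_iso[OF this] show ?thesis
    unfolding span_runit_cell by (intro invertible2_Span[OF T _ 1]) simp
qed

section \<open>Axioms of the bicategory of spans, on representatives\<close>

lemma span_triple_triple: "span_triple X X' t \<Longrightarrow> triple X X' (fst t) (fst (snd t)) (snd (snd t))"
  by (simp add: span_triple_def)

lemma two_SpanE:
  assumes "A \<in> two Span X X'"
  obtains t where "A = span_cell X X' t" "span_triple X X' t"
  using assms unfolding two_Span by blast

lemma span_vcomp_two: "A \<in> two Span X X' \<Longrightarrow> B \<in> two Span X' X'' \<Longrightarrow> span_vcomp B A \<in> two Span X X''"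
  by (elim two_SpanE) (auto intro!: two_SpanI span_triple_vcomp)

lemma span_vcomp_assoc:
  assumes "A \<in> two Span X X'" "B \<in> two Span X' X''" "C \<in> two Span X'' Y"
  shows "span_vcomp C (span_vcomp B A) = span_vcomp (span_vcomp C B) A"
proof -
  obtain t where t: "A = span_cell X X' t" "span_triple X X' t"
    using assms(1) by (rule two_SpanE)
  obtain u where u: "B = span_cell X' X'' u" "span_triple X' X'' u"
    using assms(2) by (rule two_SpanE)
  obtain v where v: "C = span_cell X'' Y v" "span_triple X'' Y v"
    using assms(3) by (rule two_SpanE)
  interpret t: triple X X' "fst t" "fst (snd t)" "snd (snd t)"
    by (rule span_triple_triple[OF t(2)])
  interpret u: triple X' X'' "fst u" "fst (snd u)" "snd (snd u)"
    by (rule span_triple_triple[OF u(2)])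
  interpret v: triple X'' Y "fst v" "fst (snd v)" "snd (snd v)"
    by (rule span_triple_triple[OF v(2)])
  note T = span_triple_vcomp[OF t(2) u(2)] span_triple_vcomp[OF u(2) v(2)]
  show ?thesis
    unfolding t(1) u(1) v(1) span_vcomp_cell[OF t(2) u(2)] span_vcomp_cell[OF u(2) v(2)]
      span_vcomp_cell[OF T(1) v(2)] span_vcomp_cell[OF t(2) T(2)]
    by (rule span_cell_cong[OF span_triple_vcomp[OF T(1) v(2)] span_triple_vcomp[OF t(2) T(2)]])
      (auto simp: triple_vcomp_eq)
qed

lemma span_vcomp_vid:
  assumes "A \<in> two Span X X'"
  shows "span_vcomp A (span_vid X) = A" "span_vcomp (span_vid X') A = A"
proof -
  obtain t where t: "A = span_cell X X' t" "span_triple X X' t"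
    using assms(1) by (rule two_SpanE)
  interpret t: triple X X' "fst t" "fst (snd t)" "snd (snd t)"
    by (rule span_triple_triple[OF t(2)])
  have V: "span_triple X X (vid_triple X)" "span_triple X' X' (vid_triple X')"
    by simp_all
  show "span_vcomp A (span_vid X) = A"
    unfolding t(1) span_vid_cell span_vcomp_cell[OF V(1) t(2)]
    by (rule span_cell_cong[OF span_triple_vcomp[OF V(1) t(2)] t(2)]) (auto simp: triple_vcomp_eq
        vid_triple_strict)
  show "span_vcomp (span_vid X') A = A"
    unfolding t(1) span_vid_cell span_vcomp_cell[OF t(2) V(2)]
    by (rule span_cell_cong[OF span_triple_vcomp[OF t(2) V(2)] t(2)]) (auto simp: triple_vcomp_eq
        vid_triple_strict)
qed

lemma span_hcomp_two:
  assumes "A \<in> two Span Y Y'" "B \<in> two Span X X'" "fcod (snd Y) = fcod (fst X)"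
  shows "span_hcomp B A \<in> two Span (span_comp X Y) (span_comp X' Y')"
  using assms by (elim two_SpanE) (auto intro!: two_SpanI span_triple_hcomp)

lemma span_hcomp_vid:
  assumes "X \<in> spans" "Y \<in> spans" "fcod (snd Y) = fcod (fst X)"
  shows "span_hcomp (span_vid X) (span_vid Y) = span_vid (span_comp X Y)"
proof -
  note V = span_triple_vid[OF assms(1)] span_triple_vid[OF assms(2)] span_triple_vid[OF
      span_comp_span[OF assms]]
  show ?thesis
    unfolding span_vid_cell span_hcomp_cell[OF V(1,2) assms(3)]
    by (rule span_cell_cong[OF span_triple_hcomp[OF V(1,2) assms(3)] V(3)])
      (use assms in \<open>auto simp: triple_hcomp_eq vid_triple_strict elim!: isocomma_arE isocomma_obE\<close>)
qed

text \<open>On representatives both sides send an object \<open>(t, s, \<gamma>)\<close> to the same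
  triple: the components of \<open>B\<close> and \<open>B'\<close> are pasted onto the left of
  \<open>\<gamma>\<close>, those of \<open>A\<close> and \<open>A'\<close> onto the right.\<close>

lemma span_interchange:
  assumes "A \<in> two Span Y Y'" "A' \<in> two Span Y' Y''" "B \<in> two Span X X'" "B' \<in> two Span X' X''"
    and c: "fcod (snd Y) = fcod (fst X)"
  shows "span_hcomp (span_vcomp B' B) (span_vcomp A' A) =
      span_vcomp (span_hcomp B' A') (span_hcomp B A)"
proof -
  obtain t where t: "A = span_cell Y Y' t" "span_triple Y Y' t"
    using assms(1) by (rule two_SpanE)
  obtain t' where t': "A' = span_cell Y' Y'' t'" "span_triple Y' Y'' t'"
    using assms(2) by (rule two_SpanE)
  obtain u where u: "B = span_cell X X' u" "span_triple X X' u"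
    using assms(3) by (rule two_SpanE)
  obtain u' where u': "B' = span_cell X' X'' u'" "span_triple X' X'' u'"
    using assms(4) by (rule two_SpanE)
  interpret t: triple Y Y' "fst t" "fst (snd t)" "snd (snd t)"
    by (rule span_triple_triple[OF t(2)])
  interpret t': triple Y' Y'' "fst t'" "fst (snd t')" "snd (snd t')"
    by (rule span_triple_triple[OF t'(2)])
  interpret u: triple X X' "fst u" "fst (snd u)" "snd (snd u)"
    by (rule span_triple_triple[OF u(2)])
  interpret u': triple X' X'' "fst u'" "fst (snd u')" "snd (snd u')"
    by (rule span_triple_triple[OF u'(2)])
  have c': "fcod (snd Y') = fcod (fst X')"
    using c by simp
  note V = span_triple_vcomp[OF u(2) u'(2)] span_triple_vcomp[OF t(2) t'(2)]
  note H = span_triple_hcomp[OF u(2) t(2) c] span_triple_hcomp[OF u'(2) t'(2) c']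
  show ?thesis
    unfolding t(1) t'(1) u(1) u'(1) span_vcomp_cell[OF u(2) u'(2)] span_vcomp_cell[OF t(2) t'(2)]
      span_hcomp_cell[OF u(2) t(2) c] span_hcomp_cell[OF u'(2) t'(2) c'] span_hcomp_cell[OF V c]
      span_vcomp_cell[OF H]
    by (rule span_cell_cong[OF span_triple_hcomp[OF V c] span_triple_vcomp[OF H]])
      (use c in \<open>auto simp: triple_hcomp_eq triple_vcomp_eq elim!: isocomma_arE isocomma_obE\<close>)
qed

text \<open>Rebracketing leaves the connecting arrows alone, so the components may be pasted onto
  them before or after it.\<close>

lemma span_assoc_natural:
  assumes "A \<in> two Span Y Y'" "B \<in> two Span X X'" "C \<in> two Span Z Z'"
    and c: "fcod (snd Y) = fcod (fst X)" "fcod (snd X) = fcod (fst Z)"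
  shows "span_vcomp (span_assoc Z' X' Y') (span_hcomp (span_hcomp C B) A) =
    span_vcomp (span_hcomp C (span_hcomp B A)) (span_assoc Z X Y)"
proof -
  obtain t where t: "A = span_cell Y Y' t" "span_triple Y Y' t"
    using assms(1) by (rule two_SpanE)
  obtain u where u: "B = span_cell X X' u" "span_triple X X' u"
    using assms(2) by (rule two_SpanE)
  obtain v where v: "C = span_cell Z Z' v" "span_triple Z Z' v"
    using assms(3) by (rule two_SpanE)
  interpret t: triple Y Y' "fst t" "fst (snd t)" "snd (snd t)"
    by (rule span_triple_triple[OF t(2)])
  interpret u: triple X X' "fst u" "fst (snd u)" "snd (snd u)"
    by (rule span_triple_triple[OF u(2)])
  interpret v: triple Z Z' "fst v" "fst (snd v)" "snd (snd v)"
    by (rule span_triple_triple[OF v(2)])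
  have c': "fcod (snd Y) = fcod (fst (span_comp Z X))" "fcod (snd (span_comp X Y)) = fcod (fst Z)"
    using c by simp_all
  note a = span_triple_assoc(1)[OF v.span_src u.span_src t.span_src c(2,1)]
  have a': "span_triple (span_comp (span_comp Z' X') Y') (span_comp Z' (span_comp X' Y'))
      (strict_triple (span_comp (span_comp Z' X') Y') (assoc_functor Z' X' Y'))"
    by (rule span_triple_assoc) (use c in simp_all)
  note H = span_triple_hcomp[OF v(2) u(2) c(2)] span_triple_hcomp[OF u(2) t(2) c(1)]
  note HH = span_triple_hcomp[OF H(1) t(2) c'(1)] span_triple_hcomp[OF v(2) H(2) c'(2)]
  show ?thesis
    unfolding t(1) u(1) v(1) span_assoc_cell span_hcomp_cell[OF v(2) u(2) c(2)] span_hcomp_cell[OF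
        u(2) t(2) c(1)]
      span_hcomp_cell[OF H(1) t(2) c'(1)] span_hcomp_cell[OF v(2) H(2) c'(2)]
      span_vcomp_cell[OF HH(1) a'] span_vcomp_cell[OF a HH(2)]
    by (rule span_cell_cong[OF span_triple_vcomp[OF HH(1) a'] span_triple_vcomp[OF a HH(2)]])
      (use c in \<open>auto simp: triple_hcomp_eq triple_vcomp_eq elim!: isocomma_arE isocomma_obE\<close>)
qed

lemma span_lunit_natural:
  assumes "A \<in> two Span X X'" "fcod (snd X) = G"
  shows "span_vcomp (span_lunit X') (span_hcomp (span_vid (span_id G)) A) = span_vcomp A (span_lunit X)"
proof -
  obtain t where t: "A = span_cell X X' t" "span_triple X X' t"
    using assms(1) by (rule two_SpanE)
  interpret t: triple X X' "fst t" "fst (snd t)" "snd (snd t)"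
    by (rule span_triple_triple[OF t(2)])
  have G: "fcod (snd X) = fcod (fst (span_id G))" "fcod (snd X') = G"
    using assms by auto
  have V: "span_triple (span_id G) (span_id G) (vid_triple (span_id G))"
    using assms by auto
  note H = span_triple_hcomp[OF V t(2) G(1)]
  note L = span_triple_lunit(1)[OF t.span_src assms(2)] span_triple_lunit(1)[OF t.span_trg G(2)]
  show ?thesis
    unfolding t(1) span_vid_cell span_lunit_cell assms(2) G(2) span_hcomp_cell[OF V t(2) G(1)]
      span_vcomp_cell[OF H L(2)] span_vcomp_cell[OF L(1) t(2)]
    by (rule span_cell_cong[OF span_triple_vcomp[OF H L(2)] span_triple_vcomp[OF L(1) t(2)]])
      (use assms(2) in \<open>auto simp: triple_hcomp_eq triple_vcomp_eq vid_triple_strict elim!: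
          isocomma_arE isocomma_obE\<close>)
qed

lemma span_runit_natural:
  assumes "A \<in> two Span X X'" "fcod (fst X) = H"
  shows "span_vcomp (span_runit X') (span_hcomp A (span_vid (span_id H))) = span_vcomp A (span_runit X)"
proof -
  obtain t where t: "A = span_cell X X' t" "span_triple X X' t"
    using assms(1) by (rule two_SpanE)
  interpret t: triple X X' "fst t" "fst (snd t)" "snd (snd t)"
    by (rule span_triple_triple[OF t(2)])
  have H: "fcod (snd (span_id H)) = fcod (fst X)" "fcod (fst X') = H"
    using assms by auto
  have V: "span_triple (span_id H) (span_id H) (vid_triple (span_id H))"
    using assms by auto
  note T = span_triple_hcomp[OF t(2) V H(1)]
  note realization = span_triple_runit(1)[OF t.span_src assms(2)] span_triple_runit(1)[OF t.span_trg
      H(2)]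
  show ?thesis
    unfolding t(1) span_vid_cell span_runit_cell assms(2) H(2) span_hcomp_cell[OF t(2) V H(1)]
      span_vcomp_cell[OF T realization(2)] span_vcomp_cell[OF realization(1) t(2)]
    by (rule span_cell_cong[OF span_triple_vcomp[OF T realization(2)] span_triple_vcomp[OF
        realization(1) t(2)]])
      (use assms(2) in \<open>auto simp: triple_hcomp_eq triple_vcomp_eq vid_triple_strict elim!:
          isocomma_arE isocomma_obE\<close>)
qed

text \<open>Both sides send \<open>(r, (h, s, \<gamma>), \<delta>)\<close> to
  \<open>(r, s, \<gamma> \<delta>)\<close>: the left unitor contributes \<open>\<delta>\<close>, the
  right unitor \<open>\<gamma>\<close>.\<close>

lemma span_triangle:
  assumes "Y \<in> spans" "X \<in> spans" "fcod (snd Y) = H" "fcod (fst X) = H"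
  shows "span_vcomp (span_hcomp (span_vid X) (span_lunit Y)) (span_assoc X (span_id H) Y) =
    span_hcomp (span_runit X) (span_vid Y)"
proof -
  have c: "fcod (snd (span_comp (span_id H) Y)) = fcod (fst X)"
      "fcod (snd Y) = fcod (fst (span_comp X (span_id H)))"
    using assms by simp_all
  note V = span_triple_vid[OF assms(2)] span_triple_vid[OF assms(1)]
  note L = span_triple_lunit(1)[OF assms(1,3)] and realization = span_triple_runit(1)[OF assms(2,4)]
  have a: "span_triple (span_comp (span_comp X (span_id H)) Y) (span_comp X (span_comp (span_id H) Y))
      (strict_triple (span_comp (span_comp X (span_id H)) Y) (assoc_functor X (span_id H) Y))"
    by (rule span_triple_assoc) (use assms in auto)
  note T = span_triple_hcomp[OF V(1) L c(1)] span_triple_hcomp[OF realization V(2) c(2)]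
  show ?thesis
    unfolding span_vid_cell span_lunit_cell span_runit_cell span_assoc_cell assms(3,4)
      span_hcomp_cell[OF V(1) L c(1)] span_hcomp_cell[OF realization V(2) c(2)] span_vcomp_cell[OF a
          T(1)]
    by (rule span_cell_cong[OF span_triple_vcomp[OF a T(1)] T(2)])
      (use assms in \<open>auto simp: triple_hcomp_eq triple_vcomp_eq vid_triple_strict elim!:
          isocomma_arE isocomma_obE\<close>)
qed

text \<open>All five functors only rebracket, and the isomorphisms on the legs are identities, so
  the two composites agree on objects and arrows.\<close>

lemma span_pentagon:
  assumes "W \<in> spans" "X \<in> spans" "Y \<in> spans" "Z \<in> spans"
    and c: "fcod (snd W) = fcod (fst X)" "fcod (snd X) = fcod (fst Y)" "fcod (snd Y) = fcod (fst Z)"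
  shows "span_vcomp (span_hcomp (span_vid Z) (span_assoc Y X W))
      (span_vcomp (span_assoc Z (span_comp Y X) W) (span_hcomp (span_assoc Z Y X) (span_vid W))) =
    span_vcomp (span_assoc Z Y (span_comp X W)) (span_assoc (span_comp Z Y) X W)"
proof -
  have d: "fcod (snd (span_comp (span_comp Y X) W)) = fcod (fst Z)"
      "fcod (snd W) = fcod (fst (span_comp (span_comp Z Y) X))"
      "fcod (snd W) = fcod (fst (span_comp Y X))" "fcod (snd (span_comp Y X)) = fcod (fst Z)"
      "fcod (snd (span_comp X W)) = fcod (fst Y)" "fcod (snd X) = fcod (fst (span_comp Z Y))"
    using c by simp_all
  have S: "span_comp Y X \<in> spans" "span_comp X W \<in> spans" "span_comp Z Y \<in> spans"
    using assms by simp_all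
  note a1 = span_triple_assoc(1)[OF assms(3,2,1) c(2,1)]
  note a2 = span_triple_assoc(1)[OF assms(4) S(1) assms(1) d(4,3)]
  note a3 = span_triple_assoc(1)[OF assms(4,3,2) c(3,2)]
  note a4 = span_triple_assoc(1)[OF assms(4,3) S(2) c(3) d(5)]
  note a5 = span_triple_assoc(1)[OF S(3) assms(2,1) d(6) c(1)]
  note V = span_triple_vid[OF assms(4)] span_triple_vid[OF assms(1)]
  have d': "fcod (snd (span_comp (span_comp Y X) W)) = fcod (fst Z)"
    using c by simp
  note T = span_triple_hcomp[OF V(1) a1 d'] span_triple_hcomp[OF a3 V(2) d(2)]
  show ?thesis
    unfolding span_vid_cell span_assoc_cell span_hcomp_cell[OF V(1) a1 d'] span_hcomp_cell[OF a3
        V(2) d(2)]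
      span_vcomp_cell[OF T(2) a2] span_vcomp_cell[OF span_triple_vcomp[OF T(2) a2] T(1)]
          span_vcomp_cell[OF a5 a4]
    by (rule span_cell_cong[OF span_triple_vcomp[OF span_triple_vcomp[OF T(2) a2] T(1)]
        span_triple_vcomp[OF a5 a4]])
      (use assms in \<open>auto simp: triple_hcomp_eq triple_vcomp_eq vid_triple_strict elim!:
          isocomma_arE isocomma_obE\<close>)
qed

lemma span_cells_two: "A \<in> span_cells \<Longrightarrow> A \<in> two Span (csrc A) (ctrg A)"
  by (simp add: two_def)

lemma two_Span_ends:
  assumes "A \<in> two Span X X'"
  shows "X \<in> spans" "X' \<in> spans" "fcod (fst X') = fcod (fst X)" "fcod (snd X') = fcod (snd X)"
  using assms span_triple_ends by (metis two_SpanE)+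

lemma bicategory_Span: "bicategory (Span :: ('a elt cat, 'a span, 'a span_cell) bicat)"
proof (rule bicategory.intro, goal_cases)
  case (3 A)
  then show ?case
    using two_Span_ends[OF span_cells_two[of A]] by simp
next
  case (4 A)
  then show ?case
    using two_Span_ends[OF span_cells_two[of A]] by simp
next
  case (5 X)
  then show ?case
    by (simp add: span_vid_cell)
next
  case (6 A X X' B X'')
  then show ?case
    using span_vcomp_two by simp
next
  case (7 A X X' B X'' C Y)
  then show ?case
    using span_vcomp_assoc by simp
next
  case (8 A X X')
  then show ?case
    using span_vcomp_vid(1) by simp
next
  case (9 A X X')
  then show ?case
    using span_vcomp_vid(2) by simp
next
  case (12 Y H G X K A Y' B X')
  then show ?case
    using span_hcomp_two[of A Y Y' B X X'] by simp
next
  case (13 Y H G X K)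
  then show ?case
    using span_hcomp_vid[of X Y] by simp
next
  case (14 Y H G X K A Y' A' Y'' B X' B' X'')
  then show ?case
    using span_interchange[of A Y Y' A' Y'' B X X' B' X''] by simp
next
  case (15 Y H G X K Z L)
  then show ?case
    using span_triple_assoc(1)[of Z X Y] by (simp add: span_assoc_cell)
next
  case (16 Y H G X K Z L)
  then show ?case
    using invertible_span_assoc[of Z X Y] by simp
next
  case (17 Y H G X K Z L A Y' B X' C Z')
  then show ?case
    using span_assoc_natural[of A Y Y' B X X' C Z Z'] by simp
next
  case (18 X H G)
  then show ?case
    using span_triple_lunit(1)[of X G] by (simp add: span_lunit_cell)
next
  case (19 X)
  then show ?case
    using invertible_span_lunit[of X] by simp
next
  case (20 X H G A X')
  then show ?case
    using span_lunit_natural[of A X X' G] by simp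
next
  case (21 X H G)
  then show ?case
    using span_triple_runit(1)[of X H] by (simp add: span_runit_cell)
next
  case (22 X)
  then show ?case
    using invertible_span_runit[of X] by simp
next
  case (23 X H G A X')
  then show ?case
    using span_runit_natural[of A X X' H] by simp
next
  case (24 Y H G X K)
  then show ?case
    using span_triangle[of Y X G] by simp
next
  case (25 W H G X K Y L Z M)
  then show ?case
    using span_pentagon[of W X Y Z] by simp
qed (auto simp: span_vid_cell)

section \<open>The pseudo-functor from spans to bisets\<close>

declare hom_iff [simp]

section \<open>Classes in the biset of a span\<close>

definition span_biset :: "'a span \<Rightarrow> 'a elt prof" where
  "span_biset X = tensor (hom_from (snd X)) (hom_to (fst X))"

text \<open>The class \<open>[s, (x, y)]\<close> for \<open>x : a s \<rightarrow> g\<close> and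
  \<open>y : h \<rightarrow> b s\<close>.\<close>

definition rin :: "'a span \<Rightarrow> 'a elt \<Rightarrow> 'a elt \<Rightarrow> 'a elt \<Rightarrow> 'a elt \<Rightarrow> 'a elt \<Rightarrow> 'a elt" where
  "rin X h g s x y = tensor_in (hom_from (snd X)) (hom_to (fst X)) h g s x y"

definition rlift :: "'a span \<Rightarrow> 'a elt \<Rightarrow> 'a elt \<Rightarrow> ('a elt \<Rightarrow> 'a elt \<Rightarrow> 'a elt \<Rightarrow> 'a elt) \<Rightarrow> 'a elt \<Rightarrow> 'a
    elt" where
  "rlift X h g \<phi> = coend_lift (integrand (hom_from (snd X)) (hom_to (fst X)) h g)
      (\<lambda>s z. \<phi> s (tfst z) (tsnd z))"

lemma span_biset_simps [simp]: "pdom (span_biset X) = fcod (fst X)" "pcod (span_biset X) = fcod (snd X)"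
  by (simp_all add: span_biset_def)

lemma span_biset_biset [simp]: "X \<in> spans \<Longrightarrow> biset (span_biset X)"
  by (simp add: span_biset_def)

lemma rin_in [simp]:
  assumes "X \<in> spans" "s \<in> ob (apex X)" "x \<in> ar (fcod (snd X))" "src (fcod (snd X)) x =
      fo (snd X) s" "tgt (fcod (snd X)) x = g"
    "y \<in> ar (fcod (fst X))" "src (fcod (fst X)) y = h" "tgt (fcod (fst X)) y = fo (fst X) s"
  shows "rin X h g s x y \<in> po (span_biset X) h g"
  using assms by (simp add: span_biset_def rin_def)

lemma span_bisetE:
  assumes "c \<in> po (span_biset X) h g"
  obtains s x y where "c = rin X h g s x y" "s \<in> ob (apex X)"
    "x \<in> ar (fcod (snd X))" "src (fcod (snd X)) x = fo (snd X) s" "tgt (fcod (snd X)) x = g"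
    "y \<in> ar (fcod (fst X))" "src (fcod (fst X)) y = h" "tgt (fcod (fst X)) y = fo (fst X) s"
  using assms unfolding span_biset_def rin_def by (auto elim!: tensorE)

text \<open>The generating relation seen through the legs: \<open>m\<close> leaves \<open>x\<close>
  as its image under one leg and reaches \<open>y\<close> as its image under the other.\<close>

lemma rin_glue:
  assumes "X \<in> spans" "m \<in> ar (apex X)" "h \<in> ob (fcod (fst X))" "g \<in> ob (fcod (snd X))"
    "x \<in> ar (fcod (snd X))" "src (fcod (snd X)) x = fo (snd X) (tgt (apex X) m)"
        "tgt (fcod (snd X)) x = g"
    "y \<in> ar (fcod (fst X))" "src (fcod (fst X)) y = h" "tgt (fcod (fst X)) y =
        fo (fst X) (src (apex X) m)"
  shows "rin X h g (src (apex X) m) (cmp (fcod (snd X)) x (fa (snd X) m)) y =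
    rin X h g (tgt (apex X) m) x (cmp (fcod (fst X)) (fa (fst X) m) y)"
  using tensor_in_glue[of "hom_from (snd X)" "hom_to (fst X)" "fcod (snd X)" h g m "src (apex X) m"
      x y] assms
  by (simp add: rin_def)

lemma rlift:
  assumes "X \<in> spans" "h \<in> ob (fcod (fst X))" "g \<in> ob (fcod (snd X))"
    and compat: "\<And>m x y. m \<in> ar (apex X) \<Longrightarrow>
      x \<in> ar (fcod (snd X)) \<Longrightarrow> src (fcod (snd X)) x = fo (snd X) (tgt (apex X) m) \<Longrightarrow>
          tgt (fcod (snd X)) x = g \<Longrightarrow>
      y \<in> ar (fcod (fst X)) \<Longrightarrow> src (fcod (fst X)) y = h \<Longrightarrow> tgt (fcod (fst X)) y =
          fo (fst X) (src (apex X) m) \<Longrightarrow>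
      \<phi> (src (apex X) m) (cmp (fcod (snd X)) x (fa (snd X) m)) y =
      \<phi> (tgt (apex X) m) x (cmp (fcod (fst X)) (fa (fst X) m) y)"
    and "s \<in> ob (apex X)" "x \<in> ar (fcod (snd X))" "src (fcod (snd X)) x = fo (snd X) s"
        "tgt (fcod (snd X)) x = g"
    "y \<in> ar (fcod (fst X))" "src (fcod (fst X)) y = h" "tgt (fcod (fst X)) y = fo (fst X) s"
  shows "rlift X h g \<phi> (rin X h g s x y) = \<phi> s x y"
  unfolding rlift_def rin_def
  by (subst tensor_in_lift) (use assms in auto)

lemma pa_span_biset [simp]:
  assumes "X \<in> spans" "v \<in> ar (fcod (fst X))" "u \<in> ar (fcod (snd X))"
    "h = tgt (fcod (fst X)) v" "g = src (fcod (snd X)) u"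
    "s \<in> ob (apex X)" "x \<in> ar (fcod (snd X))" "src (fcod (snd X)) x = fo (snd X) s"
        "tgt (fcod (snd X)) x = g"
    "y \<in> ar (fcod (fst X))" "src (fcod (fst X)) y = h" "tgt (fcod (fst X)) y = fo (fst X) s"
  shows "pa (span_biset X) v u (rin X h g s x y) =
    rin X (src (fcod (fst X)) v) (tgt (fcod (snd X)) u) s (cmp (fcod (snd X)) u x)
        (cmp (fcod (fst X)) y v)"
  using assms by (simp add: span_biset_def rin_def)

text \<open>The value does not depend on the chosen representative, see \<open>cmap_span_map\<close>.\<close>

definition span_map :: "'a span_cell \<Rightarrow> 'a elt biset_cell" where
  "span_map A = (let X = csrc A; X' = ctrg A; t = (SOME t. t \<in> cmap A)
     in biset_cell (span_biset X) (span_biset X') (\<lambda>h g. rlift X h g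
       (\<lambda>s x y. rin X' h g (fo (fst t) s) (cmp (fcod (snd X)) x (snd (snd t) s)) (cmp (fcod (fst X))
           (fst (snd t) s) y))))"

lemma span_map_simps [simp]: "csrc (span_map A) = span_biset (csrc A)" "ctrg (span_map A) =
    span_biset (ctrg A)"
  by (simp_all add: span_map_def Let_def)

lemma cmap_span_map:
  assumes t: "span_triple X X' t" and s: "s \<in> ob (apex X)"
    and x: "x \<in> ar (fcod (snd X))" "src (fcod (snd X)) x = fo (snd X) s" "tgt (fcod (snd X)) x = g"
    and y: "y \<in> ar (fcod (fst X))" "src (fcod (fst X)) y = h" "tgt (fcod (fst X)) y = fo (fst X) s"
  shows "cmap (span_map (span_cell X X' t)) h g (rin X h g s x y) =
    rin X' h g (fo (fst t) s) (cmp (fcod (snd X)) x (snd (snd t) s)) (cmp (fcod (fst X))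
        (fst (snd t) s) y)"
proof -
  \<comment> \<open>The representative that \<open>span_map\<close> picks; the value is computed
    with \<open>u\<close> and carried over to \<open>t\<close> at the end.\<close>
  define u where "u = (SOME u. u \<in> triple_class X X' t)"
  have "u \<in> triple_class X X' t"
    unfolding u_def using triple_class_self[OF t] by (rule someI)
  then obtain \<theta> where \<theta>: "span_triple_iso X X' t u \<theta>"
    using t by (rule triple_class_iso)
  interpret triple_iso X X' "fst t" "fst (snd t)" "snd (snd t)" "fst u" "fst (snd u)" "snd (snd u)" \<theta>
    using \<theta> by (simp add: span_triple_iso_def)
  have obs: "h \<in> ob (fcod (fst X))" "g \<in> ob (fcod (snd X))"
    using x y by auto
  let ?\<phi> = "\<lambda>s x y. rin X' h g (fo (fst u) s) (cmp (fcod (snd X)) x (snd (snd u) s))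
      (cmp (fcod (fst X)) (fst (snd u) s) y)"
  have compat: "?\<phi> (src (apex X) m) (cmp (fcod (snd X)) x (fa (snd X) m)) y =
      ?\<phi> (tgt (apex X) m) x (cmp (fcod (fst X)) (fa (fst X) m) y)"
    if "m \<in> ar (apex X)"
      "x \<in> ar (fcod (snd X))" "src (fcod (snd X)) x = fo (snd X) (tgt (apex X) m)"
          "tgt (fcod (snd X)) x = g"
      "y \<in> ar (fcod (fst X))" "src (fcod (fst X)) y = h" "tgt (fcod (fst X)) y =
          fo (fst X) (src (apex X) m)" for m x y
    \<comment> \<open>Glueing in the target along the image of \<open>m\<close>; naturality of the
      components of \<open>u\<close> matches the factors. Expanding the first of them through
      \<open>\<theta>\<close> would hide that naturality.\<close>
    using rin_glue[of X' "fa (fst u) m" h g "cmp (fcod (snd X)) x (snd (snd u) (tgt (apex X) m))"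
      "cmp (fcod (fst X)) (fst (snd u) (src (apex X) m)) y"] that obs by (simp del: beta_tilde)
  have "cmap (span_map (span_cell X X' t)) h g (rin X h g s x y) = rlift X h g ?\<phi> (rin X h g s x y)"
    unfolding span_map_def Let_def span_cell_simps u_def[symmetric]
    by (subst cell_simps(3)) (use assms obs in simp_all)
  also have "\<dots> = ?\<phi> s x y"
    by (rule rlift[OF span_src obs compat s x y])
  also have "\<dots> = rin X' h g (fo (fst t) s) (cmp (fcod (snd X)) x (snd (snd t) s))
      (cmp (fcod (fst X)) (fst (snd t) s) y)"
    \<comment> \<open>The values for \<open>u\<close> and for \<open>t\<close> are the two sides of
      the glueing along \<open>\<theta> s\<close>.\<close>
    using rin_glue[of X' "\<theta> s" h g "cmp (fcod (snd X)) x (snd (snd u) s)"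
        "cmp (fcod (fst X)) (fst (snd t) s) y"]
      s x y obs by simp
  finally show ?thesis .
qed

lemma span_map_cells:
  assumes "span_triple X X' t"
  shows "span_map (span_cell X X' t) \<in> biset_cells"
proof -
  interpret triple X X' "fst t" "fst (snd t)" "snd (snd t)"
    by (rule span_triple_triple[OF assms])
  show ?thesis
    by (rule biset_cellsI2[OF span_map_def[unfolded Let_def]])
      (use assms in \<open>auto elim!: span_bisetE simp: cmap_span_map\<close>)
qed

lemma span_map_vid:
  assumes "X \<in> spans"
  shows "span_map (span_vid X) = biset_vid (span_biset X)"
  unfolding span_vid_cell
  by (rule biset_cell_eqI) (use assms in \<open>auto elim!: span_bisetE simp: cmap_span_map span_map_cells
      vid_triple_strict
    span_triple_vid[unfolded vid_triple_strict]\<close>)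

lemma span_map_vcomp:
  assumes "span_triple X X' t" "span_triple X' X'' u"
  shows "span_map (span_vcomp (span_cell X' X'' u) (span_cell X X' t)) =
    biset_vcomp (span_map (span_cell X' X'' u)) (span_map (span_cell X X' t))"
proof -
  interpret t: triple X X' "fst t" "fst (snd t)" "snd (snd t)"
    by (rule span_triple_triple[OF assms(1)])
  interpret u: triple X' X'' "fst u" "fst (snd u)" "snd (snd u)"
    by (rule span_triple_triple[OF assms(2)])
  note T = span_triple_vcomp[OF assms]
  show ?thesis
    unfolding span_vcomp_cell[OF assms]
    by (rule biset_cell_eqI)
      (use assms T in \<open>auto elim!: span_bisetE simp: cmap_span_map span_map_cells triple_vcomp_eq[of
          X u t]\<close>)
qed

section \<open>The comparison of composites\<close>

definition span_biset_comp :: "'a span \<Rightarrow> 'a span \<Rightarrow> 'a elt biset_cell" where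
  "span_biset_comp X Y = biset_cell (tensor (span_biset X) (span_biset Y))
      (span_biset (span_comp X Y)) (\<lambda>k g.
     coend_lift (integrand (span_biset X) (span_biset Y) k g) (\<lambda>h z.
       rlift X h g (\<lambda>s x y. rlift Y k h (\<lambda>t z w.
         rin (span_comp X Y) k g (Tup t (Tup s (cmp (fcod (fst X)) y z))) x w) (tsnd z)) (tfst z)))"

lemma span_biset_comp_simps [simp]: "csrc (span_biset_comp X Y) =
    tensor (span_biset X) (span_biset Y)" "ctrg (span_biset_comp X Y) = span_biset (span_comp X Y)"
  by (simp_all add: span_biset_comp_def)

text \<open>The relations in the factors come from the arrows \<open>(\<phi>, 1)\<close> and \<open>(1, \<psi>)\<close> of the iso-comma
    groupoid.\<close>

lemma cmap_span_biset_comp [simp]: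
  assumes XY: "X \<in> spans" "Y \<in> spans" "fcod (snd Y) = fcod (fst X)"
    and obs: "k \<in> ob (fcod (fst Y))" "g \<in> ob (fcod (snd X))" "h \<in> ob (fcod (fst X))"
    and s: "s \<in> ob (apex X)" "x \<in> ar (fcod (snd X))" "src (fcod (snd X)) x = fo (snd X) s"
        "tgt (fcod (snd X)) x = g"
      "y \<in> ar (fcod (fst X))" "src (fcod (fst X)) y = h" "tgt (fcod (fst X)) y = fo (fst X) s"
    and t: "t \<in> ob (apex Y)" "z \<in> ar (fcod (fst X))" "src (fcod (fst X)) z = fo (snd Y) t"
        "tgt (fcod (fst X)) z = h"
      "w \<in> ar (fcod (fst Y))" "src (fcod (fst Y)) w = k" "tgt (fcod (fst Y)) w = fo (fst Y) t"
  shows "cmap (span_biset_comp X Y) k g (tensor_in (span_biset X) (span_biset Y) k g h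
      (rin X h g s x y) (rin Y k h t z w)) =
    rin (span_comp X Y) k g (Tup t (Tup s (cmp (fcod (fst X)) y z))) x w"
proof -
  let ?\<phi> = "\<lambda>k g s x y t z w. rin (span_comp X Y) k g (Tup t (Tup s (cmp (fcod (fst X)) y z))) x w"
  let ?H = "fcod (fst X)"
  have XY': "span_comp X Y \<in> spans"
    using XY by simp
  have right: "rlift Y k h (?\<phi> k g s x y) (rin Y k h t z w) = ?\<phi> k g s x y t z w"
    if "h \<in> ob ?H" "s \<in> ob (apex X)" "x \<in> ar (fcod (snd X))" "src (fcod (snd X)) x = fo (snd X) s"
        "tgt (fcod (snd X)) x = g"
      "y \<in> ar ?H" "src ?H y = h" "tgt ?H y = fo (fst X) s"
      "t \<in> ob (apex Y)" "z \<in> ar ?H" "src ?H z = fo (snd Y) t" "tgt ?H z = h"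
      "w \<in> ar (fcod (fst Y))" "src (fcod (fst Y)) w = k" "tgt (fcod (fst Y)) w = fo (fst Y) t"
          for h s x y t z w
  proof (rule rlift)
    fix m z w
    assume "m \<in> ar (apex Y)" "z \<in> ar (fcod (snd Y))" "src (fcod (snd Y)) z =
        fo (snd Y) (tgt (apex Y) m)"
      "tgt (fcod (snd Y)) z = h" "w \<in> ar (fcod (fst Y))" "src (fcod (fst Y)) w = k"
      "tgt (fcod (fst Y)) w = fo (fst Y) (src (apex Y) m)"
    then show "?\<phi> k g s x y (src (apex Y) m) (cmp (fcod (snd Y)) z (fa (snd Y) m)) w =
        ?\<phi> k g s x y (tgt (apex Y) m) z (cmp (fcod (fst Y)) (fa (fst Y) m) w)"
      using that(1-8) XY XY' obs
        rin_glue[of "span_comp X Y"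
            "Tup (Tup (Tup (src (apex Y) m) (Tup s (cmp ?H y (cmp ?H z (fa (snd Y) m)))))
          (Tup (tgt (apex Y) m) (Tup s (cmp ?H y z)))) (Tup m (idt (apex X) s))" k g x w]
      by simp
  qed (use that XY obs in auto)
  have left: "rlift X h g (\<lambda>s x y. rlift Y k h (?\<phi> k g s x y) c) (rin X h g s x y) =
      rlift Y k h (?\<phi> k g s x y) c"
    if h: "h \<in> ob ?H" and s: "s \<in> ob (apex X)" "x \<in> ar (fcod (snd X))" "src (fcod (snd X)) x =
        fo (snd X) s" "tgt (fcod (snd X)) x = g"
      "y \<in> ar ?H" "src ?H y = h" "tgt ?H y = fo (fst X) s" and c: "c \<in> po (span_biset Y) k h"
          for h s x y c
  proof (rule rlift)
    fix m x y
    assume A: "m \<in> ar (apex X)" "x \<in> ar (fcod (snd X))" "src (fcod (snd X)) x =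
        fo (snd X) (tgt (apex X) m)"
      "tgt (fcod (snd X)) x = g" "y \<in> ar ?H" "src ?H y = h" "tgt ?H y = fo (fst X) (src (apex X) m)"
    show "rlift Y k h (?\<phi> k g (src (apex X) m) (cmp (fcod (snd X)) x (fa (snd X) m)) y) c =
        rlift Y k h (?\<phi> k g (tgt (apex X) m) x (cmp ?H (fa (fst X) m) y)) c"
      using c
    proof (rule span_bisetE)
      fix t z w
      assume B: "c = rin Y k h t z w" "t \<in> ob (apex Y)" "z \<in> ar (fcod (snd Y))"
          "src (fcod (snd Y)) z = fo (snd Y) t"
        "tgt (fcod (snd Y)) z = h" "w \<in> ar (fcod (fst Y))" "src (fcod (fst Y)) w = k"
            "tgt (fcod (fst Y)) w = fo (fst Y) t"
      show ?thesis
        using A B h XY XY' obs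
          rin_glue[of "span_comp X Y" "Tup (Tup (Tup t (Tup (src (apex X) m) (cmp ?H y z)))
          (Tup t (Tup (tgt (apex X) m) (cmp ?H (fa (fst X) m) (cmp ?H y z))))) (Tup (idt (apex Y) t)
              m)" k g x w]
        by (simp add: right)
    qed
  qed (use that XY obs in auto)
  have "coend_lift (integrand (span_biset X) (span_biset Y) k g) (\<lambda>h z.
       rlift X h g (\<lambda>s x y. rlift Y k h (?\<phi> k g s x y) (tsnd z)) (tfst z))
      (tensor_in (span_biset X) (span_biset Y) k g h (rin X h g s x y) (rin Y k h t z w)) =
          ?\<phi> k g s x y t z w"
  proof (subst tensor_in_lift)
    fix m p q
    assume A: "m \<in> ar (pcod (span_biset Y))" "p \<in> po (span_biset X) (tgt (pcod (span_biset Y)) m) g"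
        "q \<in> po (span_biset Y) k (src (pcod (span_biset Y)) m)"
    \<comment> \<open>Balancing over the middle groupoid is associativity: \<open>m\<close> is
      attached to \<open>y\<close> on one side and to \<open>z\<close> on the other, and only the
      composite \<open>y m z\<close> enters the value.\<close>
    show "rlift X (src (pcod (span_biset Y)) m) g (\<lambda>s x y. rlift Y k (src (pcod (span_biset Y)) m)
        (?\<phi> k g s x y)
           (tsnd (Tup (pa (span_biset X) m (idt (pcod (span_biset X)) g) p) q))) (tfst
               (Tup (pa (span_biset X) m (idt (pcod (span_biset X)) g) p) q)) =
        rlift X (tgt (pcod (span_biset Y)) m) g (\<lambda>s x y. rlift Y k (tgt (pcod (span_biset Y)) m)
            (?\<phi> k g s x y)
           (tsnd (Tup p (pa (span_biset Y) (idt (pdom (span_biset Y)) k) m q)))) (tfst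
               (Tup p (pa (span_biset Y) (idt (pdom (span_biset Y)) k) m q)))"
      by (rule span_bisetE[OF A(2)], rule span_bisetE[OF A(3)]) (use A(1) XY obs in \<open>simp add: left
          right\<close>)
  qed (use XY obs s t in \<open>auto simp: left right\<close>)
  then show ?thesis
    unfolding span_biset_comp_def by (subst cell_simps(3)) (use XY obs s t in auto)
qed

lemma span_biset_comp_cells [simp]:
  assumes "X \<in> spans" "Y \<in> spans" "fcod (snd Y) = fcod (fst X)"
  shows "span_biset_comp X Y \<in> biset_cells"
  by (rule biset_cellsI2[OF span_biset_comp_def]) (use assms in \<open>auto elim!: tensorE span_bisetE\<close>)

text \<open>An inverse has to split the connecting arrow \<open>\<gamma>\<close> as
  \<open>y z\<close>. The choice here is \<open>y = 1\<close>, \<open>z = \<gamma>\<close>;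
  balancing over the middle groupoid makes every splitting equivalent to this one.\<close>

lemma invertible_span_biset_comp:
  assumes XY: "X \<in> spans" "Y \<in> spans" "fcod (snd Y) = fcod (fst X)"
  shows "invertible2 Biset (span_biset_comp X Y)"
proof -
  let ?b = "fst X" and ?H = "fcod (fst X)"
  let ?\<phi> = "\<lambda>k g p x w. tensor_in (span_biset X) (span_biset Y) k g (fo ?b (tri2 p))
      (rin X (fo ?b (tri2 p)) g (tri2 p) x (idt ?H (fo ?b (tri2 p)))) (rin Y k (fo ?b (tri2 p))
          (tri1 p) (tri3 p) w)"
  let ?\<sigma> = "\<lambda>k g. rlift (span_comp X Y) k g (?\<phi> k g)"
  have XY': "span_comp X Y \<in> spans"
    using XY by simp
  \<comment> \<open>Balancing along an arrow \<open>(\<phi>, \<psi>)\<close> of the iso-comma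
    groupoid: glue along \<open>\<psi>\<close> in \<open>X\<close>, carry \<open>b \<psi>\<close>
    across the tensor sign, replace \<open>b \<psi> \<gamma>\<close> by
    \<open>\<gamma>' c \<phi>\<close> with \<open>c\<close> the right leg of \<open>Y\<close>, and
    glue along \<open>\<phi>\<close> in \<open>Y\<close>.\<close>
  have compat: "?\<phi> k g (src (apex (span_comp X Y)) m) (cmp (fcod (snd (span_comp X Y))) x
      (fa (snd (span_comp X Y)) m)) w =
      ?\<phi> k g (tgt (apex (span_comp X Y)) m) x (cmp (fcod (fst (span_comp X Y)))
          (fa (fst (span_comp X Y)) m) w)"
    if m: "m \<in> ar (apex (span_comp X Y))" and obs: "k \<in> ob (fcod (fst Y))" "g \<in> ob (fcod (snd X))"
      and x: "x \<in> ar (fcod (snd (span_comp X Y)))"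
        "src (fcod (snd (span_comp X Y))) x = fo (snd (span_comp X Y)) (tgt (apex (span_comp X Y)) m)"
        "tgt (fcod (snd (span_comp X Y))) x = g"
      and w: "w \<in> ar (fcod (fst (span_comp X Y)))" "src (fcod (fst (span_comp X Y))) w = k"
        "tgt (fcod (fst (span_comp X Y))) w = fo (fst (span_comp X Y)) (src (apex (span_comp X Y))
            m)" for k g m x w
  proof -
    from m have "m \<in> ar (isocomma (snd Y) (fst X))"
      by simp
    then show ?thesis
    proof (rule isocomma_arE)
      fix \<phi> \<psi> \<gamma> \<gamma>'
      let ?s = "src (apex X) \<psi>" and ?s' = "tgt (apex X) \<psi>" and ?t = "src (apex Y) \<phi>" and ?t' =
          "tgt (apex Y) \<phi>"
      assume m': "m = Tup (Tup (Tup (src (fdom (snd Y)) \<phi>) (Tup ?s \<gamma>)) (Tup (tgt (fdom (snd Y)) \<phi>)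
          (Tup ?s' \<gamma>'))) (Tup \<phi> \<psi>)"
        and "\<phi> \<in> ar (fdom (snd Y))" "\<psi> \<in> ar (apex X)"
          "\<gamma> \<in> ar (fcod (snd Y))" "src (fcod (snd Y)) \<gamma> = fo (snd Y) (src (fdom (snd Y)) \<phi>)"
              "tgt (fcod (snd Y)) \<gamma> = fo ?b ?s"
          "\<gamma>' \<in> ar (fcod (snd Y))" "src (fcod (snd Y)) \<gamma>' = fo (snd Y) (tgt (fdom (snd Y)) \<phi>)"
              "tgt (fcod (snd Y)) \<gamma>' = fo ?b ?s'"
        and sq: "cmp (fcod (snd Y)) \<gamma>' (fa (snd Y) \<phi>) = cmp (fcod (snd Y)) (fa ?b \<psi>) \<gamma>"
      then have A: "\<phi> \<in> ar (apex Y)" "\<psi> \<in> ar (apex X)"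
          "\<gamma> \<in> ar ?H" "src ?H \<gamma> = fo (snd Y) ?t" "tgt ?H \<gamma> = fo ?b ?s"
          "\<gamma>' \<in> ar ?H" "src ?H \<gamma>' = fo (snd Y) ?t'" "tgt ?H \<gamma>' = fo ?b ?s'"
        using XY by simp_all
      have X': "x \<in> ar (fcod (snd X))" "src (fcod (snd X)) x = fo (snd X) ?s'"
          "tgt (fcod (snd X)) x = g"
        and W: "w \<in> ar (fcod (fst Y))" "src (fcod (fst Y)) w = k" "tgt (fcod (fst Y)) w = fo (fst Y) ?t"
        using x w XY unfolding m' by simp_all
      have "rin X (fo ?b ?s) g ?s (cmp (fcod (snd X)) x (fa (snd X) \<psi>)) (idt ?H (fo ?b ?s)) =
          pa (span_biset X) (fa ?b \<psi>) (idt (fcod (snd X)) g) (rin X (fo ?b ?s') g ?s' x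
              (idt ?H (fo ?b ?s')))"
        using rin_glue[of X \<psi> "fo ?b ?s" g x "idt ?H (fo ?b ?s)"] XY A X' obs by simp
      moreover have "tensor_in (span_biset X) (span_biset Y) k g (fo ?b ?s)
          (pa (span_biset X) (fa ?b \<psi>) (idt (fcod (snd X)) g) (rin X (fo ?b ?s') g ?s' x
              (idt ?H (fo ?b ?s'))))
          (rin Y k (fo ?b ?s) ?t \<gamma> w) =
        tensor_in (span_biset X) (span_biset Y) k g (fo ?b ?s') (rin X (fo ?b ?s') g ?s' x
            (idt ?H (fo ?b ?s')))
          (pa (span_biset Y) (idt (fcod (fst Y)) k) (fa ?b \<psi>) (rin Y k (fo ?b ?s) ?t \<gamma> w))"
        by (subst tensor_in_glue) (use XY A X' W obs in simp_all)
      moreover have "pa (span_biset Y) (idt (fcod (fst Y)) k) (fa ?b \<psi>) (rin Y k (fo ?b ?s) ?t \<gamma> w) =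
          rin Y k (fo ?b ?s') ?t' \<gamma>' (cmp (fcod (fst Y)) (fa (fst Y) \<phi>) w)"
        using rin_glue[of Y \<phi> k "fo ?b ?s'" \<gamma>' w] XY A X' W obs sq by simp
      ultimately show ?thesis
        unfolding m' using XY by simp
    qed
  qed
  have val: "?\<sigma> k g (rin (span_comp X Y) k g (Tup t (Tup s \<gamma>)) x w) =
      tensor_in (span_biset X) (span_biset Y) k g (fo ?b s) (rin X (fo ?b s) g s x
          (idt ?H (fo ?b s))) (rin Y k (fo ?b s) t \<gamma> w)"
    if "k \<in> ob (fcod (fst Y))" "g \<in> ob (fcod (snd X))" "t \<in> ob (apex Y)" "s \<in> ob (apex X)"
      "\<gamma> \<in> ar ?H" "src ?H \<gamma> = fo (snd Y) t" "tgt ?H \<gamma> = fo ?b s"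
      "x \<in> ar (fcod (snd X))" "src (fcod (snd X)) x = fo (snd X) s" "tgt (fcod (snd X)) x = g"
      "w \<in> ar (fcod (fst Y))" "src (fcod (fst Y)) w = k" "tgt (fcod (fst Y)) w = fo (fst Y) t"
          for k g t s \<gamma> x w
    by (subst rlift[OF XY']) (use that XY in \<open>simp_all add: compat[simplified]\<close>)
  \<comment> \<open>Carrying \<open>y\<close> across the tensor sign leaves an identity in the first
    entry, which is the shape of the values of the inverse.\<close>
  have move: "tensor_in (span_biset X) (span_biset Y) k g (fo ?b s) (rin X (fo ?b s) g s x
      (idt ?H (fo ?b s))) (rin Y k (fo ?b s) t (cmp ?H y z) w) =
      tensor_in (span_biset X) (span_biset Y) k g h (rin X h g s x y) (rin Y k h t z w)"
    if "k \<in> ob (fcod (fst Y))" "g \<in> ob (fcod (snd X))" "h \<in> ob ?H"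
      "s \<in> ob (apex X)" "x \<in> ar (fcod (snd X))" "src (fcod (snd X)) x = fo (snd X) s"
          "tgt (fcod (snd X)) x = g"
      "y \<in> ar (fcod (fst X))" "src (fcod (fst X)) y = h" "tgt (fcod (fst X)) y = fo (fst X) s"
      "t \<in> ob (apex Y)" "z \<in> ar (fcod (fst X))" "src (fcod (fst X)) z = fo (snd Y) t"
          "tgt (fcod (fst X)) z = h"
      "w \<in> ar (fcod (fst Y))" "src (fcod (fst Y)) w = k" "tgt (fcod (fst Y)) w = fo (fst Y) t"
          for k g h s x y t z w
    using tensor_in_glue[of "span_biset X" "span_biset Y" "fcod (snd X)"
        k g y h "rin X (fo ?b s) g s x (idt ?H (fo ?b s))" "rin Y k h t z w"]
      that XY by simp
  show ?thesis
  proof (rule invertible2_Biset[where \<sigma> = ?\<sigma>])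
    fix k g c
    assume obs: "k \<in> ob (pdom (csrc (span_biset_comp X Y)))"
        "g \<in> ob (pcod (csrc (span_biset_comp X Y)))" and c: "c \<in> po (csrc (span_biset_comp X Y)) k g"
    from c show "?\<sigma> k g (cmap (span_biset_comp X Y) k g c) = c"
      unfolding span_biset_comp_simps
    proof (rule tensorE)
      fix h p q
      assume D: "c = tensor_in (span_biset X) (span_biset Y) k g h p q"
          "h \<in> ob (pcod (span_biset Y))" "p \<in> po (span_biset X) h g" "q \<in> po (span_biset Y) k h"
      show ?thesis
        by (rule span_bisetE[OF D(3)], rule span_bisetE[OF D(4)]) (use D(1,2) obs XY in \<open>simp add:
            val move\<close>)
    qed
  next
    fix k g c
    assume obs: "k \<in> ob (pdom (csrc (span_biset_comp X Y)))"
        "g \<in> ob (pcod (csrc (span_biset_comp X Y)))" and c: "c \<in> po (ctrg (span_biset_comp X Y)) k g"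
    have "c \<in> po (span_biset (span_comp X Y)) k g"
      using c by simp
    then show "?\<sigma> k g c \<in> po (csrc (span_biset_comp X Y)) k g \<and> cmap (span_biset_comp X Y) k g
        (?\<sigma> k g c) = c"
    proof (rule span_bisetE)
      fix p x w
      assume D: "c = rin (span_comp X Y) k g p x w" "p \<in> ob (apex (span_comp X Y))"
         "x \<in> ar (fcod (snd (span_comp X Y)))" "src (fcod (snd (span_comp X Y))) x =
             fo (snd (span_comp X Y)) p" "tgt (fcod (snd (span_comp X Y))) x = g"
         "w \<in> ar (fcod (fst (span_comp X Y)))" "src (fcod (fst (span_comp X Y))) w = k"
             "tgt (fcod (fst (span_comp X Y))) w = fo (fst (span_comp X Y)) p"
      from D(2) have p: "p \<in> ob (isocomma (snd Y) (fst X))"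
        by simp
      show ?thesis
        by (rule isocomma_obE[OF p]) (use D obs XY in \<open>simp add: val\<close>)
    qed
  qed (use XY in simp)
qed

lemma triple_hcomp_simps: "fst (triple_hcomp X X' Y Y' t t') = isocomma_map X X' Y Y' t t'"
  "fst (snd (triple_hcomp X X' Y Y' t t')) x = fst (snd t') (tri1 x)"
  "snd (snd (triple_hcomp X X' Y Y' t t')) x = snd (snd t) (tri2 x)"
  by (simp_all add: triple_hcomp_eq)

text \<open>With \<open>(f, \<beta>, \<alpha>)\<close> representing \<open>B\<close> and
  \<open>(f', \<beta>', \<alpha>')\<close> representing \<open>A\<close>, both sides give the class
  of \<open>(f' t, f s, \<beta> y z \<alpha>')\<close> with factors \<open>x \<alpha>\<close> and
  \<open>\<beta>' w\<close>.\<close>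

lemma span_biset_comp_natural:
  assumes "A \<in> two Span Y Y'" "B \<in> two Span X X'" and c: "fcod (snd Y) = fcod (fst X)"
  shows "biset_vcomp (span_biset_comp X' Y') (biset_hcomp (span_map B) (span_map A)) =
      biset_vcomp (span_map (span_hcomp B A)) (span_biset_comp X Y)"
proof -
  obtain t where t: "A = span_cell Y Y' t" "span_triple Y Y' t"
    using assms(1) by (rule two_SpanE)
  obtain u where u: "B = span_cell X X' u" "span_triple X X' u"
    using assms(2) by (rule two_SpanE)
  interpret t: triple Y Y' "fst t" "fst (snd t)" "snd (snd t)"
    by (rule span_triple_triple[OF t(2)])
  interpret u: triple X X' "fst u" "fst (snd u)" "snd (snd u)"
    by (rule span_triple_triple[OF u(2)])
  note H = span_triple_hcomp[OF u(2) t(2) c]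
  note cells = span_map_cells[OF t(2)] span_map_cells[OF u(2)] span_map_cells[OF H]
  note vals = cmap_span_map[OF t(2)] cmap_span_map[OF u(2)] cmap_span_map[OF H]
  show ?thesis
    unfolding t(1) u(1) span_hcomp_cell[OF u(2) t(2) c]
    by (rule biset_cell_eqI)
      (use c in \<open>auto simp: cells vals triple_hcomp_simps elim!: tensorE span_bisetE\<close>)
qed

section \<open>The comparison of units\<close>

definition span_biset_unit :: "'a elt cat \<Rightarrow> 'a elt biset_cell" where
  "span_biset_unit G = biset_cell (biset_id G) (span_biset (span_id G)) (\<lambda>h g x. rin (span_id G) h g
      g (idt G g) x)"

lemma span_biset_unit_simps [simp]: "csrc (span_biset_unit G) = biset_id G"
    "ctrg (span_biset_unit G) = span_biset (span_id G)"
  by (simp_all add: span_biset_unit_def)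

lemma cmap_span_biset_unit [simp]:
  "h \<in> ob G \<Longrightarrow> g \<in> ob G \<Longrightarrow> x \<in> hom G h g \<Longrightarrow> cmap (span_biset_unit G) h g x =
      rin (span_id G) h g g (idt G g) x"
  by (simp add: span_biset_unit_def)

text \<open>Glueing along \<open>x\<close>, which is itself an arrow of the apex of the identity
  span, moves it to the right. So a class over \<open>span_id G\<close> is determined by the
  composite \<open>x y\<close>, and composition inverts the unit comparison.\<close>

lemma rin_id:
  assumes "finite_groupoid G" "x \<in> ar G" "y \<in> ar G" "src G y = h" "tgt G y = s" "src G x = s"
      "tgt G x = g"
  shows "rin (span_id G) h g s x y = rin (span_id G) h g g (idt G g) (cmp G x y)"
  using rin_glue[of "span_id G" x h g "idt G g" y] assms by auto

lemma span_biset_unit_cells [simp]: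
  assumes "finite_groupoid G"
  shows "span_biset_unit G \<in> biset_cells"
proof (rule biset_cellsI2[OF span_biset_unit_def])
  fix v u x
  assume "v \<in> ar (pdom (biset_id G))" "u \<in> ar (pcod (biset_id G))"
    "x \<in> po (biset_id G) (tgt (pdom (biset_id G)) v) (src (pcod (biset_id G)) u)"
  then show "cmap (span_biset_unit G) (src (pdom (biset_id G)) v) (tgt (pcod (biset_id G)) u)
      (pa (biset_id G) v u x) =
      pa (span_biset (span_id G)) v u (cmap (span_biset_unit G) (tgt (pdom (biset_id G)) v)
          (src (pcod (biset_id G)) u) x)"
    using assms rin_id[of G u "cmp G x v" "src G v" "src G u" "tgt G u"] by simp
qed (use assms in auto)

lemma invertible_span_biset_unit:
  assumes "finite_groupoid G"
  shows "invertible2 Biset (span_biset_unit G)"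
proof -
  let ?\<sigma> = "\<lambda>h g. rlift (span_id G) h g (\<lambda>s x y. cmp G x y)"
  have val: "?\<sigma> h g (rin (span_id G) h g s x y) = cmp G x y"
    if "h \<in> ob G" "g \<in> ob G" "s \<in> ob G" "x \<in> ar G" "src G x = s" "tgt G x = g" "y \<in> ar G" "src G y =
        h" "tgt G y = s" for h g s x y
    by (subst rlift) (use that assms in auto)
  show ?thesis
  proof (rule invertible2_Biset[where \<sigma> = ?\<sigma>])
    fix h g y
    assume obs: "h \<in> ob (pdom (csrc (span_biset_unit G)))"
        "g \<in> ob (pcod (csrc (span_biset_unit G)))" "y \<in> po (ctrg (span_biset_unit G)) h g"
    then have "y \<in> po (span_biset (span_id G)) h g"
      by simp
    then show "?\<sigma> h g y \<in> po (csrc (span_biset_unit G)) h g \<and>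
        cmap (span_biset_unit G) h g (?\<sigma> h g y) = y"
      by (rule span_bisetE) (use obs assms in \<open>auto simp: val intro: rin_id[symmetric]\<close>)
  qed (use assms in \<open>auto simp: val\<close>)
qed

text \<open>On classes \<open>[u, (x, y)]\<close>, \<open>[v, (z, w)]\<close>,
  \<open>[r, (p, q)]\<close> from \<open>Z\<close>, \<open>Y\<close>, \<open>X\<close> both sides
  give \<open>[((r, v, w p), u, y z), (x, q)]\<close>.\<close>

lemma realization_assoc:
  assumes "X \<in> spans" "Y \<in> spans" "Z \<in> spans" "fcod (snd X) = fcod (fst Y)" "fcod (snd Y) =
      fcod (fst Z)"
  shows "biset_vcomp (span_map (span_assoc Z Y X))
      (biset_vcomp (span_biset_comp (span_comp Z Y) X) (biset_hcomp (span_biset_comp Z Y)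
          (biset_vid (span_biset X)))) =
    biset_vcomp (span_biset_comp Z (span_comp Y X))
      (biset_vcomp (biset_hcomp (biset_vid (span_biset Z)) (span_biset_comp Y X))
          (biset_assoc (span_biset Z) (span_biset Y) (span_biset X)))"
proof -
  note a = span_triple_assoc(1)[OF assms(3,2,1,5,4)]
  show ?thesis
    unfolding span_assoc_cell
    by (rule biset_cell_eqI)
      (use assms in \<open>auto simp: span_map_cells[OF a] cmap_span_map[OF a] elim!: tensorE span_bisetE\<close>)
qed

text \<open>For \<open>x\<close> in the hom set and a class \<open>[s, (p, q)]\<close> the
  comparison produces the object \<open>(s, g, x p)\<close> with factors \<open>1\<close> and
  \<open>q\<close>; the left unitor releases \<open>x p\<close> into the first factor, which is the
  action of \<open>x\<close>.\<close>

lemma realization_lunit: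
  assumes "X \<in> spans" "fcod (snd X) = G"
  shows "biset_vcomp (span_map (span_lunit X)) (biset_vcomp (span_biset_comp (span_id G) X)
      (biset_hcomp (span_biset_unit G) (biset_vid (span_biset X)))) =
    biset_lunit (span_biset X)"
proof -
  note a = span_triple_lunit(1)[OF assms(1) refl]
  have "finite_groupoid G"
    using assms by auto
  then show ?thesis
    unfolding span_lunit_cell assms(2)[symmetric]
    by (intro biset_cell_eqI)
      (use assms in \<open>auto simp: span_map_cells[OF a] cmap_span_map[OF a] elim!: tensorE span_bisetE\<close>)
qed

text \<open>For a class \<open>[s, (x, y)]\<close> and \<open>z\<close> in the hom set the
  connecting arrow is \<open>y\<close>; the right unitor releases it into the second factor, giving
  \<open>[s, (x, y z)]\<close>.\<close>

lemma realization_runit: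
  assumes "X \<in> spans" "fcod (fst X) = H"
  shows "biset_vcomp (span_map (span_runit X)) (biset_vcomp (span_biset_comp X (span_id H))
      (biset_hcomp (biset_vid (span_biset X)) (span_biset_unit H))) =
    biset_runit (span_biset X)"
proof -
  note a = span_triple_runit(1)[OF assms(1) refl]
  have "finite_groupoid H"
    using assms by auto
  then show ?thesis
    unfolding span_runit_cell assms(2)[symmetric]
    by (intro biset_cell_eqI)
      (use assms in \<open>auto simp: span_map_cells[OF a] cmap_span_map[OF a] elim!: tensorE span_bisetE\<close>)
qed

section \<open>Assembling the pseudo-functor\<close>

definition realization :: "('a elt cat, 'a span, 'a span_cell, 'a elt cat, 'a elt prof,
    'a elt biset_cell) psfun" where
  "realization = \<lparr>F0 = (\<lambda>G. G), F1 = span_biset, F2 = span_map, Fcomp = span_biset_comp, Funit =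
      span_biset_unit\<rparr>"

lemma realization_simps [simp]: "F0 realization = (\<lambda>G. G)" "F1 realization = span_biset"
    "F2 realization = span_map" "Fcomp realization = span_biset_comp" "Funit realization =
    span_biset_unit"
  by (simp_all add: realization_def)

lemma span_map_two:
  assumes "A \<in> two Span X X'"
  shows "span_map A \<in> two Biset (span_biset X) (span_biset X')"
proof -
  obtain t where "A = span_cell X X' t" "span_triple X X' t"
    using assms by (rule two_SpanE)
  then show ?thesis
    using two_Span_ends[OF assms] span_map_cells[of X X' t] by simp
qed

lemma pseudo_functor_realization: "pseudo_functor Span Biset realization"
proof (intro pseudo_functor.intro pseudo_functor_axioms.intro bicategory_Span bicategory_Biset,
    goal_cases)
  case (3 A X X')
  then show ?case
    using span_map_two by simp
next
  case (4 X)
  then show ?case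
    using span_map_vid by simp
next
  case (5 A X X' B X'')
  then show ?case
    by (auto elim!: two_SpanE simp: span_map_vcomp simp del: span_vcomp_cell)
next
  case (7 Y H G X K)
  then show ?case
    using invertible_span_biset_comp[of X Y] by simp
next
  case (8 Y H G X K A Y' B X')
  then show ?case
    using span_biset_comp_natural[of A Y Y' B X X'] by simp
next
  case (10 G)
  then show ?case
    using invertible_span_biset_unit[of G] by simp
next
  case (11 X H G Y K Z L)
  then show ?case
    using realization_assoc[of X Y Z] by simp
next
  case (12 X H G)
  then show ?case
    using realization_lunit[of X G] by simp
next
  case (13 X H G)
  then show ?case
    using realization_runit[of X H] by simp
qed auto

section \<open>The category of elements of a biset\<close>

text \<open>For an arrow \<open>(v, u)\<close> from \<open>(h, g, x)\<close> to
  \<open>(h', g', x')\<close> the points are compared in \<open>U(h, g')\<close>, where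
  contravariance in the first variable and covariance in the second let them meet. Arrows carry
  their ends, as in \<open>isocomma\<close>.\<close>

definition elements :: "'a elt prof \<Rightarrow> 'a elt cat" where
  "elements U = (let H = pdom U; G = pcod U;
     Obs = {tri h g x | h g x. h \<in> ob H \<and> g \<in> ob G \<and> x \<in> po U h g}
   in \<lparr>ob = Obs,
       ar = {Tup (Tup p p') (Tup v u) | p p' v u. p \<in> Obs \<and> p' \<in> Obs \<and>
               v \<in> hom H (tri1 p) (tri1 p') \<and> u \<in> hom G (tri2 p) (tri2 p') \<and>
               pa U v (idt G (tri2 p')) (tri3 p') = pa U (idt H (tri1 p)) u (tri3 p)},
       src = (\<lambda>m. tfst (tfst m)),
       tgt = (\<lambda>m. tsnd (tfst m)),
       cmp = (\<lambda>n m. Tup (Tup (tfst (tfst m)) (tsnd (tfst n)))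
                (Tup (cmp H (tri2 n) (tri2 m)) (cmp G (tri3 n) (tri3 m)))),
       idt = (\<lambda>p. Tup (Tup p p) (Tup (idt H (tri1 p)) (idt G (tri2 p))))\<rparr>)"

lemma elements_simps [simp]:
  "src (elements U) m = tfst (tfst m)" "tgt (elements U) m = tsnd (tfst m)"
  "cmp (elements U) n m = Tup (Tup (tfst (tfst m)) (tsnd (tfst n)))
    (Tup (cmp (pdom U) (tri2 n) (tri2 m)) (cmp (pcod U) (tri3 n) (tri3 m)))"
  "idt (elements U) p = Tup (Tup p p) (Tup (idt (pdom U) (tri1 p)) (idt (pcod U) (tri2 p)))"
  "Tup h (Tup g x) \<in> ob (elements U) \<longleftrightarrow> h \<in> ob (pdom U) \<and> g \<in> ob (pcod U) \<and> x \<in> po U h g"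
  "Tup (Tup p p') (Tup v u) \<in> ar (elements U) \<longleftrightarrow> p \<in> ob (elements U) \<and> p' \<in> ob (elements U) \<and>
    v \<in> hom (pdom U) (tri1 p) (tri1 p') \<and> u \<in> hom (pcod U) (tri2 p) (tri2 p') \<and>
    pa U v (idt (pcod U) (tri2 p')) (tri3 p') = pa U (idt (pdom U) (tri1 p)) u (tri3 p)"
  by (auto simp: elements_def Let_def)

lemma elements_obE:
  assumes "p \<in> ob (elements U)"
  obtains h g x where "p = Tup h (Tup g x)" "h \<in> ob (pdom U)" "g \<in> ob (pcod U)" "x \<in> po U h g"
  using assms by (auto simp: elements_def Let_def)

lemma elements_arE:
  assumes "m \<in> ar (elements U)"
  obtains v u x x' where "m = Tup (Tup (Tup (src (pdom U) v) (Tup (src (pcod U) u) x))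
      (Tup (tgt (pdom U) v) (Tup (tgt (pcod U) u) x'))) (Tup v u)"
    "v \<in> ar (pdom U)" "u \<in> ar (pcod U)" "x \<in> po U (src (pdom U) v) (src (pcod U) u)"
    "x' \<in> po U (tgt (pdom U) v) (tgt (pcod U) u)"
    "pa U v (idt (pcod U) (tgt (pcod U) u)) x' = pa U (idt (pdom U) (src (pdom U) v)) u x"
  using assms by (auto simp: elements_def Let_def)

lemma finite_groupoid_elements [simp]:
  assumes "biset U"
  shows "finite_groupoid (elements U)"
proof -
  let ?H = "pdom U" and ?G = "pcod U" and ?E = "elements U"
  have cat: "category ?E"
  proof (rule categoryI)
    fix m n
    assume A: "m \<in> ar ?E" "n \<in> ar ?E" "src ?E n = tgt ?E m"
    from A(1) show "cmp ?E n m \<in> ar ?E \<and> src ?E (cmp ?E n m) = src ?E m \<and> tgt ?E (cmp ?E n m) =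
        tgt ?E n"
    proof (rule elements_arE)
      fix v u x y
      assume m: "m = Tup (Tup (Tup (src ?H v) (Tup (src ?G u) x)) (Tup (tgt ?H v) (Tup (tgt ?G u)
          y))) (Tup v u)"
        "v \<in> ar ?H" "u \<in> ar ?G" "x \<in> po U (src ?H v) (src ?G u)" "y \<in> po U (tgt ?H v) (tgt ?G u)"
        "pa U v (idt ?G (tgt ?G u)) y = pa U (idt ?H (src ?H v)) u x"
      from A(2) show ?thesis
      proof (rule elements_arE)
        fix v' u' x' z
        assume n: "n = Tup (Tup (Tup (src ?H v') (Tup (src ?G u') x')) (Tup (tgt ?H v')
            (Tup (tgt ?G u') z))) (Tup v' u')"
          "v' \<in> ar ?H" "u' \<in> ar ?G" "x' \<in> po U (src ?H v') (src ?G u')"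
              "z \<in> po U (tgt ?H v') (tgt ?G u')"
          "pa U v' (idt ?G (tgt ?G u')) z = pa U (idt ?H (src ?H v')) u' x'"
        have c: "src ?H v' = tgt ?H v" "src ?G u' = tgt ?G u" "x' = y"
          using A(3) m(1) n(1) by auto
        \<comment> \<open>The actions in the two variables commute, which lets the conditions for
          \<open>n\<close> and then for \<open>m\<close> be applied in turn.\<close>
        have "pa U (cmp ?H v' v) (idt ?G (tgt ?G u')) z =
            pa U v (idt ?G (tgt ?G u')) (pa U v' (idt ?G (tgt ?G u')) z)"
          using m(2-5) n(2-5) c assms by simp
        also have "\<dots> = pa U (idt ?H (src ?H v)) u' (pa U v (idt ?G (tgt ?G u)) y)"
          unfolding n(6) c(3) using m(2-5) n(2-5) c assms by simp
        also have "\<dots> = pa U (idt ?H (src ?H v)) (cmp ?G u' u) x"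
          unfolding m(6) using m(2-5) n(2-5) c assms by simp
        finally show ?thesis
          using m n c assms by simp
      qed
    qed
  qed (use assms in \<open>auto elim!: elements_arE elements_obE\<close>)
  have grp: "groupoid ?E"
  proof (rule groupoidI[OF cat])
    fix m
    assume "m \<in> ar ?E"
    then show "\<exists>n \<in> ar ?E. src ?E n = tgt ?E m \<and> tgt ?E n = src ?E m \<and>
      cmp ?E n m = idt ?E (src ?E m) \<and> cmp ?E m n = idt ?E (tgt ?E m)"
    proof (rule elements_arE)
      fix v u x y
      assume m: "m = Tup (Tup (Tup (src ?H v) (Tup (src ?G u) x)) (Tup (tgt ?H v) (Tup (tgt ?G u)
          y))) (Tup v u)"
        "v \<in> ar ?H" "u \<in> ar ?G" "x \<in> po U (src ?H v) (src ?G u)" "y \<in> po U (tgt ?H v) (tgt ?G u)"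
        "pa U v (idt ?G (tgt ?G u)) y = pa U (idt ?H (src ?H v)) u x"
      \<comment> \<open>Acting with both inverses on the condition for \<open>m\<close> yields the
        condition for the inverse arrow.\<close>
      have "pa U (inv_ar ?H v) (inv_ar ?G u) (pa U v (idt ?G (tgt ?G u)) y) =
          pa U (inv_ar ?H v) (inv_ar ?G u) (pa U (idt ?H (src ?H v)) u x)"
        by (simp only: m(6))
      then have "pa U (idt ?H (tgt ?H v)) (inv_ar ?G u) y = pa U (inv_ar ?H v) (idt ?G (src ?G u)) x"
        using m(2-5) assms by simp
      then show ?thesis
        using m assms
        by (intro bexI[of _ "Tup (Tup (Tup (tgt ?H v) (Tup (tgt ?G u) y)) (Tup (src ?H v)
            (Tup (src ?G u) x)))
          (Tup (inv_ar ?H v) (inv_ar ?G u))"]) simp_all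
    qed
  qed
  note fin = finite_groupoid.finite_ob finite_groupoid.finite_ar biset_groupoid[OF assms]
  have "ob ?E = (\<Union>h \<in> ob ?H. \<Union>g \<in> ob ?G. (\<lambda>x. Tup h (Tup g x)) ` po U h g)"
    by (auto elim!: elements_obE)
  then have ob: "finite (ob ?E)"
    using assms by (auto intro!: fin biset.finite_po[OF assms])
  have "ar ?E \<subseteq> (\<lambda>(p, p', v, u). Tup (Tup p p') (Tup v u)) ` (ob ?E \<times> ob ?E \<times> ar ?H \<times> ar ?G)"
    by (auto simp: elements_def Let_def image_iff)
  then have "finite (ar ?E)"
    by (rule finite_subset) (intro finite_imageI finite_cartesian_product fin ob)
  then show ?thesis
    using grp ob by (simp add: finite_groupoid_def finite_groupoid_axioms_def)
qed

section \<open>The span of elements\<close>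

definition elements_span :: "'a elt prof \<Rightarrow> 'a span" where
  "elements_span U =
    (\<lparr>fdom = elements U, fcod = pdom U, fo = (\<lambda>p. tri1 p), fa = (\<lambda>m. tri2 m)\<rparr>,
     \<lparr>fdom = elements U, fcod = pcod U, fo = (\<lambda>p. tri2 p), fa = (\<lambda>m. tri3 m)\<rparr>)"

lemma elements_span_simps [simp]:
  "fdom (fst (elements_span U)) = elements U" "fcod (fst (elements_span U)) = pdom U"
  "fo (fst (elements_span U)) p = tri1 p" "fa (fst (elements_span U)) m = tri2 m"
  "fdom (snd (elements_span U)) = elements U" "fcod (snd (elements_span U)) = pcod U"
  "fo (snd (elements_span U)) p = tri2 p" "fa (snd (elements_span U)) m = tri3 m"
  by (simp_all add: elements_span_def)

lemma elements_span [simp]: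
  assumes "biset U"
  shows "elements_span U \<in> spans"
proof (rule spansI)
  show "cat_functor (fst (elements_span U))" "cat_functor (snd (elements_span U))"
    by (rule cat_functorI; use assms in \<open>auto elim!: elements_arE elements_obE\<close>)+
qed (use assms in auto)

text \<open>Two glueings through the intermediate object \<open>(h, g0, U(v, 1) x)\<close>, along
  the arrows \<open>(v, 1)\<close> and \<open>(1, u)\<close> of the category of elements, absorb
  both arrows into the point.\<close>

lemma rin_elements:
  assumes "biset U" "h0 \<in> ob (pdom U)" "g0 \<in> ob (pcod U)" "x \<in> po U h0 g0"
    and v: "v \<in> ar (pdom U)" "src (pdom U) v = h" "tgt (pdom U) v = h0"
    and u: "u \<in> ar (pcod U)" "src (pcod U) u = g0" "tgt (pcod U) u = g"
  shows "rin (elements_span U) h g (Tup h0 (Tup g0 x)) u v =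
    rin (elements_span U) h g (Tup h (Tup g (pa U v u x))) (idt (pcod U) g) (idt (pdom U) h)"
proof -
  let ?X = "elements_span U"
  let ?p = "Tup h (Tup g0 (pa U v (idt (pcod U) g0) x))"
  have obs: "h \<in> ob (pdom U)" "g \<in> ob (pcod U)"
    using assms by auto
  have "rin ?X h g ?p u (idt (pdom U) h) = rin ?X h g (Tup h0 (Tup g0 x)) u v"
    using rin_glue[of ?X "Tup (Tup ?p (Tup h0 (Tup g0 x))) (Tup v (idt (pcod U) g0))"
        h g u "idt (pdom U) h"]
      assms obs by simp
  moreover have "rin ?X h g ?p u (idt (pdom U) h) =
      rin ?X h g (Tup h (Tup g (pa U v u x))) (idt (pcod U) g) (idt (pdom U) h)"
    using rin_glue[of ?X "Tup (Tup ?p (Tup h (Tup g (pa U v u x)))) (Tup (idt (pdom U) h) u)" h g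
        "idt (pcod U) g" "idt (pdom U) h"] assms obs by simp
  ultimately show ?thesis
    by simp
qed

text \<open>The cell starts at \<open>U\<close>, since
  \<open>x \<mapsto> [(h, g, x), (1, 1)]\<close> needs no lift out of a coend; evaluation serves as
  its pointwise inverse. \<open>rin_elements\<close> gives both naturality and the fact that every
  class is reached.\<close>

lemma isomorphic_elements:
  assumes U: "biset U"
  shows "isomorphic1 Biset U (span_biset (elements_span U))"
proof -
  let ?X = "elements_span U" and ?H = "pdom U" and ?G = "pcod U"
  let ?\<tau> = "\<lambda>h g x. rin ?X h g (Tup h (Tup g x)) (idt ?G g) (idt ?H h)"
  let ?\<alpha> = "biset_cell U (span_biset ?X) ?\<tau>"
  let ?\<sigma> = "\<lambda>h g. rlift ?X h g (\<lambda>p u v. pa U v u (tri3 p))"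
  have \<alpha>: "?\<alpha> \<in> biset_cells"
  proof (rule biset_cellsI)
    fix v u x
    assume "v \<in> ar ?H" "u \<in> ar ?G" "x \<in> po U (tgt ?H v) (src ?G u)"
    then show "?\<tau> (src ?H v) (tgt ?G u) (pa U v u x) =
        pa (span_biset ?X) v u (?\<tau> (tgt ?H v) (src ?G u) x)"
      using U rin_elements[of U "tgt ?H v" "src ?G u" x v "src ?H v" u "tgt ?G u"] by simp
  qed (use U in auto)
  have val: "?\<sigma> h g (rin ?X h g (Tup h0 (Tup g0 x)) u v) = pa U v u x"
    if "h0 \<in> ob ?H" "g0 \<in> ob ?G" "x \<in> po U h0 g0" "v \<in> ar ?H" "src ?H v = h" "tgt ?H v = h0"
      "u \<in> ar ?G" "src ?G u = g0" "tgt ?G u = g" for h g h0 g0 x u v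
  proof (subst rlift)
    fix m u v
    assume m: "m \<in> ar (apex ?X)"
      and u: "u \<in> ar (fcod (snd ?X))" "src (fcod (snd ?X)) u = fo (snd ?X) (tgt (apex ?X) m)"
          "tgt (fcod (snd ?X)) u = g"
      and v: "v \<in> ar (fcod (fst ?X))" "src (fcod (fst ?X)) v = h" "tgt (fcod (fst ?X)) v =
          fo (fst ?X) (src (apex ?X) m)"
    from m have "m \<in> ar (elements U)"
      by simp
    then show "pa U v (cmp (fcod (snd ?X)) u (fa (snd ?X) m)) (tri3 (src (apex ?X) m)) =
        pa U (cmp (fcod (fst ?X)) (fa (fst ?X) m) v) u (tri3 (tgt (apex ?X) m))"
    proof (rule elements_arE)
      fix v' u' x x'
      assume m': "m = Tup (Tup (Tup (src ?H v') (Tup (src ?G u') x)) (Tup (tgt ?H v')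
          (Tup (tgt ?G u') x'))) (Tup v' u')"
        "v' \<in> ar ?H" "u' \<in> ar ?G" "x \<in> po U (src ?H v') (src ?G u')" "x' \<in> po U (tgt ?H v') (tgt ?G u')"
        and eq: "pa U v' (idt ?G (tgt ?G u')) x' = pa U (idt ?H (src ?H v')) u' x"
      \<comment> \<open>Evaluation is balanced: this is \<open>U(v, u)\<close> applied to the
        condition that makes \<open>m\<close> an arrow.\<close>
      have "pa U v u (pa U v' (idt ?G (tgt ?G u')) x') = pa U v u (pa U (idt ?H (src ?H v')) u' x)"
        by (simp only: eq)
      then show ?thesis
        using m' u v U by simp
    qed
  qed (use that U in auto)
  have "invertible2 Biset ?\<alpha>"
  proof (rule invertible2_Biset[OF \<alpha>, where \<sigma> = ?\<sigma>])
    fix h g c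
    assume obs: "h \<in> ob (pdom (csrc ?\<alpha>))" "g \<in> ob (pcod (csrc ?\<alpha>))" "c \<in> po (ctrg ?\<alpha>) h g"
    then have "c \<in> po (span_biset ?X) h g"
      by simp
    then show "?\<sigma> h g c \<in> po (csrc ?\<alpha>) h g \<and> cmap ?\<alpha> h g (?\<sigma> h g c) = c"
    proof (rule span_bisetE)
      fix p u v
      assume A: "c = rin ?X h g p u v" "p \<in> ob (apex ?X)"
        "u \<in> ar (fcod (snd ?X))" "src (fcod (snd ?X)) u = fo (snd ?X) p" "tgt (fcod (snd ?X)) u = g"
        "v \<in> ar (fcod (fst ?X))" "src (fcod (fst ?X)) v = h" "tgt (fcod (fst ?X)) v = fo (fst ?X) p"
      from A(2) have p: "p \<in> ob (elements U)"
        by simp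
      show ?thesis
        by (rule elements_obE[OF p]) (use A obs U in \<open>simp add: val rin_elements[of U _ _ _ v h u g]\<close>)
    qed
  qed (use U in \<open>auto simp: val\<close>)
  then show ?thesis
    unfolding isomorphic1_def using \<alpha> U by (intro bexI[of _ ?\<alpha>]) simp_all
qed

theorem theorem1p1:
  shows "\<exists>R :: ('a elt cat, 'a span, 'a span_cell, 'a elt cat, 'a elt prof, 'a elt biset_cell) psfun.
    pseudo_functor (Span :: ('a elt cat, 'a span, 'a span_cell) bicat) Biset R \<and>
    (\<forall>G. finite_groupoid G \<longrightarrow> F0 R G = G) \<and>
    (\<forall>H G b a. (b, a) \<in> one Span H G \<longrightarrow> F1 R (b, a) = tensor (hom_from a) (hom_to b)) \<and>
    (\<forall>H G U. U \<in> one Biset H G \<longrightarrow>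
       (\<exists>b a. (b, a) \<in> one Span H G \<and> isomorphic1 Biset U (F1 R (b, a))))"
proof (intro exI[of _ realization] conjI allI impI)
  fix H G and U :: "'a elt prof"
  assume "U \<in> one Biset H G"
  then have "elements_span U \<in> one Span H G" "isomorphic1 Biset U (F1 realization (elements_span U))"
    using isomorphic_elements[of U] by auto
  then show "\<exists>b a. (b, a) \<in> one Span H G \<and> isomorphic1 Biset U (F1 realization (b, a))"
    by (metis prod.exhaust)
qed (use pseudo_functor_realization in \<open>auto simp: span_biset_def\<close>)

end
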